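(* Assume that $h=(h_1,h_2)$ satisfies the assumptions (A1), (A2) and (A3) listed in the context (with constants $m_1,m_2,m_3>0$ from (A3)), and set $$\mathfrak K:=\beta-4L^2\big[(d+1)\sigma_{max}(12m_2L^2+2m_3)-\tau\big]_+ .$$ If $\max\{a,\mathfrak K\}>0$, then the total energy $E$ has at least one minimizer $u_*$ in $\bar{S_0}$; that is, $E(u_* )=\min_{\bar{S_0}}E$.
   Context: Fix $H,L,d>0$, $D:=(-L,L)$, $V>0$, $\beta>0$, $\tau\ge0$, $a\ge0$; $[r]_+:=\max\{r,0\}$. Let $$\bar{S_0}:=\{u\in H^2(D): u(\pm L)=\partial_xu(\pm L)=0,\ u\ge-H\text{ in }D\}.$$ For $u\in\bar{S_0}$ put $\Omega_1:=D\times(-H-d,-H)$, $\Omega_2(u):=\{(x,z)\in D\times\mathbb R: -H<z<u(x)\}$, $\Omega(u):=\{(x,z)\in D\times\mathbb R: -H-d<z<u(x)\}$. The function $\sigma_1\in C^2(\overline{\Omega_1})$ is strictly positive, $\sigma_2>0$ is a constant, $\sigma_1(\cdot,-H)\not\equiv\sigma_2$, $\sigma:=\sigma_1$ in $\Omega_1$, $\sigma:=\sigma_2$ in $\Omega_2(u)$, and $\sigma_{max}:=\max\{\sigma_2,\|\sigma_1\|_{C^2(\overline{\Omega_1})}\}$. Assumptions on the boundary data (arguments of $h_i$ are denoted $(x,z,w)$): (A1) $h_1:\bar D\times[-H-d,-H]\times[-H,\infty)\to[0,\infty)$ and $h_2:\bar D\times[-H,\infty)\times[-H,\infty)\to[0,\infty)$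 are $C^2$-functions with $h_1(x,-H,w)=h_2(x,-H,w)$ and $\sigma_1(x,-H)\partial_zh_1(x,-H,w)=\sigma_2\partial_zh_2(x,-H,w)$ for $(x,w)\in D\times[-H,\infty)$. Put $h_u(x,z):=h_1(x,z,u(x))$ on $\overline{\Omega_1}$ and $h_u(x,z):=h_2(x,z,u(x))$ for $x\in D$, $z>-H$. (A2) $h_1(x,-H-d,w)=0$ and $h_2(x,w,w)=V$ for $(x,w)\in\bar D\times[-H,\infty)$. (A3) There are constants $m_1,m_2,m_3>0$ such that $|\partial_xh_1(x,z,w)|+|\partial_zh_1(x,z,w)|\le\sqrt{m_1+m_2w^2}$ and $|\partial_wh_1(x,z,w)|\le\sqrt{m_3}$ for $(x,z,w)\in\bar D\times[-H-d,-H]\times[-H,\infty)$, and $|\partial_xh_2(x,z,w)|+|\partial_zh_2(x,z,w)|\le\sqrt{\frac{m_1+m_2w^2}{H+w}}$ and $|\partial_wh_2(x,z,w)|\le\sqrt{\frac{m_3}{H+w}}$ for $(x,z,w)\in\bar D\times[-H,\infty)\times[-H,\infty)$ (the right-hand sides being $+\infty$ for $w=-H$). $\psi_u$ is the unique function in $h_u+H_0^1(\Omega(u))$ with $\int_{\Omega(u)}\sigma\nabla\psi_u\cdot\nabla\theta\,\mathrm d(x,z)=0$ for all $\theta\in H_0^1(\Omega(u))$. The total energy is $E(u):=E_m(u)+E_e(u)$ with $$E_m(u):=\frac\beta2\|\partial_x^2u\|_{L_2(D)}^2+\Big(\frac\tau2+\frac a4\|\partial_xu\|_{L_2(D)}^2\Big)\|\partial_xu\|_{L_2(D)}^2,\qquad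 E_e(u):=-\frac12\int_{\Omega(u)}\sigma|\nabla\psi_u|^2\,\mathrm d(x,z).$$ *)

theory Defs
  imports "HOL-Analysis.Analysis"
begin

section \<open>Classical differentiability up to the boundary\<close>

definition pd :: "'a::euclidean_space set \<Rightarrow> 'a \<Rightarrow> ('a \<Rightarrow> real) \<Rightarrow> 'a \<Rightarrow> real" where
  "pd S b f x = frechet_derivative f (at x within S) b"

(* Only used for open sets and for products of nondegenerate closed intervals (possibly half-lines).
   There the derivative within S is unique, and on such products this is the usual C^k(S): all
   derivatives of order at most k in the interior extend continuously to S. *)
primrec Ck_on :: "nat \<Rightarrow> ('a::euclidean_space \<Rightarrow> real) \<Rightarrow> 'a set \<Rightarrow> bool" where
  "Ck_on 0 f S \<longleftrightarrow> continuous_on S f"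
| "Ck_on (Suc k) f S \<longleftrightarrow> f differentiable_on S \<and> (\<forall>b\<in>Basis. Ck_on k (pd S b f) S)"

(* The maximum, over all partial derivatives of order at most k, of their sup norms on S;
   intended for f of class C^k on a nonempty compact S. *)
primrec Ck_norm :: "nat \<Rightarrow> ('a::euclidean_space \<Rightarrow> real) \<Rightarrow> 'a set \<Rightarrow> real" where
  "Ck_norm 0 f S = (SUP x\<in>S. \<bar>f x\<bar>)"
| "Ck_norm (Suc k) f S = max (SUP x\<in>S. \<bar>f x\<bar>) (MAX b\<in>Basis. Ck_norm k (pd S b f) S)"

section \<open>Weak derivatives and Sobolev spaces\<close>

(* Elements of Lebesgue and Sobolev spaces are represented by functions; the values outside the
   domain, and on null sets, play no role. *)

definition test_functions :: "'a::euclidean_space set \<Rightarrow> ('a \<Rightarrow> real) set" where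
  "test_functions \<Omega> =
     {\<phi>. (\<forall>k. Ck_on k \<phi> UNIV) \<and> compact (closure {x. \<phi> x \<noteq> 0}) \<and> closure {x. \<phi> x \<noteq> 0} \<subseteq> \<Omega>}"

definition loc_integrable :: "'a::euclidean_space set \<Rightarrow> ('a \<Rightarrow> real) \<Rightarrow> bool" where
  "loc_integrable \<Omega> f \<longleftrightarrow> (\<forall>C. compact C \<and> C \<subseteq> \<Omega> \<longrightarrow> integrable (lebesgue_on C) f)"

definition has_weak_pderiv ::
  "'a::euclidean_space set \<Rightarrow> 'a \<Rightarrow> ('a \<Rightarrow> real) \<Rightarrow> ('a \<Rightarrow> real) \<Rightarrow> bool" where
  "has_weak_pderiv \<Omega> b u g \<longleftrightarrow>
     loc_integrable \<Omega> u \<and> loc_integrable \<Omega> g \<and>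
     (\<forall>\<phi>\<in>test_functions \<Omega>.
        (LINT x|lebesgue_on \<Omega>. u x * pd UNIV b \<phi> x) = - (LINT x|lebesgue_on \<Omega>. g x * \<phi> x))"

(* Weak derivatives are unique up to null sets, so that every use below under an integral sign
   is independent of the choice made here. *)
definition weak_pd :: "'a::euclidean_space set \<Rightarrow> 'a \<Rightarrow> ('a \<Rightarrow> real) \<Rightarrow> 'a \<Rightarrow> real" where
  "weak_pd \<Omega> b u = (SOME g. has_weak_pderiv \<Omega> b u g)"

definition weak_grad :: "'a::euclidean_space set \<Rightarrow> ('a \<Rightarrow> real) \<Rightarrow> 'a \<Rightarrow> 'a" where
  "weak_grad \<Omega> u x = (\<Sum>b\<in>Basis. weak_pd \<Omega> b u x *\<^sub>R b)"

definition L2 :: "'a::euclidean_space set \<Rightarrow> ('a \<Rightarrow> real) set" where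
  "L2 \<Omega> = {f. f \<in> borel_measurable (lebesgue_on \<Omega>) \<and> integrable (lebesgue_on \<Omega>) (\<lambda>x. (f x)\<^sup>2)}"

definition L2_norm :: "'a::euclidean_space set \<Rightarrow> ('a \<Rightarrow> real) \<Rightarrow> real" where
  "L2_norm \<Omega> f = sqrt (LINT x|lebesgue_on \<Omega>. (f x)\<^sup>2)"

primrec Hk :: "nat \<Rightarrow> 'a::euclidean_space set \<Rightarrow> ('a \<Rightarrow> real) set" where
  "Hk 0 \<Omega> = L2 \<Omega>"
| "Hk (Suc k) \<Omega> = {u \<in> L2 \<Omega>. \<forall>b\<in>Basis. \<exists>g\<in>Hk k \<Omega>. has_weak_pderiv \<Omega> b u g}"

definition H1_norm :: "'a::euclidean_space set \<Rightarrow> ('a \<Rightarrow> real) \<Rightarrow> real" where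
  "H1_norm \<Omega> u = sqrt ((L2_norm \<Omega> u)\<^sup>2 + (\<Sum>b\<in>Basis. (L2_norm \<Omega> (weak_pd \<Omega> b u))\<^sup>2))"

definition H10 :: "'a::euclidean_space set \<Rightarrow> ('a \<Rightarrow> real) set" where
  "H10 \<Omega> = {v \<in> Hk 1 \<Omega>. \<forall>\<epsilon>>0. \<exists>\<phi>\<in>test_functions \<Omega>. H1_norm \<Omega> (\<lambda>x. v x - \<phi> x) < \<epsilon>}"

section \<open>Geometry and admissible deflections\<close>

definition D :: "real \<Rightarrow> real set" where
  "D L = {-L<..<L}"

definition Omega1 :: "real \<Rightarrow> real \<Rightarrow> real \<Rightarrow> (real \<times> real) set" where
  "Omega1 H L d = D L \<times> {-H - d<..<-H}"

definition Omega :: "real \<Rightarrow> real \<Rightarrow> real \<Rightarrow> (real \<Rightarrow> real) \<Rightarrow> (real \<times> real) set" where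
  "Omega H L d u = {(x, z). x \<in> D L \<and> -H - d < z \<and> z < u x}"

(* By the embedding of H^2(D) into C^1 of the closed interval, u denotes the continuously
   differentiable representative of its class; this gives the boundary conditions their meaning. *)
definition S0bar :: "real \<Rightarrow> real \<Rightarrow> (real \<Rightarrow> real) set" where
  "S0bar H L = {u \<in> Hk 2 (D L).
     Ck_on 1 u {-L..L} \<and>
     u (-L) = 0 \<and> u L = 0 \<and> pd {-L..L} 1 u (-L) = 0 \<and> pd {-L..L} 1 u L = 0 \<and>
     (\<forall>x\<in>D L. u x \<ge> -H)}"

section \<open>Permittivity and boundary data\<close>

(* Inside Omega H L d u, the second case is the region Omega_2(u) together with a subset of
   the null set z = -H. *)
definition sigma :: "real \<Rightarrow> real \<Rightarrow> real \<Rightarrow> (real \<times> real \<Rightarrow> real) \<Rightarrow> real \<Rightarrow> real \<times> real \<Rightarrow> real" where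
  "sigma H L d \<sigma>\<^sub>1 \<sigma>\<^sub>2 p = (if p \<in> Omega1 H L d then \<sigma>\<^sub>1 p else \<sigma>\<^sub>2)"

definition sigma_max :: "real \<Rightarrow> real \<Rightarrow> real \<Rightarrow> (real \<times> real \<Rightarrow> real) \<Rightarrow> real \<Rightarrow> real" where
  "sigma_max H L d \<sigma>\<^sub>1 \<sigma>\<^sub>2 = max \<sigma>\<^sub>2 (Ck_norm 2 \<sigma>\<^sub>1 (closure (Omega1 H L d)))"

definition admissible_sigma ::
  "real \<Rightarrow> real \<Rightarrow> real \<Rightarrow> (real \<times> real \<Rightarrow> real) \<Rightarrow> real \<Rightarrow> bool" where
  "admissible_sigma H L d \<sigma>\<^sub>1 \<sigma>\<^sub>2 \<longleftrightarrow>
     Ck_on 2 \<sigma>\<^sub>1 (closure (Omega1 H L d)) \<and>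
     (\<forall>p\<in>closure (Omega1 H L d). \<sigma>\<^sub>1 p > 0) \<and>
     \<sigma>\<^sub>2 > 0 \<and>
     (\<exists>x\<in>D L. \<sigma>\<^sub>1 (x, -H) \<noteq> \<sigma>\<^sub>2)"

definition dom_h1 :: "real \<Rightarrow> real \<Rightarrow> real \<Rightarrow> (real \<times> real \<times> real) set" where
  "dom_h1 H L d = {-L..L} \<times> {-H - d..-H} \<times> {-H..}"

definition dom_h2 :: "real \<Rightarrow> real \<Rightarrow> (real \<times> real \<times> real) set" where
  "dom_h2 H L = {-L..L} \<times> {-H..} \<times> {-H..}"

(* Partial derivatives of functions of (x, z, w); at boundary points of S they are one-sided. *)
abbreviation d_x :: "(real \<times> real \<times> real) set \<Rightarrow> (real \<times> real \<times> real \<Rightarrow> real) \<Rightarrow> real \<times> real \<times> real \<Rightarrow> real" where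
  "d_x S \<equiv> pd S (1, 0, 0)"
abbreviation d_z :: "(real \<times> real \<times> real) set \<Rightarrow> (real \<times> real \<times> real \<Rightarrow> real) \<Rightarrow> real \<times> real \<times> real \<Rightarrow> real" where
  "d_z S \<equiv> pd S (0, 1, 0)"
abbreviation d_w :: "(real \<times> real \<times> real) set \<Rightarrow> (real \<times> real \<times> real \<Rightarrow> real) \<Rightarrow> real \<times> real \<times> real \<Rightarrow> real" where
  "d_w S \<equiv> pd S (0, 0, 1)"

definition A1 :: "real \<Rightarrow> real \<Rightarrow> real \<Rightarrow> (real \<times> real \<Rightarrow> real) \<Rightarrow> real \<Rightarrow>
    (real \<times> real \<times> real \<Rightarrow> real) \<Rightarrow> (real \<times> real \<times> real \<Rightarrow> real) \<Rightarrow> bool" where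
  "A1 H L d \<sigma>\<^sub>1 \<sigma>\<^sub>2 h\<^sub>1 h\<^sub>2 \<longleftrightarrow>
     Ck_on 2 h\<^sub>1 (dom_h1 H L d) \<and> (\<forall>p\<in>dom_h1 H L d. h\<^sub>1 p \<ge> 0) \<and>
     Ck_on 2 h\<^sub>2 (dom_h2 H L) \<and> (\<forall>p\<in>dom_h2 H L. h\<^sub>2 p \<ge> 0) \<and>
     (\<forall>x\<in>D L. \<forall>w\<ge>-H.
        h\<^sub>1 (x, -H, w) = h\<^sub>2 (x, -H, w) \<and>
        \<sigma>\<^sub>1 (x, -H) * d_z (dom_h1 H L d) h\<^sub>1 (x, -H, w) = \<sigma>\<^sub>2 * d_z (dom_h2 H L) h\<^sub>2 (x, -H, w))"

definition A2 :: "real \<Rightarrow> real \<Rightarrow> real \<Rightarrow> real \<Rightarrow>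
    (real \<times> real \<times> real \<Rightarrow> real) \<Rightarrow> (real \<times> real \<times> real \<Rightarrow> real) \<Rightarrow> bool" where
  "A2 H L d V h\<^sub>1 h\<^sub>2 \<longleftrightarrow>
     (\<forall>x\<in>{-L..L}. \<forall>w\<ge>-H. h\<^sub>1 (x, -H - d, w) = 0 \<and> h\<^sub>2 (x, w, w) = V)"

(* For w = -H the bounds on the derivatives of h_2 read "at most infinity" and are void, hence
   the restriction w > -H there. *)
definition A3 :: "real \<Rightarrow> real \<Rightarrow> real \<Rightarrow> real \<Rightarrow> real \<Rightarrow> real \<Rightarrow>
    (real \<times> real \<times> real \<Rightarrow> real) \<Rightarrow> (real \<times> real \<times> real \<Rightarrow> real) \<Rightarrow> bool" where
  "A3 H L d m\<^sub>1 m\<^sub>2 m\<^sub>3 h\<^sub>1 h\<^sub>2 \<longleftrightarrow>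
     (\<forall>(x, z, w)\<in>dom_h1 H L d.
        \<bar>d_x (dom_h1 H L d) h\<^sub>1 (x, z, w)\<bar> + \<bar>d_z (dom_h1 H L d) h\<^sub>1 (x, z, w)\<bar> \<le> sqrt (m\<^sub>1 + m\<^sub>2 * w\<^sup>2) \<and>
        \<bar>d_w (dom_h1 H L d) h\<^sub>1 (x, z, w)\<bar> \<le> sqrt m\<^sub>3) \<and>
     (\<forall>(x, z, w)\<in>dom_h2 H L. w > -H \<longrightarrow>
        \<bar>d_x (dom_h2 H L) h\<^sub>2 (x, z, w)\<bar> + \<bar>d_z (dom_h2 H L) h\<^sub>2 (x, z, w)\<bar>
          \<le> sqrt ((m\<^sub>1 + m\<^sub>2 * w\<^sup>2) / (H + w)) \<and>
        \<bar>d_w (dom_h2 H L) h\<^sub>2 (x, z, w)\<bar> \<le> sqrt (m\<^sub>3 / (H + w)))"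

definition h_of :: "real \<Rightarrow> (real \<times> real \<times> real \<Rightarrow> real) \<Rightarrow> (real \<times> real \<times> real \<Rightarrow> real) \<Rightarrow>
    (real \<Rightarrow> real) \<Rightarrow> real \<times> real \<Rightarrow> real" where
  "h_of H h\<^sub>1 h\<^sub>2 u = (\<lambda>(x, z). if z \<le> -H then h\<^sub>1 (x, z, u x) else h\<^sub>2 (x, z, u x))"

section \<open>Electrostatic potential and energy\<close>

definition is_potential :: "real \<Rightarrow> real \<Rightarrow> real \<Rightarrow> (real \<times> real \<Rightarrow> real) \<Rightarrow> real \<Rightarrow>
    (real \<times> real \<times> real \<Rightarrow> real) \<Rightarrow> (real \<times> real \<times> real \<Rightarrow> real) \<Rightarrow> (real \<Rightarrow> real) \<Rightarrow>
    (real \<times> real \<Rightarrow> real) \<Rightarrow> bool" where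
  "is_potential H L d \<sigma>\<^sub>1 \<sigma>\<^sub>2 h\<^sub>1 h\<^sub>2 u \<psi> \<longleftrightarrow>
     (\<lambda>p. \<psi> p - h_of H h\<^sub>1 h\<^sub>2 u p) \<in> H10 (Omega H L d u) \<and>
     (\<forall>\<theta>\<in>H10 (Omega H L d u).
        (LINT p|lebesgue_on (Omega H L d u).
           sigma H L d \<sigma>\<^sub>1 \<sigma>\<^sub>2 p *
           (weak_grad (Omega H L d u) \<psi> p \<bullet> weak_grad (Omega H L d u) \<theta> p)) = 0)"

(* The potential is unique as an element of H^1, that is, up to null sets; a representative
   is chosen. *)
definition psi :: "real \<Rightarrow> real \<Rightarrow> real \<Rightarrow> (real \<times> real \<Rightarrow> real) \<Rightarrow> real \<Rightarrow>
    (real \<times> real \<times> real \<Rightarrow> real) \<Rightarrow> (real \<times> real \<times> real \<Rightarrow> real) \<Rightarrow> (real \<Rightarrow> real) \<Rightarrow>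
    real \<times> real \<Rightarrow> real" where
  "psi H L d \<sigma>\<^sub>1 \<sigma>\<^sub>2 h\<^sub>1 h\<^sub>2 u = (SOME \<psi>. is_potential H L d \<sigma>\<^sub>1 \<sigma>\<^sub>2 h\<^sub>1 h\<^sub>2 u \<psi>)"

definition E_m :: "real \<Rightarrow> real \<Rightarrow> real \<Rightarrow> real \<Rightarrow> (real \<Rightarrow> real) \<Rightarrow> real" where
  "E_m L \<beta> \<tau> a u =
     \<beta> / 2 * (L2_norm (D L) (weak_pd (D L) 1 (weak_pd (D L) 1 u)))\<^sup>2 +
     (\<tau> / 2 + a / 4 * (L2_norm (D L) (weak_pd (D L) 1 u))\<^sup>2) * (L2_norm (D L) (weak_pd (D L) 1 u))\<^sup>2"

definition E_e :: "real \<Rightarrow> real \<Rightarrow> real \<Rightarrow> (real \<times> real \<Rightarrow> real) \<Rightarrow> real \<Rightarrow>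
    (real \<times> real \<times> real \<Rightarrow> real) \<Rightarrow> (real \<times> real \<times> real \<Rightarrow> real) \<Rightarrow> (real \<Rightarrow> real) \<Rightarrow> real" where
  "E_e H L d \<sigma>\<^sub>1 \<sigma>\<^sub>2 h\<^sub>1 h\<^sub>2 u =
     - (1 / 2) * (LINT p|lebesgue_on (Omega H L d u).
        sigma H L d \<sigma>\<^sub>1 \<sigma>\<^sub>2 p *
        (norm (weak_grad (Omega H L d u) (psi H L d \<sigma>\<^sub>1 \<sigma>\<^sub>2 h\<^sub>1 h\<^sub>2 u) p))\<^sup>2)"

definition total_energy :: "real \<Rightarrow> real \<Rightarrow> real \<Rightarrow> real \<Rightarrow> real \<Rightarrow> real \<Rightarrow>
    (real \<times> real \<Rightarrow> real) \<Rightarrow> real \<Rightarrow>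
    (real \<times> real \<times> real \<Rightarrow> real) \<Rightarrow> (real \<times> real \<times> real \<Rightarrow> real) \<Rightarrow> (real \<Rightarrow> real) \<Rightarrow> real" where
  "total_energy H L d \<beta> \<tau> a \<sigma>\<^sub>1 \<sigma>\<^sub>2 h\<^sub>1 h\<^sub>2 u = E_m L \<beta> \<tau> a u + E_e H L d \<sigma>\<^sub>1 \<sigma>\<^sub>2 h\<^sub>1 h\<^sub>2 u"

definition frak_K :: "real \<Rightarrow> real \<Rightarrow> real \<Rightarrow> real \<Rightarrow> real \<Rightarrow> (real \<times> real \<Rightarrow> real) \<Rightarrow> real \<Rightarrow>
    real \<Rightarrow> real \<Rightarrow> real" where
  "frak_K H L d \<beta> \<tau> \<sigma>\<^sub>1 \<sigma>\<^sub>2 m\<^sub>2 m\<^sub>3 =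
     \<beta> - 4 * L\<^sup>2 * max ((d + 1) * sigma_max H L d \<sigma>\<^sub>1 \<sigma>\<^sub>2 * (12 * m\<^sub>2 * L\<^sup>2 + 2 * m\<^sub>3) - \<tau>) 0"

end

theory Submission
  imports Defs "HOL-Complex_Analysis.Great_Picard"
begin

text \<open>The proof is the direct method. Dirichlet's principle makes the electrostatic energy of a deflection u
  the supremum of -J(u, \<phi>)/2 over the test functions \<phi> on \<Omega>(u), where J(u, \<phi>) is the integral of
  \<sigma> times the squared norm of the gradient of h_u + \<phi>. For fixed \<phi>, J(u, \<phi>) is continuous in u with respect to
  convergence in C^1, by dominated convergence; hence the electrostatic energy is lower semicontinuous.
  The choice \<phi> = 0, the growth conditions (A3) and Poincare's inequality make the total energy coercive in H^2,
  and by the theorem of Arzela and Ascoli a minimizing sequence has a subsequence converging in C^1.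
  Weak compactness is replaced by the parallelogram law: almost minimizers of an L2 norm over decreasing sets that
  are closed under midpoints form a Cauchy sequence. This gives the second derivative of the limit, with the lower
  semicontinuity of the bending energy, and also the existence of the potential.\<close>

section \<open>Smooth test functions\<close>

text \<open>The obstacle is that the electrostatic energy is negative and lives on a domain that
  moves with u and may pinch: where u touches -H the upper region degenerates. The argument
  therefore relies neither on uniform extension operators nor on convergence of the potentials. The
  sign helps: minus a minimum of Dirichlet integrals is a supremum, and a supremum of functions
  continuous in u is lower semicontinuous. One competitor \<phi> is frozen; its compact support lies
  in \<Omega>(u), hence in the domains of all uniformly close deflections, so the same function is
  admissible on all of them. The pinching also explains the weight in (A3): the squared gradient of
  \<open>h\<^sub>2\<close> may grow like 1/(H+u), but the column above x has height H+u, so the two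
  cancel; together with the layer of thickness d this gives the factor d+1. Poincare's inequality on
  D, with constant 4L^2, turns the terms in u and its derivative into bending energy, which is where
  4L^2 in \<open>frak_K\<close> comes from. If a > 0, the quartic term absorbs them instead,
  whatever the sign of \<open>frak_K\<close>.\<close>

lemma pd_eqI: "(f has_derivative f') (at x) \<Longrightarrow> pd UNIV b f x = f' b"
  unfolding pd_def by (metis frechet_derivative_at)

lemma pd_real_eqI: "(f has_real_derivative c) (at x) \<Longrightarrow> pd UNIV 1 f x = c"
  by (drule has_field_derivative_imp_has_derivative, drule pd_eqI[of _ _ _ 1]) simp

lemma has_derivative_pd:
  assumes "f differentiable_on UNIV"
  shows "(f has_derivative (\<lambda>h. pd UNIV h f x)) (at x)"
  using assms unfolding differentiable_on_def pd_def by (simp add: frechet_derivative_works[symmetric])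

lemma Ck_on_SucD:
  fixes f :: "'a::euclidean_space \<Rightarrow> real"
  shows "Ck_on (Suc k) f S \<Longrightarrow> Ck_on k f S"
  by (induction k arbitrary: f) (auto intro: differentiable_imp_continuous_on)

lemma Ck_on_const: "Ck_on k (\<lambda>x::'a::euclidean_space. c) UNIV"
proof (induction k arbitrary: c)
  case (Suc k)
  have "pd UNIV b (\<lambda>x::'a. c) = (\<lambda>x. 0)" for b by (auto intro!: ext pd_eqI derivative_eq_intros)
  with Suc show ?case by simp
qed simp

lemma Ck_on_add:
  fixes f g :: "'a::euclidean_space \<Rightarrow> real"
  shows "Ck_on k f UNIV \<Longrightarrow> Ck_on k g UNIV \<Longrightarrow> Ck_on k (\<lambda>x. f x + g x) UNIV"
proof (induction k arbitrary: f g)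
  case (Suc k)
  have "pd UNIV b (\<lambda>x. f x + g x) = (\<lambda>x. pd UNIV b f x + pd UNIV b g x)" for b
    using Suc.prems by (intro ext pd_eqI) (auto intro!: derivative_eq_intros has_derivative_pd)
  with Suc show ?case by auto
qed (auto intro!: continuous_intros)

lemma Ck_on_mult:
  fixes f g :: "'a::euclidean_space \<Rightarrow> real"
  shows "Ck_on k f UNIV \<Longrightarrow> Ck_on k g UNIV \<Longrightarrow> Ck_on k (\<lambda>x. f x * g x) UNIV"
proof (induction k arbitrary: f g)
  case (Suc k)
  have "pd UNIV b (\<lambda>x. f x * g x) = (\<lambda>x. f x * pd UNIV b g x + pd UNIV b f x * g x)" for b
    using Suc.prems by (intro ext pd_eqI) (auto intro!: derivative_eq_intros has_derivative_pd)
  moreover have "Ck_on k f UNIV" "Ck_on k g UNIV" using Suc.prems Ck_on_SucD by blast+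
  ultimately show ?case using Suc by (auto intro!: Ck_on_add differentiable_on_mult)
qed (auto intro!: continuous_intros)

lemma Ck_on_diff:
  fixes f g :: "'a::euclidean_space \<Rightarrow> real"
  assumes "Ck_on k f UNIV" "Ck_on k g UNIV" shows "Ck_on k (\<lambda>x. f x - g x) UNIV"
  using Ck_on_add[OF assms(1) Ck_on_mult[OF Ck_on_const[of k "-1"] assms(2)]] by simp

lemma Ck_on_power:
  fixes f :: "'a::euclidean_space \<Rightarrow> real"
  assumes "Ck_on k f UNIV" shows "Ck_on k (\<lambda>x. f x ^ n) UNIV"
  by (induction n) (auto intro!: Ck_on_mult Ck_on_const assms)

lemma Ck_on_prod:
  fixes f :: "'i \<Rightarrow> 'a::euclidean_space \<Rightarrow> real"
  assumes "\<And>i. i \<in> I \<Longrightarrow> Ck_on k (f i) UNIV" shows "Ck_on k (\<lambda>x. \<Prod>i\<in>I. f i x) UNIV"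
  using assms by (induction I rule: infinite_finite_induct) (auto intro!: Ck_on_mult Ck_on_const)

text \<open>The only kind of composition that the constructions require: box bumps apply a function
  of one variable to coordinates and their reflections, and the test functions of the Hoelder
  estimate are differences of translates. A chain rule for general C^k maps is thereby
  avoided.\<close>

lemma Ck_on_affine:
  fixes g :: "real \<Rightarrow> real" and c :: "'a::euclidean_space"
  shows "Ck_on k g UNIV \<Longrightarrow> Ck_on k (\<lambda>x. g (x \<bullet> c + e)) UNIV"
proof (induction k arbitrary: g)
  case 0
  then show ?case by (auto intro!: continuous_intros continuous_on_compose2[of UNIV g])
next
  case (Suc k)
  have d: "((\<lambda>x. g (x \<bullet> c + e)) has_derivative (\<lambda>h. pd UNIV 1 g (x \<bullet> c + e) * (h \<bullet> c))) (at x)" for x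
  proof -
    have "(g has_derivative (\<lambda>h. pd UNIV h g (x \<bullet> c + e))) (at (x \<bullet> c + e))"
      using Suc.prems by (auto intro: has_derivative_pd)
    \<comment> \<open>On the real line the derivative is multiplication by its value at 1, the only
      direction that \<open>Ck_on\<close> controls.\<close>
    moreover have lin: "pd UNIV h g y = pd UNIV 1 g y * h" for h y
    proof -
      have "(g has_derivative (\<lambda>h. pd UNIV h g y)) (at y)" using Suc.prems by (auto intro: has_derivative_pd)
      then have "linear (\<lambda>h. pd UNIV h g y)" by (rule has_derivative_linear)
      from linear_scale[OF this, of h 1] show ?thesis by simp
    qed
    ultimately have "(g has_derivative (\<lambda>h. pd UNIV 1 g (x \<bullet> c + e) * h)) (at (x \<bullet> c + e))"
      by (elim has_derivative_eq_rhs) (rule ext, rule lin)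
    moreover have "((\<lambda>x. x \<bullet> c + e) has_derivative (\<lambda>h. h \<bullet> c)) (at x)"
      by (auto intro!: derivative_eq_intros)
    ultimately show ?thesis by (rule has_derivative_compose[rotated])
  qed
  then have "pd UNIV b (\<lambda>x. g (x \<bullet> c + e)) = (\<lambda>x. pd UNIV 1 g (x \<bullet> c + e) * (b \<bullet> c))" for b
    by (intro ext pd_eqI)
  moreover have "(\<lambda>x. g (x \<bullet> c + e)) differentiable_on UNIV"
    using d unfolding differentiable_on_def differentiable_def by blast
  ultimately show ?case using Suc by (auto intro!: Ck_on_mult Ck_on_const)
qed

text \<open>The case n = 0 is the classical function exp(-1/t), extended by 0. The powers of 1/t are
  included because they make the family closed under differentiation up to linear combinations, so
  that a single induction shows smoothness of all its members.\<close>

definition flat :: "nat \<Rightarrow> real \<Rightarrow> real" where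
  "flat n t = (if t > 0 then exp (- (1 / t)) / t ^ n else 0)"

text \<open>One term of the exponential series at 1/t is at most exp(1/t). The term of order n+2
  beats the pole of order n and leaves t^2, enough for a zero derivative at the origin.\<close>

lemma flat_bound: "\<bar>flat n t\<bar> \<le> fact (n + 2) * t\<^sup>2"
proof (cases "t > 0")
  case True
  have "(1/t) ^ (n+2) / fact (n+2) \<le> exp (1/t)"
  proof -
    have "(1/t) ^ (n+2) / fact (n+2) = (\<Sum>k\<in>{n+2}. (1/t) ^ k / fact k)" by simp
    also have "\<dots> \<le> (\<Sum>k. (1/t) ^ k / fact k)"
      using True summable_exp_generic[of "1/t"] by (intro sum_le_suminf) (auto simp: divide_inverse ac_simps)
    also have "\<dots> = exp (1/t)" by (simp add: exp_def divide_inverse ac_simps)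
    finally show ?thesis .
  qed
  then have "1 \<le> exp (1/t) * (fact (n+2) * t ^ (n+2))" using True
    by (simp add: power_divide pos_divide_le_eq divide_le_eq del: fact_Suc power_Suc)
       (simp add: mult.commute mult.left_commute)?
  then have "exp (-(1/t)) \<le> fact (n+2) * t ^ (n+2)" by (simp add: exp_minus field_simps)
  then show ?thesis using True unfolding flat_def
    by (simp add: pos_divide_le_eq power_add power2_eq_square mult.assoc mult.commute mult.left_commute del: fact_Suc)
qed (simp add: flat_def)

lemma flat_deriv:
  "(flat n has_real_derivative (flat (n+2) t - real n * flat (n+1) t)) (at t)"
proof -
  consider "t > 0" | "t < 0" | "t = 0" by linarith
  then show ?thesis
  proof cases
    case 1
    have "((\<lambda>t. exp (- (1 / t)) / t ^ n) has_real_derivative (flat (n+2) t - real n * flat (n+1) t)) (at t)"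
    proof -
      have "((\<lambda>t. exp (- (1 / t)) * (1 / t) ^ n) has_real_derivative
          exp (- (1 / t)) * (1 / t\<^sup>2) * (1 / t) ^ n + exp (- (1 / t)) * (real n * (- 1 / t\<^sup>2) * (1 / t) ^ (n - 1))) (at t)"
        using 1 by (auto intro!: derivative_eq_intros simp: power2_eq_square)
      moreover have r: "real n * (- 1 / t\<^sup>2) * (1 / t) ^ (n - 1) = - (real n * (1 / t) ^ (n + 1))"
        by (cases n) (auto simp: power2_eq_square)
      moreover have "exp (- (1 / t)) * (1 / t\<^sup>2) * (1 / t) ^ n + exp (- (1 / t)) * (- (real n * (1 / t) ^ (n + 1)))
          = flat (n+2) t - real n * flat (n+1) t"
        using 1 by (simp add: flat_def power_divide power2_eq_square algebra_simps)
      moreover have "(\<lambda>t. exp (- (1 / t)) * (1 / t) ^ n) = (\<lambda>t::real. exp (- (1 / t)) / t ^ n)"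
        by (simp add: power_divide fun_eq_iff)
      ultimately show ?thesis by (simp only: r)
    qed
    then show ?thesis
      by (rule has_field_derivative_transform_within_open[of _ _ _ "{0<..}"]) (use 1 in \<open>auto simp: flat_def\<close>)
  next
    case 2
    have "((\<lambda>t. 0) has_real_derivative (flat (n+2) t - real n * flat (n+1) t)) (at t)"
      using 2 by (auto simp: flat_def)
    then show ?thesis
      by (rule has_field_derivative_transform_within_open[of _ _ _ "{..<0}"]) (use 2 in \<open>auto simp: flat_def\<close>)
  next
    case 3
    \<comment> \<open>The quadratic bound makes the difference quotient at the origin of order
      |h|.\<close>
    have "((\<lambda>h. flat n h / h) \<longlongrightarrow> 0) (at 0)"
    proof (rule Lim_null_comparison)
      show "\<forall>\<^sub>F h in at 0. norm (flat n h / h) \<le> fact (n+2) * \<bar>h\<bar>"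
        unfolding eventually_at_filter
      proof (rule always_eventually, intro allI impI)
        fix h :: real assume "h \<noteq> 0"
        have "\<bar>flat n h\<bar> \<le> fact (n+2) * \<bar>h\<bar> * \<bar>h\<bar>"
          using flat_bound[of n h] by (simp add: power2_eq_square mult.assoc del: fact_Suc)
        with \<open>h \<noteq> 0\<close> show "norm (flat n h / h) \<le> fact (n+2) * \<bar>h\<bar>"
          by (simp add: abs_divide pos_divide_le_eq del: fact_Suc)
      qed
      show "((\<lambda>h. fact (n+2) * \<bar>h\<bar>) \<longlongrightarrow> (0::real)) (at 0)" by (auto intro!: tendsto_eq_intros)
    qed
    then show ?thesis using 3 by (simp add: DERIV_def flat_def)
  qed
qed

lemma Ck_on_flat: "Ck_on k (flat n) UNIV"
proof (induction k arbitrary: n)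
  case 0
  then show ?case using flat_deriv by (auto intro!: DERIV_continuous_on)
next
  case (Suc k)
  have "pd UNIV 1 (flat n) = (\<lambda>t. flat (n+2) t - real n * flat (n+1) t)"
    by (intro ext pd_real_eqI flat_deriv)
  moreover have "flat n differentiable_on UNIV" using flat_deriv
    unfolding differentiable_on_def by (meson has_field_derivative_imp_has_derivative differentiable_def)
  ultimately show ?case using Suc by (auto intro!: Ck_on_diff Ck_on_mult Ck_on_const)
qed

definition box_bump :: "'a::euclidean_space \<Rightarrow> 'a \<Rightarrow> 'a \<Rightarrow> real" where
  "box_bump a b x = (\<Prod>i\<in>Basis. flat 0 (x \<bullet> i - a \<bullet> i) * flat 0 (b \<bullet> i - x \<bullet> i))"

lemma Ck_on_box_bump: "Ck_on k (box_bump a b) UNIV"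
proof -
  have 1: "Ck_on k (\<lambda>x. flat 0 (x \<bullet> i - a \<bullet> i)) UNIV" for i
    using Ck_on_affine[OF Ck_on_flat[of k 0], of i "- (a \<bullet> i)"] by simp
  have 2: "Ck_on k (\<lambda>x. flat 0 (b \<bullet> i - x \<bullet> i)) UNIV" for i
    using Ck_on_affine[OF Ck_on_flat[of k 0], of "-i" "b \<bullet> i"] by simp
  have "Ck_on k (\<lambda>x. \<Prod>i\<in>Basis. flat 0 (x \<bullet> i - a \<bullet> i) * flat 0 (b \<bullet> i - x \<bullet> i)) UNIV"
    by (intro Ck_on_prod Ck_on_mult 1 2)
  then show ?thesis unfolding box_bump_def .
qed

lemma flat_0_bounds: "0 \<le> flat 0 t" "flat 0 t \<le> 1" "flat 0 t > 0 \<longleftrightarrow> t > 0"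
  by (auto simp: flat_def)

lemma box_bump_bounds:
  "0 \<le> box_bump a b x" "box_bump a b x \<le> 1"
  "x \<in> box a b \<Longrightarrow> box_bump a b x > 0" "x \<notin> box a b \<Longrightarrow> box_bump a b x = 0"
proof -
  show "0 \<le> box_bump a b x" unfolding box_bump_def by (intro prod_nonneg) (auto simp: flat_0_bounds)
  show "box_bump a b x \<le> 1" unfolding box_bump_def
    by (intro prod_le_1) (auto simp: flat_0_bounds intro!: mult_le_one)
  show "x \<in> box a b \<Longrightarrow> box_bump a b x > 0" unfolding box_bump_def
    by (intro prod_pos) (auto simp: flat_0_bounds mem_box intro!: mult_pos_pos)
  assume "x \<notin> box a b"
  then obtain i where "i \<in> Basis" "\<not> (a \<bullet> i < x \<bullet> i \<and> x \<bullet> i < b \<bullet> i)" by (auto simp: mem_box)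
  then have "flat 0 (x \<bullet> i - a \<bullet> i) * flat 0 (b \<bullet> i - x \<bullet> i) = 0" by (auto simp: flat_def)
  with \<open>i \<in> Basis\<close> show "box_bump a b x = 0" unfolding box_bump_def
    by (intro prod_zero) auto
qed

section \<open>Test functions: supports, algebra, bounds, approximation of boxes\<close>

lemma test_functionsI:
  assumes "\<And>k. Ck_on k \<phi> UNIV" "compact K" "\<And>x. x \<notin> K \<Longrightarrow> \<phi> x = 0" "K \<subseteq> \<Omega>"
  shows "\<phi> \<in> test_functions \<Omega>"
proof -
  have "closure {x. \<phi> x \<noteq> 0} \<subseteq> K"
    using assms(2,3) by (intro closure_minimal) (auto simp: compact_imp_closed)
  then show ?thesis unfolding test_functions_def
    using assms(1,4) closed_Int_compact[OF closed_closure[of "{x. \<phi> x \<noteq> 0}"] assms(2)]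
    by (auto simp: Int_absorb2)
qed

lemma test_functionsE:
  assumes "\<phi> \<in> test_functions \<Omega>"
  obtains K where "compact K" "K \<subseteq> \<Omega>" "\<And>x. x \<notin> K \<Longrightarrow> \<phi> x = 0" "\<And>x b. x \<notin> K \<Longrightarrow> pd UNIV b \<phi> x = 0"
proof
  let ?K = "closure {x. \<phi> x \<noteq> 0}"
  show "compact ?K" "?K \<subseteq> \<Omega>" using assms unfolding test_functions_def by auto
  show "\<phi> x = 0" if "x \<notin> ?K" for x using that closure_subset[of "{x. \<phi> x \<noteq> 0}"] by auto
  then have *: "\<phi> x = 0" if "x \<in> - ?K" for x using that by blast
  show "pd UNIV b \<phi> x = 0" if "x \<notin> ?K" for x b
  proof -
    have "((\<lambda>x. 0) has_derivative (\<lambda>h. 0::real)) (at x)" by simp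
    moreover have "open (- ?K)" by (rule open_Compl) (rule closed_closure)
    moreover have "x \<in> - ?K" using that by blast
    ultimately have "(\<phi> has_derivative (\<lambda>h. 0)) (at x)"
      by (rule has_derivative_transform_within_open) (rule *[symmetric])
    then show ?thesis by (rule pd_eqI)
  qed
qed

lemma test_functions_Ck: "\<phi> \<in> test_functions \<Omega> \<Longrightarrow> Ck_on k \<phi> UNIV"
  by (simp add: test_functions_def)

lemma test_functions_differentiable:
  assumes "\<phi> \<in> test_functions \<Omega>"
  shows "\<phi> differentiable_on UNIV" "continuous_on UNIV \<phi>"
    "\<And>x. (\<phi> has_derivative (\<lambda>h. pd UNIV h \<phi> x)) (at x)"
    "b \<in> Basis \<Longrightarrow> continuous_on UNIV (pd UNIV b \<phi>)"
  using test_functions_Ck[OF assms, of 1] test_functions_Ck[OF assms, of 0]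
  by (auto intro: has_derivative_pd)

text \<open>Differentiation along lines is the form in which classical derivatives enter all
  integrations by parts below.\<close>

lemma test_functions_line_derivative:
  assumes "\<phi> \<in> test_functions \<Omega>"
  shows "((\<lambda>t. \<phi> (p + t *\<^sub>R b)) has_real_derivative pd UNIV b \<phi> p) (at 0)"
proof -
  note \<phi>d = test_functions_differentiable(3)[OF assms]
  have lin: "((\<lambda>t. p + t *\<^sub>R b) has_derivative (\<lambda>t. t *\<^sub>R b)) (at 0)" by (auto intro!: derivative_eq_intros)
  have "(\<phi> has_derivative (\<lambda>h. pd UNIV h \<phi> p)) (at (p + 0 *\<^sub>R b))" using \<phi>d[of p] by simp
  then have c: "((\<lambda>t. \<phi> (p + t *\<^sub>R b)) has_derivative (\<lambda>t. pd UNIV (t *\<^sub>R b) \<phi> p)) (at 0)"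
    by (rule has_derivative_compose[OF lin])
  have "pd UNIV (t *\<^sub>R b) \<phi> p = pd UNIV b \<phi> p * t" for t
    using linear_scale[OF has_derivative_linear[OF \<phi>d[of p]], of t b] by simp
  with c show ?thesis by (simp add: has_field_derivative_def mult_commute_abs)
qed

lemma test_functions_add:
  assumes "\<phi> \<in> test_functions \<Omega>" "\<eta> \<in> test_functions \<Omega>"
  shows "(\<lambda>x. \<phi> x + \<eta> x) \<in> test_functions \<Omega>"
    "pd UNIV b (\<lambda>x. \<phi> x + \<eta> x) x = pd UNIV b \<phi> x + pd UNIV b \<eta> x"
proof -
  obtain K where K: "compact K" "K \<subseteq> \<Omega>" "\<And>x. x \<notin> K \<Longrightarrow> \<phi> x = 0" using test_functionsE[OF assms(1)] by metis
  obtain K' where K': "compact K'" "K' \<subseteq> \<Omega>" "\<And>x. x \<notin> K' \<Longrightarrow> \<eta> x = 0" using test_functionsE[OF assms(2)] by metis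
  show "(\<lambda>x. \<phi> x + \<eta> x) \<in> test_functions \<Omega>"
    using K K' by (intro test_functionsI[of _ "K \<union> K'"] Ck_on_add test_functions_Ck[OF assms(1)] test_functions_Ck[OF assms(2)]) auto
  show "pd UNIV b (\<lambda>x. \<phi> x + \<eta> x) x = pd UNIV b \<phi> x + pd UNIV b \<eta> x"
    by (intro pd_eqI) (auto intro!: derivative_eq_intros test_functions_differentiable(3) assms)
qed

lemma test_functions_cmult:
  assumes "\<phi> \<in> test_functions \<Omega>"
  shows "(\<lambda>x. c * \<phi> x) \<in> test_functions \<Omega>"
    "pd UNIV b (\<lambda>x. c * \<phi> x) x = c * pd UNIV b \<phi> x"
proof -
  obtain K where K: "compact K" "K \<subseteq> \<Omega>" "\<And>x. x \<notin> K \<Longrightarrow> \<phi> x = 0" using test_functionsE[OF assms(1)] by metis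
  show "(\<lambda>x. c * \<phi> x) \<in> test_functions \<Omega>"
    using K by (intro test_functionsI[of _ K] Ck_on_mult Ck_on_const test_functions_Ck[OF assms(1)]) auto
  show "pd UNIV b (\<lambda>x. c * \<phi> x) x = c * pd UNIV b \<phi> x"
    by (intro pd_eqI) (auto intro!: derivative_eq_intros test_functions_differentiable(3) assms)
qed

lemma zero_test_function: "(\<lambda>x. 0) \<in> test_functions \<Omega>" "pd UNIV b (\<lambda>x. 0) x = 0"
  by (intro test_functionsI[of _ "{}"] Ck_on_const; simp)
     (auto intro!: pd_eqI derivative_eq_intros)

lemma test_functions_bounded:
  assumes "\<phi> \<in> test_functions \<Omega>"
  obtains B where "B \<ge> 0" "\<And>x. \<bar>\<phi> x\<bar> \<le> B" "\<And>x b. b \<in> Basis \<Longrightarrow> \<bar>pd UNIV b \<phi> x\<bar> \<le> B"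
proof -
  obtain K where K: "compact K" "\<And>x. x \<notin> K \<Longrightarrow> \<phi> x = 0" "\<And>x b. x \<notin> K \<Longrightarrow> pd UNIV b \<phi> x = 0"
    using test_functionsE[OF assms] by metis
  have bd: "\<exists>B\<ge>0. \<forall>x. \<bar>f x\<bar> \<le> B" if "continuous_on UNIV f" "\<And>x. x \<notin> K \<Longrightarrow> f x = 0" for f :: "'a \<Rightarrow> real"
  proof -
    have "bounded (f ` K)" using K(1) that(1) by (meson compact_continuous_image compact_imp_bounded continuous_on_subset subset_UNIV)
    then obtain B where "\<forall>y\<in>f ` K. norm y \<le> B" by (auto simp: bounded_iff)
    then have "\<bar>f x\<bar> \<le> max B 0" for x using that(2)[of x] by (cases "x \<in> K") (auto simp: le_max_iff_disj)
    then show ?thesis by (meson max.cobounded2)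
  qed
  obtain B0 where B0: "B0 \<ge> 0" "\<And>x. \<bar>\<phi> x\<bar> \<le> B0"
    using bd[of \<phi>] test_functions_differentiable(2)[OF assms] K(2) by auto
  have "\<exists>B\<ge>0. \<forall>x. \<bar>pd UNIV b \<phi> x\<bar> \<le> B" if "b \<in> Basis" for b
    using bd[of "pd UNIV b \<phi>"] test_functions_differentiable(4)[OF assms that] K(3) by auto
  then obtain B where B: "\<And>b. b \<in> Basis \<Longrightarrow> B b \<ge> 0" "\<And>b x. b \<in> Basis \<Longrightarrow> \<bar>pd UNIV b \<phi> x\<bar> \<le> B b" by metis
  show ?thesis
  proof
    show "B0 + (\<Sum>b\<in>Basis. B b) \<ge> 0" using B B0 by (simp add: sum_nonneg)
    show "\<bar>\<phi> x\<bar> \<le> B0 + (\<Sum>b\<in>Basis. B b)" for x using B0(2)[of x] sum_nonneg[of Basis B] B(1) by fastforce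
    show "\<bar>pd UNIV b \<phi> x\<bar> \<le> B0 + (\<Sum>b\<in>Basis. B b)" if "b \<in> Basis" for b x
      using B(2)[OF that, of x] member_le_sum[of b Basis B] that B(1) B0(1) by force
  qed
qed

text \<open>The functions 1 - (1 - b)^n, with b the bump of the box, increase to the indicator of
  the open box, because 0 < b \<le> 1 exactly there. Powers keep both smoothness and support, so no
  rescaling of bumps is required.\<close>

lemma box_approximation:
  fixes a b :: "'a::euclidean_space"
  assumes "cbox a b \<subseteq> \<Omega>"
  obtains \<phi> where "\<And>n::nat. \<phi> n \<in> test_functions \<Omega>" "\<And>n x. 0 \<le> \<phi> n x" "\<And>n x. \<phi> n x \<le> indicator (box a b) x"
    "\<And>x. (\<lambda>n. \<phi> n x) \<longlonglongrightarrow> indicator (box a b) x"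
proof
  let ?\<phi> = "\<lambda>n x. 1 - (1 - box_bump a b x) ^ n"
  have "box_bump a b x = 0" if "x \<notin> cbox a b" for x
    using that box_subset_cbox[of a b] by (intro box_bump_bounds(4)) auto
  then show "?\<phi> n \<in> test_functions \<Omega>" for n
    using assms
    by (intro test_functionsI[of _ "cbox a b"] Ck_on_diff Ck_on_power Ck_on_const Ck_on_box_bump)
       auto
  have p: "0 \<le> (1 - box_bump a b x) ^ n" for n x using box_bump_bounds(2)[of a b x] by simp
  show "0 \<le> ?\<phi> n x" for n x using box_bump_bounds(1,2)[of a b x] by (simp add: power_le_one)
  show "?\<phi> n x \<le> indicator (box a b) x" for n x
    using p[of x n] by (cases "x \<in> box a b") (auto simp: box_bump_bounds)
  show "(\<lambda>n. ?\<phi> n x) \<longlonglongrightarrow> indicator (box a b) x" for x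
  proof (cases "x \<in> box a b")
    case True
    then have "(\<lambda>n. (1 - box_bump a b x) ^ n) \<longlonglongrightarrow> 0"
      using box_bump_bounds(2)[of a b x] box_bump_bounds(3)[of x a b] by (intro LIMSEQ_realpow_zero) auto
    from tendsto_diff[OF tendsto_const[of 1] this] True show ?thesis by simp
  qed (simp add: box_bump_bounds)
qed

section \<open>Square-integrable functions\<close>

text \<open>Stated for an arbitrary measure and vector values, so that functions, gradients and
  weighted gradients share one L2 theory. Together with \<open>nsq\<close> it works with functions
  and squared norms throughout, without quotients and without the triangle inequality of the
  norm.\<close>

definition sqint :: "'a measure \<Rightarrow> ('a \<Rightarrow> 'b::euclidean_space) \<Rightarrow> bool" where
  "sqint M f \<longleftrightarrow> f \<in> borel_measurable M \<and> integrable M (\<lambda>x. (norm (f x))\<^sup>2)"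

abbreviation nsq :: "'a measure \<Rightarrow> ('a \<Rightarrow> 'b::euclidean_space) \<Rightarrow> real" where
  "nsq M f \<equiv> (LINT x|M. (norm (f x))\<^sup>2)"

lemma L2_iff_sqint: "f \<in> L2 \<Omega> \<longleftrightarrow> sqint (lebesgue_on \<Omega>) f"
  by (simp add: L2_def sqint_def)

lemma sqint_measurable [measurable_dest]: "sqint M f \<Longrightarrow> f \<in> borel_measurable M"
  by (simp add: sqint_def)

lemma sqint_integrable: "sqint M f \<Longrightarrow> integrable M (\<lambda>x. (norm (f x))\<^sup>2)"
  by (simp add: sqint_def)

lemma sqint_bound:
  assumes "f \<in> borel_measurable M" "integrable M g" "AE x in M. (norm (f x))\<^sup>2 \<le> g x"
  shows "sqint M f"
  unfolding sqint_def using assms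
  by (auto intro!: Bochner_Integration.integrable_bound[OF assms(2)] elim!: eventually_mono)

lemma sqint_inner:
  assumes "sqint M f" "sqint M g"
  shows "integrable M (\<lambda>x. f x \<bullet> g x)"
proof -
  have [measurable]: "f \<in> borel_measurable M" "g \<in> borel_measurable M" using assms by (auto simp: sqint_def)
  show ?thesis
  proof (rule Bochner_Integration.integrable_bound)
    show "integrable M (\<lambda>x. (norm (f x))\<^sup>2 + (norm (g x))\<^sup>2)"
      using assms by (auto simp: sqint_def)
    have "\<bar>f x \<bullet> g x\<bar> \<le> (norm (f x))\<^sup>2 + (norm (g x))\<^sup>2" for x
      using Cauchy_Schwarz_ineq2[of "f x" "g x"] sum_squares_bound[of "norm (f x)" "norm (g x)"]
        mult_nonneg_nonneg[OF norm_ge_zero[of "f x"] norm_ge_zero[of "g x"]] by linarith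
    then show "AE x in M. norm (f x \<bullet> g x) \<le> norm ((norm (f x))\<^sup>2 + (norm (g x))\<^sup>2)" by auto
  qed simp
qed

lemma norm_add_sq: "(norm (x + y))\<^sup>2 = (norm x)\<^sup>2 + 2 * (x \<bullet> y) + (norm (y::'b::euclidean_space))\<^sup>2"
  by (simp add: power2_norm_eq_inner inner_add inner_commute)

lemma sqint_scaleR: "sqint M f \<Longrightarrow> sqint M (\<lambda>x. c *\<^sub>R f x)"
  by (auto simp: sqint_def power_mult_distrib)

lemma sqint_add:
  assumes "sqint M f" "sqint M g"
  shows "sqint M (\<lambda>x. f x + g x)" "nsq M (\<lambda>x. f x + g x) = nsq M f + 2 * (LINT x|M. f x \<bullet> g x) + nsq M g"
  using assms sqint_inner[OF assms] by (auto simp: sqint_def norm_add_sq)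

lemma sqint_diff:
  assumes "sqint M f" "sqint M g"
  shows "sqint M (\<lambda>x. f x - g x)"
  using sqint_add(1)[OF assms(1) sqint_scaleR[OF assms(2), of "-1"]] by simp

lemma nsq_scaleR: "nsq M (\<lambda>x. c *\<^sub>R f x) = c\<^sup>2 * nsq M f"
  by (simp add: power_mult_distrib)

lemma nsq_nonneg [simp]: "nsq M f \<ge> 0"
  by simp

lemma nsq_add_scaleR:
  assumes "sqint M f" "sqint M g"
  shows "nsq M (\<lambda>x. f x + t *\<^sub>R g x) = nsq M f + 2 * t * (LINT x|M. f x \<bullet> g x) + t\<^sup>2 * nsq M g"
  using sqint_add(2)[OF assms(1) sqint_scaleR[OF assms(2), of t]] nsq_scaleR[of M t g] by simp

lemma nsq_diff:
  assumes "sqint M f" "sqint M g"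
  shows "nsq M (\<lambda>x. f x - g x) = nsq M f - 2 * (LINT x|M. f x \<bullet> g x) + nsq M g"
  using nsq_add_scaleR[OF assms, of "-1"] by simp

text \<open>Isolated from Cauchy-Schwarz because it is applied a second time with A = 0: there it
  forces B = 0, which is the Euler-Lagrange equation of a minimizer.\<close>

lemma discriminant_bound:
  fixes A B C :: real
  assumes "\<And>t. 0 \<le> A + 2 * t * B + t\<^sup>2 * C"
  shows "B\<^sup>2 \<le> A * C"
proof (cases "C = 0")
  case True
  have "B = 0"
  proof (rule ccontr)
    assume "B \<noteq> 0"
    \<comment> \<open>At this t the affine function A + 2tB equals -1.\<close>
    then have "0 \<le> A + 2 * (-(A+1)/(2*B)) * B" using assms[of "-(A+1)/(2*B)"] True by simp
    with \<open>B \<noteq> 0\<close> show False by (simp add: field_simps)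
  qed
  with True show ?thesis by simp
next
  case False
  have "C \<ge> 0"
  proof (rule ccontr)
    assume "\<not> C \<ge> 0"
    \<comment> \<open>Large enough for the negative term t^2 C to outweigh |A| + 2t|B|; the summand
      1 ensures t \<ge> 1, so that |A| + 1 may be multiplied by t.\<close>
    define t where "t = (\<bar>A\<bar> + 2 * \<bar>B\<bar> + 1) / (-C) + 1"
    have t1: "t \<ge> 1" using \<open>\<not> C \<ge> 0\<close> unfolding t_def by (simp add: divide_nonneg_neg divide_nonpos_neg)
    have tC: "t * (-C) \<ge> \<bar>A\<bar> + 2 * \<bar>B\<bar> + 1"
      using \<open>\<not> C \<ge> 0\<close> by (simp add: t_def field_simps)
    have "\<bar>A\<bar> + 1 + 2 * t * \<bar>B\<bar> \<le> t * (\<bar>A\<bar> + 2 * \<bar>B\<bar> + 1)"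
      using t1 by (simp add: algebra_simps) (smt (verit) mult_right_mono abs_ge_zero mult_left_le_one_le mult_le_cancel_right1)
    also have "\<dots> \<le> t * (t * (-C))" using tC t1 by (intro mult_left_mono) auto
    finally have "A + t\<^sup>2 * C + 2 * t * \<bar>B\<bar> \<le> - 1" by (simp add: power2_eq_square algebra_simps)
    moreover have "2 * t * B \<le> 2 * t * \<bar>B\<bar>" using t1 by (intro mult_left_mono) auto
    ultimately show False using assms[of t] by linarith
  qed
  with False have "C > 0" by simp
  have "0 \<le> A + 2 * (-B/C) * B + (-B/C)\<^sup>2 * C" by (rule assms)
  also have "\<dots> = A - B\<^sup>2 / C" using \<open>C > 0\<close> by (simp add: power2_eq_square field_simps)
  finally show ?thesis using \<open>C > 0\<close> by (simp add: field_simps)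
qed

lemma integral_Cauchy_Schwarz:
  assumes "sqint M f" "sqint M g"
  shows "(LINT x|M. f x \<bullet> g x)\<^sup>2 \<le> nsq M f * nsq M g"
proof (rule discriminant_bound)
  show "0 \<le> nsq M f + 2 * t * (LINT x|M. f x \<bullet> g x) + t\<^sup>2 * nsq M g" for t
    using nsq_add_scaleR[OF assms, of t, symmetric] by simp
qed

section \<open>Strong limits and completeness of L2\<close>

lemma sqint_tendsto_inner:
  assumes "\<And>n. sqint M (f n)" "sqint M g" "sqint M h" "(\<lambda>n. nsq M (\<lambda>x. f n x - g x)) \<longlonglongrightarrow> 0"
  shows "(\<lambda>n. LINT x|M. f n x \<bullet> h x) \<longlonglongrightarrow> (LINT x|M. g x \<bullet> h x)"
proof (rule LIM_zero_cancel, rule Lim_null_comparison)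
  show "\<forall>\<^sub>F n in sequentially. norm ((LINT x|M. f n x \<bullet> h x) - (LINT x|M. g x \<bullet> h x))
      \<le> sqrt (nsq M (\<lambda>x. f n x - g x) * nsq M h)"
  proof (rule always_eventually, rule allI)
    fix n
    have "(LINT x|M. f n x \<bullet> h x) - (LINT x|M. g x \<bullet> h x) = (LINT x|M. (f n x - g x) \<bullet> h x)"
      unfolding inner_diff_left by (rule Bochner_Integration.integral_diff[symmetric]) (intro sqint_inner assms)+
    moreover have "(LINT x|M. (f n x - g x) \<bullet> h x)\<^sup>2 \<le> nsq M (\<lambda>x. f n x - g x) * nsq M h"
      by (intro integral_Cauchy_Schwarz sqint_diff assms)
    ultimately show "norm ((LINT x|M. f n x \<bullet> h x) - (LINT x|M. g x \<bullet> h x))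
      \<le> sqrt (nsq M (\<lambda>x. f n x - g x) * nsq M h)" by (simp add: real_le_rsqrt)
  qed
  show "(\<lambda>n. sqrt (nsq M (\<lambda>x. f n x - g x) * nsq M h)) \<longlonglongrightarrow> 0"
    using tendsto_real_sqrt[OF tendsto_mult_left_zero[OF assms(4), of "nsq M h"]] by simp
qed

lemma sqint_tendsto_nsq:
  assumes "\<And>n. sqint M (f n)" "sqint M g" "(\<lambda>n. nsq M (\<lambda>x. f n x - g x)) \<longlonglongrightarrow> 0"
  shows "(\<lambda>n. nsq M (f n)) \<longlonglongrightarrow> nsq M g"
proof -
  have "nsq M (f n) = nsq M (\<lambda>x. f n x - g x) + 2 * (LINT x|M. f n x \<bullet> g x) - nsq M g" for n
    using nsq_diff[OF assms(1) assms(2), of n] by simp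
  moreover have "(\<lambda>n. nsq M (\<lambda>x. f n x - g x) + 2 * (LINT x|M. f n x \<bullet> g x) - nsq M g)
      \<longlonglongrightarrow> 0 + 2 * (LINT x|M. g x \<bullet> g x) - nsq M g"
    by (intro tendsto_intros assms sqint_tendsto_inner)
  ultimately show ?thesis by (simp add: power2_norm_eq_inner)
qed

text \<open>The squared steps are at most 4^(-k), so they remain summable after multiplication by
  2^k. Hence the weighted series of squares is finite almost everywhere, and the spare factor 2^k
  turns summable squares into summable norms.\<close>

lemma sqint_complete_subseq:
  fixes f :: "nat \<Rightarrow> 'a \<Rightarrow> 'b::euclidean_space"
  assumes f: "\<And>k. sqint M (f k)" and le: "\<And>k. nsq M (\<lambda>x. f (Suc k) x - f k x) \<le> (1/4) ^ k"
  shows "AE x in M. convergent (\<lambda>k. f k x)"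
proof -
  have [measurable]: "f k \<in> borel_measurable M" for k using f by (simp add: sqint_def)
  have "(\<integral>\<^sup>+x. (\<Sum>k. ennreal (2 ^ k * (norm (f (Suc k) x - f k x))\<^sup>2)) \<partial>M)
      = (\<Sum>k. \<integral>\<^sup>+x. ennreal (2 ^ k * (norm (f (Suc k) x - f k x))\<^sup>2) \<partial>M)"
    by (rule nn_integral_suminf) measurable
  also have "\<dots> \<le> (\<Sum>k. ennreal ((1/2) ^ k))"
  proof (rule suminf_le)
    fix k
    have "integrable M (\<lambda>x. (norm (f (Suc k) x - f k x))\<^sup>2)"
      using sqint_diff[OF f f] by (simp add: sqint_def)
    then have "(\<integral>\<^sup>+x. ennreal (2 ^ k * (norm (f (Suc k) x - f k x))\<^sup>2) \<partial>M)
        = ennreal (2 ^ k * nsq M (\<lambda>x. f (Suc k) x - f k x))"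
      by (subst nn_integral_eq_integral) auto
    also have "\<dots> \<le> ennreal ((1/2) ^ k)"
    proof (rule ennreal_leI)
      have "2 ^ k * nsq M (\<lambda>x. f (Suc k) x - f k x) \<le> 2 ^ k * (1/4) ^ k"
        by (intro mult_left_mono le) auto
      also have "\<dots> = (1/2) ^ k" by (simp flip: power_mult_distrib)
      finally show "2 ^ k * nsq M (\<lambda>x. f (Suc k) x - f k x) \<le> (1/2) ^ k" .
    qed
    finally show "(\<integral>\<^sup>+x. ennreal (2 ^ k * (norm (f (Suc k) x - f k x))\<^sup>2) \<partial>M) \<le> ennreal ((1/2) ^ k)" .
  qed auto
  also have "\<dots> < \<infinity>" by (subst suminf_ennreal2) auto
  finally have "(\<integral>\<^sup>+x. (\<Sum>k. ennreal (2 ^ k * (norm (f (Suc k) x - f k x))\<^sup>2)) \<partial>M) \<noteq> \<infinity>" by simp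
  then have "AE x in M. (\<Sum>k. ennreal (2 ^ k * (norm (f (Suc k) x - f k x))\<^sup>2)) \<noteq> \<infinity>"
    by (intro nn_integral_PInf_AE) auto
  then show ?thesis
  proof eventually_elim
    case (elim x)
    let ?a = "\<lambda>k. norm (f (Suc k) x - f k x)"
    have "summable (\<lambda>k. 2 ^ k * (?a k)\<^sup>2)"
      using elim by (intro summable_suminf_not_top) (auto simp: top_ennreal_def)
    then have s: "summable (\<lambda>k. (1/2) ^ k + 2 ^ k * (?a k)\<^sup>2)"
      by (intro summable_add) auto
    have "summable (\<lambda>k. f (Suc k) x - f k x)"
    proof (rule summable_comparison_test'[OF s])
      fix k
      \<comment> \<open>Young's inequality 2r \<le> 2^(-k) + 2^k r^2 for r the norm of the
        step.\<close>
      have "2 * ((1/2) ^ k * (2 ^ k * ?a k)) \<le> ((1/2) ^ k) * 1 + (1/2)^k * (2 ^ k * ?a k)\<^sup>2"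
        using mult_left_mono[OF sum_squares_bound[of 1 "2 ^ k * ?a k"], of "(1/2) ^ k"]
        by (simp add: algebra_simps)
      also have "(1/2)^k * (2 ^ k * ?a k)\<^sup>2 = 2 ^ k * (?a k)\<^sup>2"
        by (simp add: power_mult_distrib power2_eq_square power_divide)
      also have "2 * ((1/2) ^ k * (2 ^ k * ?a k)) = 2 * ?a k" by (simp add: power_divide)
      finally show "norm (f (Suc k) x - f k x) \<le> (1/2) ^ k + 2 ^ k * (?a k)\<^sup>2"
        using norm_ge_zero[of "f (Suc k) x - f k x"] by linarith
    qed
    then obtain l where "(\<lambda>n. \<Sum>k<n. f (Suc k) x - f k x) \<longlonglongrightarrow> l" by (auto simp: summable_def sums_def)
    then have "(\<lambda>n. f n x - f 0 x) \<longlonglongrightarrow> l" by (simp only: sum_lessThan_telescope[of "\<lambda>k. f k x"])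
    from tendsto_add[OF this tendsto_const[of "f 0 x"]] show ?case by (auto simp: convergent_def)
  qed
qed

text \<open>Riesz-Fischer: a fast subsequence converges almost everywhere, and Fatou's lemma carries
  the Cauchy bound over to the distance from its limit, for the whole sequence.\<close>

theorem sqint_complete:
  fixes f :: "nat \<Rightarrow> 'a \<Rightarrow> 'b::euclidean_space"
  assumes f: "\<And>k. sqint M (f k)"
    and cauchy: "\<And>e. e > 0 \<Longrightarrow> \<exists>N. \<forall>m\<ge>N. \<forall>n\<ge>N. nsq M (\<lambda>x. f m x - f n x) \<le> e"
  obtains g where "sqint M g" "(\<lambda>n. nsq M (\<lambda>x. f n x - g x)) \<longlonglongrightarrow> 0"
proof -
  have [measurable]: "f k \<in> borel_measurable M" for k using f by (simp add: sqint_def)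
  obtain N where N: "\<And>k m n. m \<ge> N k \<Longrightarrow> n \<ge> N k \<Longrightarrow> nsq M (\<lambda>x. f m x - f n x) \<le> (1/4) ^ k"
  proof -
    have "\<forall>k. \<exists>N. \<forall>m\<ge>N. \<forall>n\<ge>N. nsq M (\<lambda>x. f m x - f n x) \<le> (1/4) ^ k" using cauchy by simp
    from choice[OF this] show ?thesis using that by blast
  qed
  \<comment> \<open>Summing all earlier \<open>N j\<close> makes both \<open>r k\<close> and
    \<open>r (Suc k)\<close> at least \<open>N k\<close> although \<open>N\<close> itself need not
    be monotone; the summand k makes the indices unbounded.\<close>
  define r where "r k = k + (\<Sum>j\<le>k. N j)" for k
  have rN: "r k \<ge> N k" "r (Suc k) \<ge> N k" "r k \<ge> k" for k
    using member_le_sum[of k "{..k}" N] by (auto simp: r_def)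
  have "AE x in M. convergent (\<lambda>k. f (r k) x)"
    by (rule sqint_complete_subseq) (auto intro!: f N rN)
  define g where "g x = lim (\<lambda>k. f (r k) x)" for x
  have [measurable]: "g \<in> borel_measurable M" unfolding g_def by (rule borel_measurable_lim_metric) auto
  have conv: "AE x in M. (\<lambda>k. f (r k) x) \<longlonglongrightarrow> g x"
    using \<open>AE x in M. convergent _\<close> by (auto simp: g_def convergent_LIMSEQ_iff)
  \<comment> \<open>Kept as a nonnegative integral, because integrability of the difference to the
    limit is itself a consequence of this bound.\<close>
  have fatou: "(\<integral>\<^sup>+x. ennreal ((norm (f n x - g x))\<^sup>2) \<partial>M) \<le> ennreal e"
    if "e > 0" "\<And>i j. i \<ge> K \<Longrightarrow> j \<ge> K \<Longrightarrow> nsq M (\<lambda>x. f i x - f j x) \<le> e" "n \<ge> K" for n K e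
  proof -
    have "(\<integral>\<^sup>+x. ennreal ((norm (f n x - g x))\<^sup>2) \<partial>M)
        = (\<integral>\<^sup>+x. liminf (\<lambda>k. ennreal ((norm (f n x - f (r k) x))\<^sup>2)) \<partial>M)"
    proof (rule nn_integral_cong_AE)
      show "AE x in M. ennreal ((norm (f n x - g x))\<^sup>2) = liminf (\<lambda>k. ennreal ((norm (f n x - f (r k) x))\<^sup>2))"
        using conv
      proof eventually_elim
        case (elim x)
        have "(\<lambda>k. ennreal ((norm (f n x - f (r k) x))\<^sup>2)) \<longlonglongrightarrow> ennreal ((norm (f n x - g x))\<^sup>2)"
          by (intro tendsto_intros tendsto_ennrealI elim)
        from lim_imp_Liminf[OF trivial_limit_sequentially this] show ?case by (rule sym)
      qed
    qed
    also have "\<dots> \<le> liminf (\<lambda>k. \<integral>\<^sup>+x. ennreal ((norm (f n x - f (r k) x))\<^sup>2) \<partial>M)"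
      by (rule nn_integral_liminf) measurable
    also have "\<dots> \<le> liminf (\<lambda>k. ennreal e)"
    proof (rule Liminf_mono)
      show "\<forall>\<^sub>F k in sequentially. (\<integral>\<^sup>+x. ennreal ((norm (f n x - f (r k) x))\<^sup>2) \<partial>M) \<le> ennreal e"
        using eventually_ge_at_top[of K]
      proof eventually_elim
        case (elim k)
        have "integrable M (\<lambda>x. (norm (f n x - f (r k) x))\<^sup>2)"
          using sqint_diff[OF f f] by (simp add: sqint_def)
        moreover have "nsq M (\<lambda>x. f n x - f (r k) x) \<le> e" using that(3) elim rN(3)[of k] by (intro that(2)) auto
        ultimately show ?case by (subst nn_integral_eq_integral) (auto intro: ennreal_leI)
      qed
    qed
    also have "\<dots> = ennreal e" by (simp add: Liminf_const)
    finally show ?thesis .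
  qed
  have ig: "integrable M (\<lambda>x. (norm (f n x - g x))\<^sup>2)" "nsq M (\<lambda>x. f n x - g x) \<le> e"
    if "e > 0" "\<And>i j. i \<ge> K \<Longrightarrow> j \<ge> K \<Longrightarrow> nsq M (\<lambda>x. f i x - f j x) \<le> e" "n \<ge> K" for n K e
  proof -
    note F = fatou[OF that]
    show i: "integrable M (\<lambda>x. (norm (f n x - g x))\<^sup>2)"
      by (rule integrableI_bounded) (use F in \<open>auto intro!: le_less_trans[OF F] ennreal_less_top\<close>)
    have "ennreal (nsq M (\<lambda>x. f n x - g x)) \<le> ennreal e"
      using F nn_integral_eq_integral[OF i] by simp
    then show "nsq M (\<lambda>x. f n x - g x) \<le> e" using \<open>e > 0\<close> by (simp add: ennreal_le_iff)
  qed
  obtain K where "\<And>i j. i \<ge> K \<Longrightarrow> j \<ge> K \<Longrightarrow> nsq M (\<lambda>x. f i x - f j x) \<le> 1"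
    using cauchy[of 1] by auto
  from ig(1)[OF _ this, of K] have "sqint M (\<lambda>x. f K x - g x)" by (simp add: sqint_def)
  from sqint_diff[OF f[of K] this] have g: "sqint M g" by simp
  show ?thesis
  proof (rule that[OF g], rule LIMSEQ_I)
    fix e :: real assume "e > 0"
    obtain K where "\<And>i j. i \<ge> K \<Longrightarrow> j \<ge> K \<Longrightarrow> nsq M (\<lambda>x. f i x - f j x) \<le> e/2"
      using cauchy[of "e/2"] \<open>e > 0\<close> by auto
    from ig(2)[OF _ this] \<open>e > 0\<close> have "nsq M (\<lambda>x. f n x - g x) \<le> e/2" if "n \<ge> K" for n using that by auto
    then show "\<exists>no. \<forall>n\<ge>no. norm (nsq M (\<lambda>x. f n x - g x) - 0) < e"
      using \<open>e > 0\<close> by (intro exI[of _ K]) force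
  qed
qed

text \<open>For k \<le> l the midpoint of \<open>f k\<close> and \<open>f l\<close> lies in the k-th
  set, so its norm is at least the infimum \<open>F k\<close>. The parallelogram law then bounds the
  distance of \<open>f k\<close> and \<open>f l\<close> by the remaining increase of these infima,
  which are increasing and bounded by \<open>B\<close>. No set has to be closed, and the limit is
  not claimed to lie in any of them; what it inherits is derived from the approximants. Constant
  families yield the potential, decreasing ones replace Mazur's lemma for weak limits.\<close>

theorem midpoint_minimizer:
  fixes P :: "nat \<Rightarrow> ('a \<Rightarrow> 'b::euclidean_space) \<Rightarrow> bool"
  assumes anti: "\<And>k f. P (Suc k) f \<Longrightarrow> P k f"
    and sq: "\<And>k f. P k f \<Longrightarrow> sqint M f"
    and mid: "\<And>k f g. P k f \<Longrightarrow> P k g \<Longrightarrow> P k (\<lambda>x. (1/2) *\<^sub>R (f x + g x))"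
    and bd: "\<And>k. \<exists>f. P k f \<and> nsq M f \<le> B"
  obtains f g where "\<And>k. P k (f k)" "sqint M g" "(\<lambda>k. nsq M (\<lambda>x. f k x - g x)) \<longlonglongrightarrow> 0"
    "nsq M g \<le> B" "\<And>h. (\<And>k. P k h) \<Longrightarrow> nsq M g \<le> nsq M h"
proof -
  have anti': "P k f" if "P l f" "k \<le> l" for k l f
    using that(2,1) by (induction rule: dec_induct) (auto dest: anti)
  define F where "F k = Inf (nsq M ` {f. P k f})" for k
  have bb: "bdd_below (nsq M ` {f. P k f})" for k by (rule bdd_belowI[of _ 0]) auto
  have F_le: "F k \<le> nsq M f" if "P k f" for k f unfolding F_def using bb that by (intro cInf_lower) auto
  have F_ge: "F k \<le> F (Suc k)" for k
    unfolding F_def using bd[of "Suc k"] anti bb by (intro cInf_superset_mono) auto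
  have F_B: "F k \<le> B" for k using bd[of k] F_le by (meson order_trans)
  obtain F0 where F0: "F \<longlonglongrightarrow> F0" "\<And>k. F k \<le> F0"
    using incseq_convergent[of F B] F_ge F_B by (auto simp: incseq_Suc_iff)
  have "\<exists>f. P k f \<and> nsq M f < F k + 1 / (real k + 1)" for k
  proof -
    have "\<exists>y\<in>nsq M ` {f. P k f}. y < F k + 1 / (real k + 1)"
      using bd[of k] by (intro cInf_lessD) (auto simp: F_def[symmetric])
    then show ?thesis by auto
  qed
  then obtain f where f: "\<And>k. P k (f k)" "\<And>k. nsq M (f k) < F k + 1 / (real k + 1)" by metis
  have fs: "sqint M (f k)" for k using sq f by blast
  have est: "nsq M (\<lambda>x. f l x - f k x) \<le> 2 * (F0 - F k) + 4 / (real k + 1)" if "k \<le> l" for k l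
  proof -
    let ?m = "\<lambda>x. (1/2) *\<^sub>R (f k x + f l x)"
    \<comment> \<open>The smaller index is used: only the k-th set contains both functions.\<close>
    have "F k \<le> nsq M ?m" using f anti'[OF f(1) that] by (intro F_le mid) auto
    also have "nsq M ?m = (1/4) * nsq M (\<lambda>x. f k x + f l x)" using nsq_scaleR[of M "1/2" "\<lambda>x. f k x + f l x"]
      by (simp add: power2_eq_square)
    finally have 1: "4 * F k \<le> nsq M (f k) + 2 * (LINT x|M. f k x \<bullet> f l x) + nsq M (f l)"
      using sqint_add(2)[OF fs fs] by simp
    have "nsq M (\<lambda>x. f l x - f k x) = nsq M (f l) - 2 * (LINT x|M. f k x \<bullet> f l x) + nsq M (f k)"
      using nsq_diff[OF fs fs, of l k] by (simp add: inner_commute)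
    moreover have "1 / (real l + 1) \<le> 1 / (real k + 1)" using that by (simp add: field_simps)
    moreover have "nsq M (f k) < F k + 1 / (real k + 1)" "nsq M (f l) < F l + 1 / (real l + 1)" "F l \<le> F0" by (rule f F0)+
    moreover have "4 / (real k + 1) = 4 * (1 / (real k + 1))" by simp
    \<comment> \<open>The arithmetic is stated for plain reals, so that the integrals act as opaque
      numbers.\<close>
    moreover have "X \<le> 2 * (F0 - Fk) + p4" if "X = fl - 2 * I + fk" "q \<le> p" "fk < Fk + p" "fl < Fl + q"
      "Fl \<le> F0" "p4 = 4 * p" "4 * Fk \<le> fk + 2 * I + fl" for X fl fk I p q p4 Fk Fl :: real
      using that by (simp add: algebra_simps)
    ultimately show ?thesis using 1 by blast
  qed
  have lim0: "(\<lambda>k. 2 * (F0 - F k) + 4 / (real k + 1)) \<longlonglongrightarrow> 0"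
  proof -
    have "(\<lambda>k. 4 / (real k + 1)) \<longlonglongrightarrow> 0"
      using tendsto_mult_right_zero[OF LIMSEQ_inverse_real_of_nat, of 4] by (simp add: field_simps inverse_eq_divide)
    from tendsto_add[OF tendsto_mult_left[OF tendsto_diff[OF tendsto_const[of F0] F0(1)], of 2] this] show ?thesis by simp
  qed
  have C: "\<exists>N. \<forall>m\<ge>N. \<forall>n\<ge>N. nsq M (\<lambda>x. f m x - f n x) \<le> e" if e0: "e > 0" for e
  proof -
    obtain N where N: "\<And>n. n \<ge> N \<Longrightarrow> 2 * (F0 - F n) + 4 / (real n + 1) < e"
      using order_tendstoD(2)[OF lim0 e0] by (auto simp: eventually_sequentially)
    have "nsq M (\<lambda>x. f m x - f n x) \<le> e" if "m \<ge> N" "n \<ge> N" for m n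
    proof (cases "n \<le> m")
      case True
      then show ?thesis using est[of n m] N[of n] that by linarith
    next
      case False
      then show ?thesis using est[of m n] N[of m] that by (simp add: norm_minus_commute)
    qed
    then show ?thesis by blast
  qed
  obtain g where g: "sqint M g" "(\<lambda>n. nsq M (\<lambda>x. f n x - g x)) \<longlonglongrightarrow> 0"
    by (rule sqint_complete[of M f, OF fs C])
  have "nsq M g \<le> F0"
  proof (rule LIMSEQ_le[OF sqint_tendsto_nsq[OF fs g]])
    have "(\<lambda>k. 1 / (real k + 1)) \<longlonglongrightarrow> 0"
      using LIMSEQ_inverse_real_of_nat by (simp add: inverse_eq_divide add.commute)
    from tendsto_add[OF F0(1) this] show "(\<lambda>k. F k + 1 / (real k + 1)) \<longlonglongrightarrow> F0" by simp
    show "\<exists>N. \<forall>n\<ge>N. nsq M (f n) \<le> F n + 1 / (real n + 1)" using f(2) by (meson less_imp_le)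
  qed
  moreover have "F0 \<le> B" using F0(1) F_B by (intro LIMSEQ_le_const2) auto
  moreover have "F0 \<le> nsq M h" if "\<And>k. P k h" for h
    using F0(1) F_le[OF that] by (intro LIMSEQ_le_const2) auto
  ultimately show ?thesis using that[of f g] f(1) g by fastforce
qed

section \<open>The fundamental lemma of the calculus of variations\<close>

lemma lebesgue_on_integrable_iff:
  fixes f :: "'a::euclidean_space \<Rightarrow> real"
  assumes "\<Omega> \<in> sets lebesgue"
  shows "integrable (lebesgue_on \<Omega>) f \<longleftrightarrow> integrable lebesgue (\<lambda>x. indicator \<Omega> x * f x)"
    "(LINT x|lebesgue_on \<Omega>. f x) = (LINT x|lebesgue. indicator \<Omega> x * f x)"
  using assms integrable_restrict_space[of \<Omega> lebesgue f] integral_restrict_space[of \<Omega> lebesgue f] by auto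

lemma lebesgue_measurable_spike:
  fixes f g :: "'a::euclidean_space \<Rightarrow> real"
  assumes f: "f \<in> borel_measurable lebesgue" and N: "negligible N" "\<And>x. x \<notin> N \<Longrightarrow> f x = g x"
  shows "g \<in> borel_measurable lebesgue"
proof (rule measurableI)
  fix A :: "real set" assume A: "A \<in> sets borel"
  have "g -` A \<inter> space lebesgue = ((f -` A \<inter> space lebesgue) - N) \<union> (g -` A \<inter> N)" using N(2) by auto
  moreover have "(f -` A \<inter> space lebesgue) - N \<in> sets lebesgue"
    using measurable_sets[OF f A] negligible_imp_sets[OF N(1)] by auto
  moreover have "g -` A \<inter> N \<in> sets lebesgue"
    using N(1) by (intro negligible_imp_sets negligible_subset[OF N(1)]) auto
  ultimately show "g -` A \<inter> space lebesgue \<in> sets lebesgue" by (metis sets.Un)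
qed simp

lemma AE_lebesgue_notin: "negligible N \<Longrightarrow> AE x in lebesgue. x \<notin> N"
  using AE_not_in[of N lebesgue] by (simp add: negligible_iff_null_sets)

lemma compactly_supported_integrable:
  fixes q :: "'a::euclidean_space \<Rightarrow> real"
  assumes "continuous_on UNIV q" "compact K" "\<And>x. x \<notin> K \<Longrightarrow> q x = 0"
  shows "integrable lborel q" "integrable lebesgue q"
proof -
  have "integrable lborel (\<lambda>x. indicator K x *\<^sub>R q x)"
    using assms by (intro borel_integrable_compact) (auto intro: continuous_on_subset)
  moreover have "(\<lambda>x. indicator K x *\<^sub>R q x) = q" using assms(3) by (force simp: indicator_def fun_eq_iff)
  ultimately show "integrable lborel q" by simp
  moreover have "q \<in> borel_measurable lborel" using assms(1) by (simp add: borel_measurable_continuous_onI)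
  ultimately show "integrable lebesgue q" by (simp add: integrable_completion)
qed

lemma integral_lebesgue_translate:
  fixes q :: "'a::euclidean_space \<Rightarrow> real"
  assumes "continuous_on UNIV q"
  shows "(LINT x|lebesgue. q (x + c)) = (LINT x|lebesgue. q x)"
proof -
  have [measurable]: "q \<in> borel_measurable borel" using assms by (simp add: borel_measurable_continuous_onI)
  have "(LINT x|lborel. q x) = (LINT x|distr lborel borel ((+) c). q x)" by (simp add: lborel_distr_plus)
  also have "\<dots> = (LINT x|lborel. q (c + x))" by (rule integral_distr) auto
  finally show ?thesis by (simp add: integral_completion add.commute)
qed

text \<open>Finitely many points without derivative are harmless to the fundamental theorem as long
  as the function is continuous there. They are the points where a line crosses the interface z =
  -H, at which the boundary data may have a kink.\<close>

lemma line_Lipschitz: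
  fixes f f' :: "real \<Rightarrow> real"
  assumes "finite S" "t \<ge> 0" "continuous_on UNIV f"
    "\<And>s. s \<notin> S \<Longrightarrow> (f has_real_derivative f' s) (at s)" "\<And>s. s \<notin> S \<Longrightarrow> \<bar>f' s\<bar> \<le> C" "C \<ge> 0"
  shows "\<bar>f t - f 0\<bar> \<le> C * t"
proof -
  define g where "g s = (if s \<in> S then 0 else f' s)" for s
  have "(g has_integral (f t - f 0)) {0..t}"
  proof (rule fundamental_theorem_of_calculus_strong[OF assms(1,2)])
    show "(f has_vector_derivative g x) (at x)" if "x \<in> {0..t} - S" for x
      using assms(4)[of x] that by (auto simp: g_def has_real_derivative_iff_has_vector_derivative)
  qed (use assms(3) in \<open>auto intro: continuous_on_subset\<close>)
  then have "(g has_integral (f t - f 0)) (cbox 0 t)" by simp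
  moreover have "norm (g x) \<le> C" for x using assms(5)[of x] assms(6) by (auto simp: g_def)
  ultimately have "norm (f t - f 0) \<le> C * measure lborel (cbox 0 t)" using assms(6) by (intro has_integral_bound) auto
  then show ?thesis using assms(2) by simp
qed

text \<open>The integral of a directional derivative vanishes because difference quotients integrate to
  zero by translation invariance.\<close>

lemma integral_line_derivative_eq_0:
  fixes q g :: "'a::euclidean_space \<Rightarrow> real"
  assumes q: "continuous_on UNIV q" "compact K" "\<And>x. x \<notin> K \<Longrightarrow> q x = 0"
    and N: "negligible N" "\<And>p. p \<notin> N \<Longrightarrow> finite {t. p + t *\<^sub>R b \<in> N}"
    and g: "\<And>p. p \<notin> N \<Longrightarrow> ((\<lambda>t. q (p + t *\<^sub>R b)) has_real_derivative g p) (at 0)"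
      "\<And>p. p \<notin> N \<Longrightarrow> \<bar>g p\<bar> \<le> C"
  shows "integrable lebesgue g" "(LINT x|lebesgue. g x) = 0"
proof -
  \<comment> \<open>The dominating bound for the difference quotients, uniform in the step;
    \<open>max C 0\<close> supplies the sign that the estimate along a line asks for.\<close>
  have lip: "\<bar>q (p + t *\<^sub>R b) - q p\<bar> \<le> max C 0 * t" if "p \<notin> N" "t \<ge> 0" for p t
  proof -
    have "\<bar>q (p + t *\<^sub>R b) - q (p + 0 *\<^sub>R b)\<bar> \<le> max C 0 * t"
    proof (rule line_Lipschitz[OF N(2)[OF that(1)] that(2), of "\<lambda>t. q (p + t *\<^sub>R b)" "\<lambda>s. g (p + s *\<^sub>R b)"])
      show "continuous_on UNIV (\<lambda>t. q (p + t *\<^sub>R b))"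
        by (intro continuous_on_compose2[OF q(1)] continuous_intros) auto
      fix s assume s: "s \<notin> {t. p + t *\<^sub>R b \<in> N}"
      have "((\<lambda>t. q (p + s *\<^sub>R b + t *\<^sub>R b)) has_real_derivative g (p + s *\<^sub>R b)) (at 0)"
        using s by (intro g) auto
      then have "((\<lambda>t. q (p + (t + s) *\<^sub>R b)) has_real_derivative g (p + s *\<^sub>R b)) (at 0)"
        by (simp add: scaleR_add_left add.assoc add.commute add.left_commute)
      then show "((\<lambda>t. q (p + t *\<^sub>R b)) has_real_derivative g (p + s *\<^sub>R b)) (at s)"
        using DERIV_shift[of "\<lambda>t. q (p + t *\<^sub>R b)" "g (p + s *\<^sub>R b)" 0 s] by simp
      show "\<bar>g (p + s *\<^sub>R b)\<bar> \<le> max C 0" using g(2)[of "p + s *\<^sub>R b"] s by auto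
    qed auto
    then show ?thesis by simp
  qed
  define e where "e n = 1 / (real n + 1)" for n
  have e: "e n > 0" "e n \<le> 1" for n by (auto simp: e_def)
  have e0: "e \<longlonglongrightarrow> 0" unfolding e_def using LIMSEQ_inverse_real_of_nat by (simp add: inverse_eq_divide add.commute)
  define s where "s n p = (q (p + e n *\<^sub>R b) - q p) / e n" for n p
  have s_lim: "(\<lambda>n. s n p) \<longlonglongrightarrow> g p" if "p \<notin> N" for p
  proof -
    have "((\<lambda>h. (q (p + h *\<^sub>R b) - q p) / h) \<longlongrightarrow> g p) (at 0)"
      using g(1)[OF that] by (simp add: DERIV_def)
    moreover have "filterlim e (at 0) sequentially"
      using e0 e(1) by (auto simp: filterlim_at less_imp_neq[symmetric])
    ultimately show ?thesis unfolding s_def by (rule filterlim_compose)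
  qed
  obtain R where R: "\<And>x. x \<in> K \<Longrightarrow> norm x \<le> R" using compact_imp_bounded[OF q(2)] by (auto simp: bounded_iff)
  \<comment> \<open>Since the steps \<open>e n\<close> are at most 1, one ball contains the supports
    of all difference quotients.\<close>
  define B where "B = cball (0::'a) (R + norm b)"
  have s_zero: "s n p = 0" if "p \<notin> B" for n p
  proof -
    have n: "norm p > R + norm b" using that by (auto simp: B_def)
    have "norm p \<le> norm (p + e n *\<^sub>R b) + norm (e n *\<^sub>R b)" by (metis add_diff_cancel_right' norm_triangle_ineq4)
    also have "norm (e n *\<^sub>R b) \<le> 1 * norm b" unfolding norm_scaleR using e[of n] by (intro mult_right_mono) auto
    finally have "norm (p + e n *\<^sub>R b) > R" using n by simp
    moreover have "norm p > R" using n norm_ge_zero[of b] by linarith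
    ultimately show ?thesis unfolding s_def using q(3) R by (metis diff_zero div_0 linorder_not_less)
  qed
  have s_cont: "continuous_on UNIV (s n)" for n
    unfolding s_def using e(1)[of n]
    by (intro continuous_intros continuous_on_compose2[OF q(1)] q(1)) auto
  have s_meas [measurable]: "s n \<in> borel_measurable lebesgue" for n
    using s_cont[of n] by (simp add: borel_measurable_continuous_onI measurable_completion)
  have g_meas: "g \<in> borel_measurable lebesgue"
  proof (rule lebesgue_measurable_spike[OF _ N(1)])
    show "(\<lambda>x. lim (\<lambda>n. s n x)) \<in> borel_measurable lebesgue" by (rule borel_measurable_lim_metric) auto
    show "lim (\<lambda>n. s n x) = g x" if "x \<notin> N" for x using s_lim[OF that] by (rule limI)
  qed
  have Bm: "B \<in> lmeasurable" by (simp add: B_def)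
  have w: "integrable lebesgue (\<lambda>x. indicator B x * max C 0)"
    using Bm by (intro integrable_mult_left) (auto simp: fmeasurable_def intro!: integrable_real_indicator)
  have dom: "AE x in lebesgue. norm (s n x) \<le> indicator B x * max C 0" for n
    using AE_lebesgue_notin[OF N(1)]
  proof eventually_elim
    case (elim x)
    then show ?case using lip[OF elim, of "e n"] e(1)[of n] s_zero[of x n]
      by (cases "x \<in> B") (auto simp: s_def abs_divide pos_divide_le_eq)
  qed
  have lim: "AE x in lebesgue. (\<lambda>n. s n x) \<longlonglongrightarrow> g x"
    using AE_lebesgue_notin[OF N(1)] by eventually_elim (rule s_lim)
  show "integrable lebesgue g" by (rule integrable_dominated_convergence[OF g_meas s_meas w lim dom])
  have D: "(\<lambda>n. LINT x|lebesgue. s n x) \<longlonglongrightarrow> (LINT x|lebesgue. g x)"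
    by (rule integral_dominated_convergence[OF g_meas s_meas w lim dom])
  have "(LINT x|lebesgue. s n x) = 0" for n
  proof -
    have c: "continuous_on UNIV (\<lambda>x. q (x + e n *\<^sub>R b))"
      by (intro continuous_intros continuous_on_compose2[OF q(1)]) auto
    have "x + e n *\<^sub>R b \<notin> K" if "x \<notin> (\<lambda>y. y - e n *\<^sub>R b) ` K" for x
      using that by (metis add_diff_cancel image_eqI)
    moreover have "compact ((\<lambda>y. y - e n *\<^sub>R b) ` K)"
      using q(2) by (intro compact_continuous_image continuous_intros)
    ultimately have "integrable lebesgue (\<lambda>x. q (x + e n *\<^sub>R b))"
      using compactly_supported_integrable(2)[OF c, of "(\<lambda>y. y - e n *\<^sub>R b) ` K"] q(3)
      by blast
    then show ?thesis unfolding s_def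
      using compactly_supported_integrable(2)[OF q] integral_lebesgue_translate[OF q(1), of "e n *\<^sub>R b"] by simp
  qed
  with D show "(LINT x|lebesgue. g x) = 0" using LIMSEQ_unique[of "\<lambda>n. 0::real"] by auto
qed

text \<open>The smooth approximations of the box from below are admissible and bounded by 1, so
  dominated convergence passes to the indicator of the open box; the boundary of the box is a null
  set.\<close>

lemma fundamental_lemma_box:
  fixes f :: "'a::euclidean_space \<Rightarrow> real"
  assumes f: "loc_integrable \<Omega> f"
    and 0: "\<And>\<phi>. \<phi> \<in> test_functions \<Omega> \<Longrightarrow> (LINT x|lebesgue. indicator \<Omega> x * (f x * \<phi> x)) = 0"
    and ab: "cbox a b \<subseteq> \<Omega>"
  shows "integrable lebesgue (\<lambda>x. indicator (cbox a b) x * f x)"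
    "(LINT x|lebesgue. indicator (cbox a b) x * f x) = 0"
proof -
  show i: "integrable lebesgue (\<lambda>x. indicator (cbox a b) x * f x)"
    using f ab by (subst lebesgue_on_integrable_iff(1)[symmetric]) (auto simp: loc_integrable_def)
  obtain \<phi> where \<phi>: "\<And>n::nat. \<phi> n \<in> test_functions \<Omega>" "\<And>n x. 0 \<le> \<phi> n x" "\<And>n x. \<phi> n x \<le> indicator (box a b) x"
    "\<And>x. (\<lambda>n. \<phi> n x) \<longlonglongrightarrow> indicator (box a b) x"
    using box_approximation[OF ab] by metis
  have z: "\<phi> n x = 0" if "x \<notin> box a b" for n x using \<phi>(2)[of n x] \<phi>(3)[of n x] that by simp
  have eq: "indicator \<Omega> x * (f x * \<phi> n x) = (indicator (cbox a b) x * f x) * \<phi> n x" for n x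
    using z[of x n] ab box_subset_cbox[of a b] by (cases "x \<in> box a b") (auto simp: indicator_def)
  have m [measurable]: "(\<lambda>x. indicator (cbox a b) x * f x) \<in> borel_measurable lebesgue" using i by auto
  have im: "indicat_real (box a b) \<in> borel_measurable lebesgue" by (intro borel_measurable_indicator) auto
  have \<phi>m [measurable]: "\<phi> n \<in> borel_measurable lebesgue" for n
    using test_functions_differentiable(2)[OF \<phi>(1), of n]
    by (simp add: borel_measurable_continuous_onI measurable_completion)
  have "(\<lambda>n. LINT x|lebesgue. (indicator (cbox a b) x * f x) * \<phi> n x) \<longlonglongrightarrow> (LINT x|lebesgue. (indicator (cbox a b) x * f x) * indicator (box a b) x)"
  proof (rule integral_dominated_convergence)
    show "integrable lebesgue (\<lambda>x. norm (indicator (cbox a b) x * f x))" using i by (rule integrable_norm)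
    show "AE x in lebesgue. (\<lambda>n. (indicator (cbox a b) x * f x) * \<phi> n x) \<longlonglongrightarrow> (indicator (cbox a b) x * f x) * indicator (box a b) x"
      by (intro AE_I2 tendsto_intros \<phi>)
    have "norm ((indicator (cbox a b) x * f x) * \<phi> n x) \<le> norm (indicator (cbox a b) x * f x) * 1" for n x
      unfolding norm_mult[of _ "\<phi> n x"] using \<phi>(2)[of n x] order_trans[OF \<phi>(3)[of n x] indicator_le_1[of "box a b" x]]
      by (intro mult_left_mono) (auto simp: indicator_def)
    then show "AE x in lebesgue. norm ((indicator (cbox a b) x * f x) * \<phi> n x) \<le> norm (indicator (cbox a b) x * f x)" for n
      by (intro AE_I2) simp
  qed (intro borel_measurable_times m \<phi>m im)+
  moreover have "(LINT x|lebesgue. (indicator (cbox a b) x * f x) * \<phi> n x) = 0" for n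
    using 0[OF \<phi>(1), of n] by (simp add: eq)
  ultimately have "(LINT x|lebesgue. (indicator (cbox a b) x * f x) * indicator (box a b) x) = 0"
    using LIMSEQ_unique[of "\<lambda>n. 0::real"] by auto
  also have "(LINT x|lebesgue. (indicator (cbox a b) x * f x) * indicator (box a b) x)
      = (LINT x|lebesgue. indicator (cbox a b) x * f x)"
  proof (rule integral_cong_AE)
    have "negligible (cbox a b - box a b)" by (rule negligible_frontier_interval)
    then show "AE x in lebesgue. (indicator (cbox a b) x * f x) * indicator (box a b) x = indicator (cbox a b) x * f x"
      by (rule AE_mp[OF AE_lebesgue_notin]) (auto simp: indicator_def)
  qed (intro borel_measurable_times m im)+
  finally show "(LINT x|lebesgue. indicator (cbox a b) x * f x) = 0" .
qed

text \<open>Vanishing integrals over all small boxes give a vanishing function by Lebesgue's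
  differentiation theorem, applied to boxes with corner x. This is local; countably many boxes whose
  closures lie in \<Omega> exhaust it.\<close>

theorem fundamental_lemma:
  fixes f :: "'a::euclidean_space \<Rightarrow> real"
  assumes "open \<Omega>" and f: "loc_integrable \<Omega> f"
    and 0: "\<And>\<phi>. \<phi> \<in> test_functions \<Omega> \<Longrightarrow> (LINT x|lebesgue. indicator \<Omega> x * (f x * \<phi> x)) = 0"
  shows "AE x in lebesgue. x \<in> \<Omega> \<longrightarrow> f x = 0"
proof -
  have box: "AE x in lebesgue. x \<in> box a b \<longrightarrow> f x = 0" if ab: "cbox a b \<subseteq> \<Omega>" for a b
  proof -
    define F where "F x = indicator (cbox a b) x * f x" for x
    have F: "integrable lebesgue F" unfolding F_def by (rule fundamental_lemma_box(1)[OF f 0 ab])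
    have "F integrable_on cbox u v" for u v
      using F by (meson integrable_on_lebesgue integrable_on_subcbox subset_UNIV)
    then obtain N where N: "negligible N" "\<And>x e. x \<notin> N \<Longrightarrow> 0 < e \<Longrightarrow>
       \<exists>d>0. \<forall>h. 0 < h \<and> h < d \<longrightarrow> norm (integral (cbox x (x + h *\<^sub>R One)) F /\<^sub>R h ^ DIM('a) - F x) < e"
      using integrable_ccontinuous_explicit[of F] by metis
    have z: "integral (cbox u v) F = 0" if "cbox u v \<subseteq> cbox a b" for u v
    proof -
      have uv: "cbox u v \<subseteq> \<Omega>" using that ab by blast
      note I = fundamental_lemma_box[OF f 0 uv]
      have eq: "(\<lambda>x. if x \<in> cbox u v then F x else 0) = (\<lambda>x. indicator (cbox u v) x * f x)"
        using that by (auto simp: F_def indicator_def fun_eq_iff)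
      have "((\<lambda>x. indicator (cbox u v) x * f x) has_integral 0) UNIV"
        using has_integral_integral_lebesgue[OF I(1)] I(2) by simp
      then have "(F has_integral 0) (cbox u v)"
        using has_integral_restrict_UNIV[of "cbox u v" F 0] eq by simp
      then show ?thesis by (rule integral_unique)
    qed
    have zero: "f x = 0" if x: "x \<in> box a b" "x \<notin> N" for x
    proof (rule ccontr)
      assume "f x \<noteq> 0"
      have Fx: "F x = f x" using x box_subset_cbox[of a b] by (auto simp: F_def)
      obtain d where d: "d > 0" "\<And>h. 0 < h \<Longrightarrow> h < d \<Longrightarrow> norm (integral (cbox x (x + h *\<^sub>R One)) F /\<^sub>R h ^ DIM('a) - F x) < \<bar>f x\<bar>"
        using N(2)[OF x(2), of "\<bar>f x\<bar>"] \<open>f x \<noteq> 0\<close> by auto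
      \<comment> \<open>The least distance from x to the upper faces, so that the box with lower
        corner x and side \<open>h\<close> stays inside.\<close>
      define m where "m = Min ((\<lambda>i. b \<bullet> i - x \<bullet> i) ` (Basis::'a set))"
      have m: "m > 0" "\<And>i. i \<in> Basis \<Longrightarrow> m \<le> b \<bullet> i - x \<bullet> i"
        using x by (auto simp: m_def mem_box)
      define h where "h = min (d/2) m"
      have h: "0 < h" "h < d" "h \<le> m" using m d by (auto simp: h_def)
      have "cbox x (x + h *\<^sub>R One) \<subseteq> cbox a b"
      proof (rule subset_box_imp)
        show "\<forall>i\<in>Basis. a \<bullet> i \<le> x \<bullet> i \<and> (x + h *\<^sub>R One) \<bullet> i \<le> b \<bullet> i"
          using x m(2) h(3) by (fastforce simp: mem_box inner_add_left)
      qed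
      from d(2)[OF h(1,2)] z[OF this] Fx show False by simp
    qed
    show ?thesis using AE_lebesgue_notin[OF N(1)] by eventually_elim (use zero in blast)
  qed
  obtain \<D> where D: "countable \<D>" "\<And>X. X \<in> \<D> \<Longrightarrow> \<exists>a b. X = box a b \<and> cbox a b \<subseteq> \<Omega>" "\<Union>\<D> = \<Omega>"
  proof -
    have "\<exists>D. countable D \<and> (\<forall>X\<in>D. \<exists>a b. X = box a b \<and> cbox a b \<subseteq> \<Omega>) \<and> \<Union>D = \<Omega>"
    proof -
      \<comment> \<open>Rational corners make the family countable; the second condition keeps the
        closed box in \<Omega>, as the local statement requires.\<close>
      define B where "B = {X. X \<in> (\<lambda>(a,b). box a b) ` ({a. \<forall>i\<in>Basis. a \<bullet> i \<in> \<rat>} \<times> {b. \<forall>i\<in>Basis. (b::'a) \<bullet> i \<in> \<rat>}) \<and> (\<exists>a b. X = box a b \<and> cbox a b \<subseteq> \<Omega>)}"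
      have c: "countable {a::'a. \<forall>i\<in>Basis. a \<bullet> i \<in> \<rat>}"
      proof -
        have "{a::'a. \<forall>i\<in>Basis. a \<bullet> i \<in> \<rat>} \<subseteq> (\<lambda>f. \<Sum>i\<in>Basis. f i *\<^sub>R i) ` (Basis \<rightarrow>\<^sub>E \<rat>)"
        proof
          fix a :: 'a assume "a \<in> {a. \<forall>i\<in>Basis. a \<bullet> i \<in> \<rat>}"
          then show "a \<in> (\<lambda>f. \<Sum>i\<in>Basis. f i *\<^sub>R i) ` (Basis \<rightarrow>\<^sub>E \<rat>)"
            by (intro image_eqI[of _ _ "\<lambda>i\<in>Basis. a \<bullet> i"]) (auto simp: euclidean_representation)
        qed
        then show ?thesis by (rule countable_subset) (intro countable_image countable_PiE countable_rat finite_Basis)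
      qed
      have "countable B" unfolding B_def
        by (rule countable_subset[of _ "(\<lambda>(a,b). box a b) ` ({a. \<forall>i\<in>Basis. a \<bullet> i \<in> \<rat>} \<times> {b. \<forall>i\<in>Basis. (b::'a) \<bullet> i \<in> \<rat>})"])
           (auto intro!: countable_image countable_SIGMA c)
      moreover have "\<Union>B = \<Omega>"
      proof (intro equalityI subsetI)
        fix x assume "x \<in> \<Union>B"
        then show "x \<in> \<Omega>" unfolding B_def using box_subset_cbox by fastforce
      next
        fix x assume "x \<in> \<Omega>"
        then obtain e where e: "e > 0" "cball x e \<subseteq> \<Omega>" using \<open>open \<Omega>\<close> open_contains_cball by blast
        obtain a b where ab: "x \<in> box a b" "\<forall>i\<in>Basis. a \<bullet> i \<in> \<rat>" "\<forall>i\<in>Basis. b \<bullet> i \<in> \<rat>" "box a b \<subseteq> ball x e"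
          using rational_boxes[OF e(1)] by metis
        have "cbox a b = closure (box a b)" using ab(1) by (intro closure_box[symmetric]) auto
        also have "\<dots> \<subseteq> cball x e" using ab(4) ball_subset_cball by (intro closure_minimal) auto
        finally have "box a b \<in> B" unfolding B_def using ab e(2) by blast
        then show "x \<in> \<Union>B" using ab(1) by blast
      qed
      ultimately show ?thesis unfolding B_def by (intro exI[of _ B]) (auto simp: B_def)
    qed
    then show ?thesis using that by metis
  qed
  have "AE x in lebesgue. \<forall>X\<in>\<D>. x \<in> X \<longrightarrow> f x = 0"
    using D(1,2) box by (subst AE_ball_countable) fastforce+
  then show ?thesis by eventually_elim (use D(3) in blast)
qed

section \<open>Weak derivatives\<close>

lemma loc_integrable_diff: "loc_integrable \<Omega> f \<Longrightarrow> loc_integrable \<Omega> g \<Longrightarrow> loc_integrable \<Omega> (\<lambda>x. f x - g x)"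
  by (simp add: loc_integrable_def)

lemma open_sets_lebesgue: "open \<Omega> \<Longrightarrow> \<Omega> \<in> sets lebesgue" for \<Omega> :: "'a::euclidean_space set"
  by (simp add: borel_open)

lemma AE_lebesgue_on_iff:
  fixes \<Omega> :: "'a::euclidean_space set"
  shows "\<Omega> \<in> sets lebesgue \<Longrightarrow> (AE x in lebesgue_on \<Omega>. P x) \<longleftrightarrow> (AE x in lebesgue. x \<in> \<Omega> \<longrightarrow> P x)"
  by (subst AE_restrict_space_iff) auto

lemma compact_restrict_integrable:
  fixes f :: "'a::euclidean_space \<Rightarrow> real"
  assumes "\<Omega> \<in> sets lebesgue" "C \<subseteq> \<Omega>" "compact C" "integrable (lebesgue_on \<Omega>) f"
  shows "integrable (lebesgue_on C) f"
proof -
  have C: "C \<in> sets lebesgue" using assms(3) by (simp add: borel_compact)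
  have "integrable lebesgue (\<lambda>x. indicator C x * (indicator \<Omega> x * f x))"
    using integrable_mult_indicator[OF C, of "\<lambda>x. indicator \<Omega> x * f x"] assms by (simp add: lebesgue_on_integrable_iff(1))
  moreover have "(\<lambda>x. indicator C x * (indicator \<Omega> x * f x)) = (\<lambda>x. indicator C x * f x)"
    using assms(2) by (auto simp: indicator_def fun_eq_iff)
  ultimately show ?thesis by (simp add: lebesgue_on_integrable_iff(1)[OF C])
qed

lemma loc_integrable_cong_AE:
  fixes f g :: "'a::euclidean_space \<Rightarrow> real"
  assumes "open \<Omega>" "AE x in lebesgue_on \<Omega>. f x = g x" "f \<in> borel_measurable (lebesgue_on \<Omega>)" "loc_integrable \<Omega> g"
  shows "loc_integrable \<Omega> f"
  unfolding loc_integrable_def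
proof (intro allI impI, elim conjE)
  fix C assume C: "compact C" "C \<subseteq> \<Omega>"
  have Cs: "C \<in> sets lebesgue" using C by (simp add: borel_compact)
  have "integrable (lebesgue_on C) g" using assms(4) C by (auto simp: loc_integrable_def)
  moreover have "AE x in lebesgue_on C. g x = f x"
    using assms(2) C(2) unfolding AE_lebesgue_on_iff[OF Cs] AE_lebesgue_on_iff[OF open_sets_lebesgue[OF assms(1)]]
    by (auto elim: eventually_mono)
  moreover have "f \<in> borel_measurable (lebesgue_on C)"
    using measurable_restrict_mono[OF assms(3) C(2)] .
  ultimately show "integrable (lebesgue_on C) f"
    using integrable_cong_AE by blast
qed

lemma sqint_loc_integrable:
  fixes f :: "'a::euclidean_space \<Rightarrow> real"
  assumes "open \<Omega>" "sqint (lebesgue_on \<Omega>) f"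
  shows "loc_integrable \<Omega> f"
  unfolding loc_integrable_def
proof (intro allI impI, elim conjE)
  fix C assume C: "compact C" "C \<subseteq> \<Omega>"
  have Cm: "C \<in> lmeasurable" using C(1) by (simp add: lmeasurable_compact)
  interpret finite_measure "lebesgue_on C" by (rule finite_measure_lebesgue_on[OF Cm])
  show "integrable (lebesgue_on C) f"
  proof (rule Bochner_Integration.integrable_bound)
    have "integrable (lebesgue_on \<Omega>) (\<lambda>x. (f x)\<^sup>2)" using sqint_integrable[OF assms(2)] by simp
    then have "integrable (lebesgue_on C) (\<lambda>x. (f x)\<^sup>2)"
      by (rule compact_restrict_integrable[OF open_sets_lebesgue[OF assms(1)] C(2,1)])
    then show "integrable (lebesgue_on C) (\<lambda>x. 1 + (f x)\<^sup>2)" by (rule Bochner_Integration.integrable_add[OF integrable_const])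
    show "f \<in> borel_measurable (lebesgue_on C)"
      by (rule measurable_restrict_mono[OF sqint_measurable[OF assms(2)] C(2)])
    have "2 * \<bar>f x\<bar> \<le> 1 + (f x)\<^sup>2" for x using sum_squares_bound[of 1 "\<bar>f x\<bar>"] by simp
    then have "\<bar>f x\<bar> \<le> 1 + (f x)\<^sup>2" for x using abs_ge_zero[of "f x"] by (smt (verit))
    then show "AE x in lebesgue_on C. norm (f x) \<le> norm (1 + (f x)\<^sup>2)" by (intro AE_I2) simp
  qed
qed

lemma has_weak_pderiv_unique:
  fixes f g :: "'a::euclidean_space \<Rightarrow> real"
  assumes "open \<Omega>" "has_weak_pderiv \<Omega> b u f" "has_weak_pderiv \<Omega> b u g"
  shows "AE x in lebesgue_on \<Omega>. f x = g x"
proof -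
  have "AE x in lebesgue. x \<in> \<Omega> \<longrightarrow> f x - g x = 0"
  proof (rule fundamental_lemma[OF assms(1)])
    show "loc_integrable \<Omega> (\<lambda>x. f x - g x)"
      using assms by (auto simp: has_weak_pderiv_def intro: loc_integrable_diff)
    fix \<phi> assume \<phi>: "\<phi> \<in> test_functions \<Omega>"
    \<comment> \<open>Needed to split the integral of the difference: local integrability suffices
      because \<phi> is bounded with compact support in \<Omega>.\<close>
    have i: "integrable (lebesgue_on \<Omega>) (\<lambda>x. h x * \<phi> x)" if h: "loc_integrable \<Omega> h" for h
    proof -
      obtain K where K: "compact K" "K \<subseteq> \<Omega>" "\<And>x. x \<notin> K \<Longrightarrow> \<phi> x = 0" using test_functionsE[OF \<phi>] by metis
      obtain B where B: "\<And>x. \<bar>\<phi> x\<bar> \<le> B" using test_functions_bounded[OF \<phi>] by metis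
      have "integrable lebesgue (\<lambda>x. indicator K x * h x)"
        using h K by (subst lebesgue_on_integrable_iff(1)[symmetric]) (auto simp: loc_integrable_def borel_compact)
      then have I: "integrable lebesgue (\<lambda>x. B * (indicator K x * h x))" by (rule integrable_mult_right)
      have "integrable lebesgue (\<lambda>x. \<phi> x *\<^sub>R (indicator K x * h x))"
      proof (rule Bochner_Integration.integrable_bound[OF I])
        have "\<phi> \<in> borel_measurable lebesgue"
          using test_functions_differentiable(2)[OF \<phi>] by (simp add: borel_measurable_continuous_onI measurable_completion)
        then show "(\<lambda>x. \<phi> x *\<^sub>R (indicator K x * h x)) \<in> borel_measurable lebesgue"
          using \<open>integrable lebesgue (\<lambda>x. indicator K x * h x)\<close> by (intro borel_measurable_scaleR) auto
        have "\<bar>\<phi> x\<bar> \<le> \<bar>B\<bar>" for x using B[of x] by simp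
        then show "AE x in lebesgue. norm (\<phi> x *\<^sub>R (indicator K x * h x)) \<le> norm (B * (indicator K x * h x))"
          by (intro AE_I2) (auto simp: abs_mult intro!: mult_right_mono)
      qed
      moreover have "(\<lambda>x. \<phi> x *\<^sub>R (indicator K x * h x)) = (\<lambda>x. indicator \<Omega> x * (h x * \<phi> x))"
      proof
        show "\<phi> x *\<^sub>R (indicator K x * h x) = indicator \<Omega> x * (h x * \<phi> x)" for x
          using K by (cases "x \<in> K") auto
      qed
      ultimately show ?thesis using assms(1) by (simp add: lebesgue_on_integrable_iff(1) open_sets_lebesgue)
    qed
    have "(LINT x|lebesgue_on \<Omega>. f x * \<phi> x) = (LINT x|lebesgue_on \<Omega>. g x * \<phi> x)"
      using assms(2,3) \<phi> by (auto simp: has_weak_pderiv_def)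
    moreover have "integrable (lebesgue_on \<Omega>) (\<lambda>x. f x * \<phi> x)" "integrable (lebesgue_on \<Omega>) (\<lambda>x. g x * \<phi> x)"
      using assms(2,3) by (auto simp: has_weak_pderiv_def intro: i)
    ultimately have "(LINT x|lebesgue_on \<Omega>. (f x - g x) * \<phi> x) = 0"
      by (simp add: left_diff_distrib)
    then show "(LINT x|lebesgue. indicator \<Omega> x * ((f x - g x) * \<phi> x)) = 0"
      using assms(1) by (simp add: lebesgue_on_integrable_iff(2) open_sets_lebesgue)
  qed
  then show ?thesis using assms(1) by (simp add: AE_lebesgue_on_iff open_sets_lebesgue)
qed

text \<open>Makes the choice behind \<open>weak_pd\<close> harmless: as soon as some weak derivative
  is known, the chosen one agrees with it almost everywhere.\<close>

lemma weak_pd: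
  assumes "open \<Omega>" "has_weak_pderiv \<Omega> b u g"
  shows "has_weak_pderiv \<Omega> b u (weak_pd \<Omega> b u)" "AE x in lebesgue_on \<Omega>. weak_pd \<Omega> b u x = g x"
proof -
  show *: "has_weak_pderiv \<Omega> b u (weak_pd \<Omega> b u)" unfolding weak_pd_def by (rule someI[of "has_weak_pderiv \<Omega> b u"]) (rule assms(2))
  show "AE x in lebesgue_on \<Omega>. weak_pd \<Omega> b u x = g x" by (rule has_weak_pderiv_unique[OF assms(1) * assms(2)])
qed

lemma sqint_restrict_UNIV:
  fixes f :: "'a::euclidean_space \<Rightarrow> real"
  assumes "open \<Omega>" "continuous_on UNIV f" "compact K" "\<And>x. x \<notin> K \<Longrightarrow> f x = 0" "K \<subseteq> \<Omega>"
  shows "sqint (lebesgue_on \<Omega>) f"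
proof -
  have "integrable lebesgue (\<lambda>x. (f x)\<^sup>2)"
    using assms by (intro compactly_supported_integrable(2)[of _ K] continuous_intros) auto
  moreover have "(\<lambda>x. indicator \<Omega> x * (f x)\<^sup>2) = (\<lambda>x. (f x)\<^sup>2)"
    using assms(4,5) by (force simp: indicator_def fun_eq_iff)
  ultimately have "integrable (lebesgue_on \<Omega>) (\<lambda>x. (f x)\<^sup>2)"
    using assms(1) by (simp add: lebesgue_on_integrable_iff(1) open_sets_lebesgue)
  moreover have "f \<in> borel_measurable (lebesgue_on \<Omega>)"
    using assms(2) by (intro measurable_restrict_space1) (simp add: borel_measurable_continuous_onI measurable_completion)
  ultimately show ?thesis by (simp add: sqint_def)
qed

lemma test_functions_sqint:
  assumes "open \<Omega>" "\<phi> \<in> test_functions \<Omega>"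
  shows "sqint (lebesgue_on \<Omega>) \<phi>" "b \<in> Basis \<Longrightarrow> sqint (lebesgue_on \<Omega>) (pd UNIV b \<phi>)"
proof -
  obtain K where K: "compact K" "K \<subseteq> \<Omega>" "\<And>x. x \<notin> K \<Longrightarrow> \<phi> x = 0" "\<And>x b. x \<notin> K \<Longrightarrow> pd UNIV b \<phi> x = 0"
    using test_functionsE[OF assms(2)] by metis
  show "sqint (lebesgue_on \<Omega>) \<phi>"
    using K test_functions_differentiable(2)[OF assms(2)] by (intro sqint_restrict_UNIV[OF assms(1)]) auto
  show "b \<in> Basis \<Longrightarrow> sqint (lebesgue_on \<Omega>) (pd UNIV b \<phi>)"
    using K test_functions_differentiable(4)[OF assms(2)] by (intro sqint_restrict_UNIV[OF assms(1)]) auto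
qed

text \<open>The exceptional null set N accommodates functions that are only piecewise differentiable.\<close>

lemma has_weak_pderivI_lines:
  fixes f g :: "'a::euclidean_space \<Rightarrow> real"
  assumes \<Omega>: "open \<Omega>" and b: "b \<in> Basis" and f: "continuous_on \<Omega> f"
    and fB: "\<And>p. p \<in> \<Omega> \<Longrightarrow> \<bar>f p\<bar> \<le> B"
    and N: "negligible N" "\<And>p. p \<notin> N \<Longrightarrow> finite {t. p + t *\<^sub>R b \<in> N}"
    and g: "\<And>p. p \<in> \<Omega> - N \<Longrightarrow> ((\<lambda>t. f (p + t *\<^sub>R b)) has_real_derivative g p) (at 0)"
      "\<And>p. p \<in> \<Omega> - N \<Longrightarrow> \<bar>g p\<bar> \<le> B"
    and loc: "loc_integrable \<Omega> f" "loc_integrable \<Omega> g"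
  shows "has_weak_pderiv \<Omega> b f g"
  unfolding has_weak_pderiv_def
proof (intro conjI loc ballI)
  fix \<phi> assume \<phi>: "\<phi> \<in> test_functions \<Omega>"
  obtain K where K: "compact K" "K \<subseteq> \<Omega>" "\<And>x. x \<notin> K \<Longrightarrow> \<phi> x = 0" "\<And>x b. x \<notin> K \<Longrightarrow> pd UNIV b \<phi> x = 0"
    using test_functionsE[OF \<phi>] by metis
  obtain B' where B': "B' \<ge> 0" "\<And>x. \<bar>\<phi> x\<bar> \<le> B'" "\<And>x b. b \<in> Basis \<Longrightarrow> \<bar>pd UNIV b \<phi> x\<bar> \<le> B'"
    using test_functions_bounded[OF \<phi>] by metis
  note \<phi>d = test_functions_differentiable[OF \<phi>]
  \<comment> \<open>A product with a factor vanishing off the compact K extends by zero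
    continuously, since \<Omega> and the complement of K are open sets that cover the space.\<close>
  have ext: "continuous_on UNIV (\<lambda>x. if x \<in> \<Omega> then f x * w x else 0)"
    if w: "continuous_on UNIV w" "\<And>x. x \<notin> K \<Longrightarrow> w x = 0" for w :: "'a \<Rightarrow> real"
  proof -
    let ?q = "\<lambda>x. if x \<in> \<Omega> then f x * w x else 0"
    have "continuous_on \<Omega> (\<lambda>x. f x * w x)" using w(1) f by (intro continuous_intros) (auto intro: continuous_on_subset)
    then have 1: "continuous_on \<Omega> ?q" by (rule continuous_on_eq) auto
    have "continuous_on (- K) (\<lambda>x. 0::real)" by simp
    then have 2: "continuous_on (- K) ?q" by (rule continuous_on_eq) (use w(2) in auto)
    have "continuous_on (\<Omega> \<union> - K) ?q"
      using 1 2 \<Omega> K(1) by (intro continuous_on_open_Un) (auto simp: open_Compl compact_imp_closed)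
    moreover have "\<Omega> \<union> - K = UNIV" using K(2) by auto
    ultimately show ?thesis by simp
  qed
  define q where "q x = (if x \<in> \<Omega> then f x * \<phi> x else 0)" for x
  define r where "r x = (if x \<in> \<Omega> then f x * pd UNIV b \<phi> x else 0)" for x
  \<comment> \<open>The derivative of \<open>q\<close> along the line by the product rule. That its
    integral vanishes is the integration by parts.\<close>
  define G where "G p = (if p \<in> \<Omega> then g p * \<phi> p + f p * pd UNIV b \<phi> p else 0)" for p
  have qc: "continuous_on UNIV q" unfolding q_def using \<phi>d K by (intro ext) auto
  have rc: "continuous_on UNIV r" unfolding r_def using \<phi>d b K by (intro ext) auto
  have ri: "integrable lebesgue r" using K by (intro compactly_supported_integrable(2)[OF rc K(1)]) (auto simp: r_def)
  have der: "((\<lambda>t. q (p + t *\<^sub>R b)) has_real_derivative G p) (at 0)" if p: "p \<notin> N" for p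
  proof (cases "p \<in> \<Omega>")
    case True
    from DERIV_mult[OF g(1)[of p] test_functions_line_derivative[OF \<phi>, of p b]] True p
    have "((\<lambda>t. f (p + t *\<^sub>R b) * \<phi> (p + t *\<^sub>R b)) has_real_derivative G p) (at 0)" by (simp add: G_def algebra_simps)
    moreover have "open ((\<lambda>t. p + t *\<^sub>R b) -` \<Omega>)"
      using \<Omega> by (intro open_vimage continuous_intros)
    ultimately show ?thesis
      by (rule has_field_derivative_transform_within_open) (use True in \<open>auto simp: q_def\<close>)
  next
    case False
    have "((\<lambda>t. 0) has_real_derivative G p) (at 0)" using False by (simp add: G_def)
    moreover have "open ((\<lambda>t. p + t *\<^sub>R b) -` (- K))"
      using K(1) by (intro open_vimage continuous_intros open_Compl compact_imp_closed)
    ultimately show ?thesis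
      by (rule has_field_derivative_transform_within_open) (use False K in \<open>auto simp: q_def\<close>)
  qed
  have GB: "\<bar>G p\<bar> \<le> \<bar>B\<bar> * B' + \<bar>B\<bar> * B'" if p: "p \<notin> N" for p
  proof (cases "p \<in> \<Omega>")
    case True
    have "\<bar>g p * \<phi> p\<bar> \<le> \<bar>B\<bar> * B'" unfolding abs_mult
      using g(2)[of p] True p B'(2)[of p] by (intro mult_mono) auto
    moreover have "\<bar>f p * pd UNIV b \<phi> p\<bar> \<le> \<bar>B\<bar> * B'" unfolding abs_mult
      using fB[OF True] B'(3)[OF b, of p] by (intro mult_mono) auto
    moreover have "G p = g p * \<phi> p + f p * pd UNIV b \<phi> p" using True by (simp add: G_def)
    ultimately show ?thesis by linarith
  next
    case False
    then show ?thesis using B'(1) by (simp add: G_def)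
  qed
  have G: "integrable lebesgue G" "(LINT x|lebesgue. G x) = 0"
    using integral_line_derivative_eq_0[OF qc K(1) _ N der GB] K(3) by (auto simp: q_def)
  have "(\<lambda>x. indicator \<Omega> x * (g x * \<phi> x)) = (\<lambda>x. G x - r x)"
    by (auto simp: G_def r_def fun_eq_iff)
  moreover have "(\<lambda>x. indicator \<Omega> x * (f x * pd UNIV b \<phi> x)) = r"
    by (auto simp: r_def fun_eq_iff)
  ultimately show "(LINT x|lebesgue_on \<Omega>. f x * pd UNIV b \<phi> x) = - (LINT x|lebesgue_on \<Omega>. g x * \<phi> x)"
    using G ri \<Omega> by (simp add: lebesgue_on_integrable_iff(2) open_sets_lebesgue)
qed

lemma has_weak_pderiv_test_function:
  assumes "open \<Omega>" "b \<in> Basis" "\<phi> \<in> test_functions \<Omega>"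
  shows "has_weak_pderiv \<Omega> b \<phi> (pd UNIV b \<phi>)"
proof -
  obtain B where B: "\<And>x. \<bar>\<phi> x\<bar> \<le> B" "\<And>x b. b \<in> Basis \<Longrightarrow> \<bar>pd UNIV b \<phi> x\<bar> \<le> B"
    using test_functions_bounded[OF assms(3)] by metis
  note \<phi>d = test_functions_differentiable[OF assms(3)]
  show ?thesis
  proof (rule has_weak_pderivI_lines[OF assms(1,2), of _ B "{}"])
    show "loc_integrable \<Omega> \<phi>" "loc_integrable \<Omega> (pd UNIV b \<phi>)"
      using test_functions_sqint[OF assms(1,3)] assms(2) by (auto intro: sqint_loc_integrable[OF assms(1)])
    show "((\<lambda>t. \<phi> (p + t *\<^sub>R b)) has_real_derivative pd UNIV b \<phi> p) (at 0)" for p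
      by (rule test_functions_line_derivative[OF assms(3)])
  qed (use B assms \<phi>d(2) in \<open>auto intro: continuous_on_subset\<close>)
qed

lemma has_weak_pderiv_linear:
  fixes u v f g :: "'a::euclidean_space \<Rightarrow> real"
  assumes "open \<Omega>" "b \<in> Basis" "has_weak_pderiv \<Omega> b u f" "has_weak_pderiv \<Omega> b v g"
    and sq: "sqint (lebesgue_on \<Omega>) u" "sqint (lebesgue_on \<Omega>) v" "sqint (lebesgue_on \<Omega>) f" "sqint (lebesgue_on \<Omega>) g"
  shows "has_weak_pderiv \<Omega> b (\<lambda>x. u x + c * v x) (\<lambda>x. f x + c * g x)"
  unfolding has_weak_pderiv_def
proof (intro conjI ballI)
  have s: "sqint (lebesgue_on \<Omega>) (\<lambda>x. h x + c * k x)" if "sqint (lebesgue_on \<Omega>) h" "sqint (lebesgue_on \<Omega>) k"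
    for h k :: "'a \<Rightarrow> real" using sqint_add(1)[OF that(1) sqint_scaleR[OF that(2), of c]] by simp
  show "loc_integrable \<Omega> (\<lambda>x. u x + c * v x)" "loc_integrable \<Omega> (\<lambda>x. f x + c * g x)"
    by (intro sqint_loc_integrable[OF assms(1)] s sq)+
  fix \<phi> assume \<phi>: "\<phi> \<in> test_functions \<Omega>"
  note t = test_functions_sqint[OF assms(1) \<phi>]
  have m: "(LINT x|lebesgue_on \<Omega>. (h x + c * k x) * w x) = (LINT x|lebesgue_on \<Omega>. h x * w x) + c * (LINT x|lebesgue_on \<Omega>. k x * w x)"
    if "sqint (lebesgue_on \<Omega>) h" "sqint (lebesgue_on \<Omega>) k" "sqint (lebesgue_on \<Omega>) w" for h k w :: "'a \<Rightarrow> real"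
    using sqint_inner[OF that(1,3)] sqint_inner[OF that(2,3)] by (simp add: distrib_right mult.assoc)
  show "(LINT x|lebesgue_on \<Omega>. (u x + c * v x) * pd UNIV b \<phi> x) = - (LINT x|lebesgue_on \<Omega>. (f x + c * g x) * \<phi> x)"
    using assms(3,4) \<phi> by (simp add: m sq t assms(2) has_weak_pderiv_def)
qed

text \<open>Both sides of the defining identity are inner products with a fixed square-integrable
  function, hence continuous in L2: weak differentiation is a closed operator.\<close>

lemma has_weak_pderiv_L2_limit:
  fixes u g :: "nat \<Rightarrow> 'a::euclidean_space \<Rightarrow> real"
  assumes "open \<Omega>" "b \<in> Basis" "\<And>n. has_weak_pderiv \<Omega> b (u n) (g n)"
    and sq: "\<And>n. sqint (lebesgue_on \<Omega>) (u n)" "\<And>n. sqint (lebesgue_on \<Omega>) (g n)" "sqint (lebesgue_on \<Omega>) v" "sqint (lebesgue_on \<Omega>) w"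
    and lim: "(\<lambda>n. nsq (lebesgue_on \<Omega>) (\<lambda>x. u n x - v x)) \<longlonglongrightarrow> 0" "(\<lambda>n. nsq (lebesgue_on \<Omega>) (\<lambda>x. g n x - w x)) \<longlonglongrightarrow> 0"
  shows "has_weak_pderiv \<Omega> b v w"
  unfolding has_weak_pderiv_def
proof (intro conjI ballI)
  show "loc_integrable \<Omega> v" "loc_integrable \<Omega> w" by (intro sqint_loc_integrable[OF assms(1)] sq)+
  fix \<phi> assume \<phi>: "\<phi> \<in> test_functions \<Omega>"
  note t = test_functions_sqint[OF assms(1) \<phi>]
  have "(\<lambda>n. LINT x|lebesgue_on \<Omega>. u n x * pd UNIV b \<phi> x) \<longlonglongrightarrow> (LINT x|lebesgue_on \<Omega>. v x * pd UNIV b \<phi> x)"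
    using sqint_tendsto_inner[OF sq(1,3) t(2)[OF assms(2)] lim(1)] by simp
  moreover have "(\<lambda>n. - (LINT x|lebesgue_on \<Omega>. g n x * \<phi> x)) \<longlonglongrightarrow> - (LINT x|lebesgue_on \<Omega>. w x * \<phi> x)"
    using tendsto_minus[OF sqint_tendsto_inner[OF sq(2,4) t(1) lim(2)]] by simp
  moreover have "(LINT x|lebesgue_on \<Omega>. u n x * pd UNIV b \<phi> x) = - (LINT x|lebesgue_on \<Omega>. g n x * \<phi> x)" for n
    using assms(3) \<phi> by (simp add: has_weak_pderiv_def)
  ultimately show "(LINT x|lebesgue_on \<Omega>. v x * pd UNIV b \<phi> x) = - (LINT x|lebesgue_on \<Omega>. w x * \<phi> x)"
    by (simp add: LIMSEQ_unique)
qed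

section \<open>Weak gradients as vector fields\<close>

definition tgrad :: "('a::euclidean_space \<Rightarrow> real) \<Rightarrow> 'a \<Rightarrow> 'a" where
  "tgrad \<phi> x = (\<Sum>b\<in>Basis. pd UNIV b \<phi> x *\<^sub>R b)"

text \<open>A relation instead of the chosen \<open>weak_grad\<close>: sums and limits then have
  explicitly given gradients, and the choice is eliminated only where an energy is evaluated.
  Square-integrability is included, so the relation also expresses membership in H^1.\<close>

definition has_wgrad :: "'a::euclidean_space set \<Rightarrow> ('a \<Rightarrow> real) \<Rightarrow> ('a \<Rightarrow> 'a) \<Rightarrow> bool" where
  "has_wgrad \<Omega> u G \<longleftrightarrow> sqint (lebesgue_on \<Omega>) u \<and> sqint (lebesgue_on \<Omega>) G \<and>
     (\<forall>b\<in>Basis. has_weak_pderiv \<Omega> b u (\<lambda>x. G x \<bullet> b))"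

lemma tgrad_inner [simp]: "b \<in> Basis \<Longrightarrow> tgrad \<phi> x \<bullet> b = pd UNIV b \<phi> x"
  by (simp add: tgrad_def inner_sum_left inner_Basis if_distrib sum.delta cong: if_cong)

lemma norm_sq_eq_sum: "(norm (x::'a::euclidean_space))\<^sup>2 = (\<Sum>b\<in>Basis. (x \<bullet> b)\<^sup>2)"
  unfolding power2_norm_eq_inner by (subst euclidean_inner) (simp add: power2_eq_square)

lemma sqint_component:
  fixes G :: "'c \<Rightarrow> 'a::euclidean_space"
  assumes "sqint M G" "b \<in> Basis"
  shows "sqint M (\<lambda>x. G x \<bullet> b)"
proof (rule sqint_bound)
  show "(\<lambda>x. G x \<bullet> b) \<in> borel_measurable M" using assms(1) by (auto simp: sqint_def)
  show "integrable M (\<lambda>x. (norm (G x))\<^sup>2)" using assms(1) by (simp add: sqint_def)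
  show "AE x in M. (norm (G x \<bullet> b))\<^sup>2 \<le> (norm (G x))\<^sup>2"
    using Basis_le_norm[OF assms(2)] by (intro AE_I2 power_mono) auto
qed

lemma sqint_of_components:
  fixes g :: "'a::euclidean_space \<Rightarrow> 'c \<Rightarrow> real"
  assumes "\<And>b. b \<in> Basis \<Longrightarrow> sqint M (g b)"
  shows "sqint M (\<lambda>x. \<Sum>b\<in>Basis. g b x *\<^sub>R b)"
proof (rule sqint_bound)
  show "(\<lambda>x. \<Sum>b\<in>Basis. g b x *\<^sub>R b) \<in> borel_measurable M"
    using assms by (intro borel_measurable_sum borel_measurable_scaleR) (auto simp: sqint_def)
  show "integrable M (\<lambda>x. \<Sum>b\<in>Basis. (g b x)\<^sup>2)"
    using assms by (intro Bochner_Integration.integrable_sum) (auto simp: sqint_def)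
  show "AE x in M. (norm (\<Sum>b\<in>Basis. g b x *\<^sub>R b))\<^sup>2 \<le> (\<Sum>b\<in>Basis. (g b x)\<^sup>2)"
    by (intro AE_I2) (simp add: norm_sq_eq_sum)
qed

lemma nsq_components:
  fixes G :: "'c \<Rightarrow> 'a::euclidean_space"
  assumes "sqint M G"
  shows "nsq M G = (\<Sum>b\<in>Basis. nsq M (\<lambda>x. G x \<bullet> b))"
  unfolding norm_sq_eq_sum[of "G x" for x]
  using sqint_component[OF assms] by (subst Bochner_Integration.integral_sum) (auto simp: sqint_def)

lemma sqint_cong_AE:
  assumes "f \<in> borel_measurable M" "sqint M g" "AE x in M. f x = g x"
  shows "sqint M f" "nsq M f = nsq M g"
proof -
  have m: "(\<lambda>x. (norm (f x))\<^sup>2) \<in> borel_measurable M" "(\<lambda>x. (norm (g x))\<^sup>2) \<in> borel_measurable M"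
    using assms by (auto simp: sqint_def)
  have e: "AE x in M. (norm (f x))\<^sup>2 = (norm (g x))\<^sup>2" using assms(3) by eventually_elim simp
  show "sqint M f" using integrable_cong_AE[OF m e] assms by (auto simp: sqint_def)
  show "nsq M f = nsq M g" by (rule integral_cong_AE[OF m e])
qed

text \<open>An open set is a countable union of compact boxes, on each of which measurability is
  known. Of a weak derivative obtained by choice only local integrability is available, so
  measurability on \<Omega> has to come from here.\<close>

lemma loc_integrable_measurable:
  fixes g :: "'a::euclidean_space \<Rightarrow> real"
  assumes "open \<Omega>" "loc_integrable \<Omega> g"
  shows "g \<in> borel_measurable (lebesgue_on \<Omega>)"
proof -
  obtain \<D> where D: "countable \<D>" "\<And>X. X \<in> \<D> \<Longrightarrow> \<exists>a b. X = cbox a b" "\<Union>\<D> = \<Omega>" "\<D> \<subseteq> Pow \<Omega>"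
    using open_countable_Union_open_cbox[OF assms(1)] by metis
  show ?thesis
  proof (rule measurableI)
    fix A :: "real set" assume A: "A \<in> sets borel"
    have "g -` A \<inter> X \<in> sets lebesgue" if "X \<in> \<D>" for X
    proof -
      have X: "compact X" "X \<subseteq> \<Omega>" using D(2)[OF that] D(4) that by auto
      then have "g \<in> borel_measurable (lebesgue_on X)" using assms(2) by (auto simp: loc_integrable_def)
      from measurable_sets[OF this A] show ?thesis
        using X(1) by (auto simp: sets_restrict_space_iff borel_compact)
    qed
    then have "(\<Union>X\<in>\<D>. g -` A \<inter> X) \<in> sets lebesgue" using D(1) by (intro sets.countable_UN') auto
    moreover have "(\<Union>X\<in>\<D>. g -` A \<inter> X) = g -` A \<inter> \<Omega>" using D(3) by auto
    ultimately show "g -` A \<inter> space (lebesgue_on \<Omega>) \<in> sets (lebesgue_on \<Omega>)"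
      using assms(1) by (simp add: sets_restrict_space_iff open_sets_lebesgue)
  qed simp
qed

lemma weak_pd_measurable:
  assumes "open \<Omega>" "has_weak_pderiv \<Omega> b u g"
  shows "weak_pd \<Omega> b u \<in> borel_measurable (lebesgue_on \<Omega>)"
  using weak_pd(1)[OF assms] loc_integrable_measurable[OF assms(1)] by (auto simp: has_weak_pderiv_def)

lemma weak_grad_eq:
  assumes "open \<Omega>" "has_wgrad \<Omega> u G"
  shows "AE x in lebesgue_on \<Omega>. weak_grad \<Omega> u x = G x" "weak_grad \<Omega> u \<in> borel_measurable (lebesgue_on \<Omega>)"
proof -
  have w: "has_weak_pderiv \<Omega> b u (\<lambda>x. G x \<bullet> b)" if "b \<in> Basis" for b using assms(2) that by (simp add: has_wgrad_def)
  have "AE x in lebesgue_on \<Omega>. \<forall>b\<in>Basis. weak_pd \<Omega> b u x = G x \<bullet> b"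
    by (intro AE_finite_allI finite_Basis weak_pd(2)[OF assms(1)] w)
  then show "AE x in lebesgue_on \<Omega>. weak_grad \<Omega> u x = G x"
    by eventually_elim (simp add: weak_grad_def euclidean_representation)
  show "weak_grad \<Omega> u \<in> borel_measurable (lebesgue_on \<Omega>)" unfolding weak_grad_def
    by (intro borel_measurable_sum borel_measurable_scaleR weak_pd_measurable[OF assms(1) w]) auto
qed

lemma has_wgrad_linear:
  assumes "open \<Omega>" "has_wgrad \<Omega> u F" "has_wgrad \<Omega> v G"
  shows "has_wgrad \<Omega> (\<lambda>x. u x + c * v x) (\<lambda>x. F x + c *\<^sub>R G x)"
proof -
  have sq: "sqint (lebesgue_on \<Omega>) u" "sqint (lebesgue_on \<Omega>) v" "sqint (lebesgue_on \<Omega>) F" "sqint (lebesgue_on \<Omega>) G"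
    and w: "\<And>b. b \<in> Basis \<Longrightarrow> has_weak_pderiv \<Omega> b u (\<lambda>x. F x \<bullet> b)" "\<And>b. b \<in> Basis \<Longrightarrow> has_weak_pderiv \<Omega> b v (\<lambda>x. G x \<bullet> b)"
    using assms by (auto simp: has_wgrad_def)
  have "has_weak_pderiv \<Omega> b (\<lambda>x. u x + c * v x) (\<lambda>x. F x \<bullet> b + c * (G x \<bullet> b))" if "b \<in> Basis" for b
    by (intro has_weak_pderiv_linear[OF assms(1)] that w sq sqint_component)
  then show ?thesis unfolding has_wgrad_def
    using sqint_add(1)[OF sq(1) sqint_scaleR[OF sq(2), of c]] sqint_add(1)[OF sq(3) sqint_scaleR[OF sq(4), of c]]
    by (simp add: inner_add_left)
qed

lemma has_wgrad_diff:
  assumes "open \<Omega>" "has_wgrad \<Omega> u F" "has_wgrad \<Omega> v G"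
  shows "has_wgrad \<Omega> (\<lambda>x. u x - v x) (\<lambda>x. F x - G x)"
  using has_wgrad_linear[OF assms, of "-1"] by simp

lemma has_wgrad_add:
  assumes "open \<Omega>" "has_wgrad \<Omega> u F" "has_wgrad \<Omega> v G"
  shows "has_wgrad \<Omega> (\<lambda>x. u x + v x) (\<lambda>x. F x + G x)"
  using has_wgrad_linear[OF assms, of 1] by simp

lemma has_wgrad_test:
  assumes "open \<Omega>" "\<phi> \<in> test_functions \<Omega>"
  shows "has_wgrad \<Omega> \<phi> (tgrad \<phi>)"
  unfolding has_wgrad_def
proof (intro conjI ballI)
  show "sqint (lebesgue_on \<Omega>) \<phi>" by (rule test_functions_sqint[OF assms])
  show "sqint (lebesgue_on \<Omega>) (tgrad \<phi>)" unfolding tgrad_def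
    by (intro sqint_of_components test_functions_sqint[OF assms])
  show "has_weak_pderiv \<Omega> b \<phi> (\<lambda>x. tgrad \<phi> x \<bullet> b)" if "b \<in> Basis" for b
    using has_weak_pderiv_test_function[OF assms(1) that assms(2)] that by simp
qed

lemma tgrad_linear:
  assumes "\<phi> \<in> test_functions \<Omega>" "\<eta> \<in> test_functions \<Omega>"
  shows "(\<lambda>x. \<phi> x + c * \<eta> x) \<in> test_functions \<Omega>" "tgrad (\<lambda>x. \<phi> x + c * \<eta> x) = (\<lambda>x. tgrad \<phi> x + c *\<^sub>R tgrad \<eta> x)"
proof -
  note c = test_functions_cmult[OF assms(2), where c=c]
  show "(\<lambda>x. \<phi> x + c * \<eta> x) \<in> test_functions \<Omega>" by (intro test_functions_add assms c)
  show "tgrad (\<lambda>x. \<phi> x + c * \<eta> x) = (\<lambda>x. tgrad \<phi> x + c *\<^sub>R tgrad \<eta> x)"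
    unfolding tgrad_def by (simp add: test_functions_add(2)[OF assms(1) c(1)] c(2) scaleR_add_left sum.distrib scaleR_sum_right)
qed

lemma Hk1_iff:
  assumes "open \<Omega>"
  shows "u \<in> Hk 1 \<Omega> \<longleftrightarrow> (\<exists>G. has_wgrad \<Omega> u G)"
proof
  assume "u \<in> Hk 1 \<Omega>"
  then have u: "sqint (lebesgue_on \<Omega>) u" "\<forall>b\<in>Basis. \<exists>g. sqint (lebesgue_on \<Omega>) g \<and> has_weak_pderiv \<Omega> b u g"
    by (auto simp: L2_iff_sqint Bex_def)
  then obtain g where g: "\<And>b. b \<in> Basis \<Longrightarrow> sqint (lebesgue_on \<Omega>) (g b)" "\<And>b. b \<in> Basis \<Longrightarrow> has_weak_pderiv \<Omega> b u (g b)"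
    by metis
  have "(\<lambda>x. (\<Sum>b\<in>Basis. g b x *\<^sub>R b) \<bullet> b) = g b" if "b \<in> Basis" for b using that by auto
  then have "has_wgrad \<Omega> u (\<lambda>x. \<Sum>b\<in>Basis. g b x *\<^sub>R b)" unfolding has_wgrad_def
    using u(1) g by (auto intro: sqint_of_components)
  then show "\<exists>G. has_wgrad \<Omega> u G" by blast
next
  assume "\<exists>G. has_wgrad \<Omega> u G"
  then obtain G where G: "has_wgrad \<Omega> u G" by blast
  have "(\<lambda>x. G x \<bullet> b) \<in> L2 \<Omega>" if "b \<in> Basis" for b
    using G that by (auto simp: has_wgrad_def L2_iff_sqint intro: sqint_component)
  then show "u \<in> Hk 1 \<Omega>" using G by (auto simp: has_wgrad_def L2_iff_sqint[of u])
qed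

section \<open>The H^1 norm, the closure of the test functions, and Poincare's inequality\<close>

lemma L2_norm_sq: "(L2_norm \<Omega> f)\<^sup>2 = nsq (lebesgue_on \<Omega>) f"
  by (simp add: L2_norm_def)

lemma H1_norm_eq:
  assumes "open \<Omega>" "has_wgrad \<Omega> u G"
  shows "H1_norm \<Omega> u = sqrt (nsq (lebesgue_on \<Omega>) u + nsq (lebesgue_on \<Omega>) G)"
proof -
  have "nsq (lebesgue_on \<Omega>) (weak_pd \<Omega> b u) = nsq (lebesgue_on \<Omega>) (\<lambda>x. G x \<bullet> b)" if "b \<in> Basis" for b
  proof (rule sqint_cong_AE)
    have w: "has_weak_pderiv \<Omega> b u (\<lambda>x. G x \<bullet> b)" using assms(2) that by (simp add: has_wgrad_def)
    show "weak_pd \<Omega> b u \<in> borel_measurable (lebesgue_on \<Omega>)" by (rule weak_pd_measurable[OF assms(1) w])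
    show "AE x in lebesgue_on \<Omega>. weak_pd \<Omega> b u x = G x \<bullet> b" by (rule weak_pd(2)[OF assms(1) w])
    show "sqint (lebesgue_on \<Omega>) (\<lambda>x. G x \<bullet> b)" using assms(2) that by (auto simp: has_wgrad_def intro: sqint_component)
  qed
  then show ?thesis unfolding H1_norm_def L2_norm_sq
    using nsq_components[of "lebesgue_on \<Omega>" G] assms(2) by (simp add: has_wgrad_def)
qed

lemma H10_approx:
  assumes "open \<Omega>" "v \<in> H10 \<Omega>" "has_wgrad \<Omega> v G" "e > 0"
  obtains \<phi> where "\<phi> \<in> test_functions \<Omega>" "nsq (lebesgue_on \<Omega>) (\<lambda>x. v x - \<phi> x) < e"
    "nsq (lebesgue_on \<Omega>) (\<lambda>x. G x - tgrad \<phi> x) < e"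
proof -
  obtain \<phi> where \<phi>: "\<phi> \<in> test_functions \<Omega>" "H1_norm \<Omega> (\<lambda>x. v x - \<phi> x) < sqrt e"
  proof -
    have "\<forall>\<epsilon>>0. \<exists>\<phi>\<in>test_functions \<Omega>. H1_norm \<Omega> (\<lambda>x. v x - \<phi> x) < \<epsilon>" "sqrt e > 0"
      using assms(2,4) by (auto simp: H10_def)
    then show ?thesis using that by blast
  qed
  have "nsq (lebesgue_on \<Omega>) (\<lambda>x. v x - \<phi> x) + nsq (lebesgue_on \<Omega>) (\<lambda>x. G x - tgrad \<phi> x) < e"
    using \<phi>(2) H1_norm_eq[OF assms(1) has_wgrad_diff[OF assms(1,3) has_wgrad_test[OF assms(1) \<phi>(1)]]] by simp
  moreover have "nsq (lebesgue_on \<Omega>) (\<lambda>x. v x - \<phi> x) \<ge> 0" "nsq (lebesgue_on \<Omega>) (\<lambda>x. G x - tgrad \<phi> x) \<ge> 0"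
    by (rule nsq_nonneg)+
  ultimately show ?thesis using that[OF \<phi>(1)] by linarith
qed

lemma H10I:
  assumes "open \<Omega>" "has_wgrad \<Omega> v G"
    and "\<And>e. e > 0 \<Longrightarrow> \<exists>\<phi>\<in>test_functions \<Omega>. nsq (lebesgue_on \<Omega>) (\<lambda>x. v x - \<phi> x) + nsq (lebesgue_on \<Omega>) (\<lambda>x. G x - tgrad \<phi> x) < e"
  shows "v \<in> H10 \<Omega>"
  unfolding H10_def
proof (intro CollectI conjI allI impI)
  show "v \<in> Hk 1 \<Omega>" using assms(1,2) Hk1_iff by blast
  fix e :: real assume "e > 0"
  then obtain \<phi> where \<phi>: "\<phi> \<in> test_functions \<Omega>"
    "nsq (lebesgue_on \<Omega>) (\<lambda>x. v x - \<phi> x) + nsq (lebesgue_on \<Omega>) (\<lambda>x. G x - tgrad \<phi> x) < e\<^sup>2"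
    using assms(3)[of "e\<^sup>2"] by auto
  have "H1_norm \<Omega> (\<lambda>x. v x - \<phi> x) < sqrt (e\<^sup>2)"
    unfolding H1_norm_eq[OF assms(1) has_wgrad_diff[OF assms(1,2) has_wgrad_test[OF assms(1) \<phi>(1)]]]
    using \<phi>(2) by (rule real_sqrt_less_mono)
  then show "\<exists>\<phi>\<in>test_functions \<Omega>. H1_norm \<Omega> (\<lambda>x. v x - \<phi> x) < e"
    using \<phi>(1) \<open>e > 0\<close> by auto
qed

lemma H10_wgrad:
  assumes "open \<Omega>" "v \<in> H10 \<Omega>"
  obtains G where "has_wgrad \<Omega> v G"
  using assms(2) Hk1_iff[OF assms(1), of v] that unfolding H10_def by blast

text \<open>If \<phi> approximates v, then \<eta> - \<phi> approximates \<eta> - v. Such differences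
  are the test functions in the orthogonality behind Dirichlet's principle.\<close>

lemma test_diff_H10:
  assumes "open \<Omega>" "v \<in> H10 \<Omega>" "\<eta> \<in> test_functions \<Omega>"
  shows "(\<lambda>x. \<eta> x - v x) \<in> H10 \<Omega>"
proof -
  obtain G where G: "has_wgrad \<Omega> v G" using H10_wgrad[OF assms(1,2)] by metis
  show ?thesis
  proof (rule H10I[OF assms(1) has_wgrad_diff[OF assms(1) has_wgrad_test[OF assms(1,3)] G]])
    fix e :: real assume "e > 0"
    then obtain \<phi> where \<phi>: "\<phi> \<in> test_functions \<Omega>" "nsq (lebesgue_on \<Omega>) (\<lambda>x. v x - \<phi> x) < e/2"
      "nsq (lebesgue_on \<Omega>) (\<lambda>x. G x - tgrad \<phi> x) < e/2"
      using H10_approx[OF assms(1,2) G, of "e/2"] by auto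
    note l = tgrad_linear[OF assms(3) \<phi>(1), of "-1"]
    have n: "norm ((\<eta> x - v x) - (\<eta> x + (- 1) * \<phi> x)) = norm (v x - \<phi> x)"
       "norm ((tgrad \<eta> x - G x) - (tgrad \<eta> x + (- 1) *\<^sub>R tgrad \<phi> x)) = norm (G x - tgrad \<phi> x)" for x
      by (simp_all add: algebra_simps norm_minus_commute)
    show "\<exists>\<zeta>\<in>test_functions \<Omega>. nsq (lebesgue_on \<Omega>) (\<lambda>x. (\<eta> x - v x) - \<zeta> x) + nsq (lebesgue_on \<Omega>) (\<lambda>x. (tgrad \<eta> x - G x) - tgrad \<zeta> x) < e"
      using \<phi>(2,3) by (intro bexI[OF _ l(1)]) (simp only: l(2) n)
  qed
qed

text \<open>The derivative of (x \<bullet> b) \<phi>^2 along b has integral zero, which expresses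
  the integral of \<phi>^2 by that of -2 (x \<bullet> b) \<phi> times the derivative of \<phi>.
  Young's inequality absorbs one half of it. Only the extent of \<Omega> in the single direction b
  enters.\<close>

lemma Poincare_test:
  fixes \<phi> :: "'a::euclidean_space \<Rightarrow> real"
  assumes "open \<Omega>" "\<phi> \<in> test_functions \<Omega>" "b \<in> Basis" and R: "\<And>x. x \<in> \<Omega> \<Longrightarrow> \<bar>x \<bullet> b\<bar> \<le> R"
  shows "nsq (lebesgue_on \<Omega>) \<phi> \<le> 4 * R\<^sup>2 * nsq (lebesgue_on \<Omega>) (tgrad \<phi>)"
proof -
  obtain K where K: "compact K" "K \<subseteq> \<Omega>" "\<And>x. x \<notin> K \<Longrightarrow> \<phi> x = 0" "\<And>x b. x \<notin> K \<Longrightarrow> pd UNIV b \<phi> x = 0"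
    using test_functionsE[OF assms(2)] by metis
  obtain B where B: "B \<ge> 0" "\<And>x. \<bar>\<phi> x\<bar> \<le> B" "\<And>x b. b \<in> Basis \<Longrightarrow> \<bar>pd UNIV b \<phi> x\<bar> \<le> B"
    using test_functions_bounded[OF assms(2)] by metis
  note \<phi>d = test_functions_differentiable[OF assms(2)]
  define q where "q p = (p \<bullet> b) * (\<phi> p)\<^sup>2" for p
  define g where "g p = (\<phi> p)\<^sup>2 + 2 * (p \<bullet> b) * \<phi> p * pd UNIV b \<phi> p" for p
  have qc: "continuous_on UNIV q" unfolding q_def using \<phi>d by (intro continuous_intros) auto
  have "((\<lambda>t. q (p + t *\<^sub>R b)) has_real_derivative g p) (at 0)" for p
  proof -
    note d = test_functions_line_derivative[OF assms(2), of p b]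
    have "((\<lambda>t. (p \<bullet> b + t) * (\<phi> (p + t *\<^sub>R b))\<^sup>2) has_real_derivative g p) (at 0)"
      by (rule derivative_eq_intros d refl)+ (simp add: g_def)
    then show ?thesis using assms(3) by (simp add: q_def inner_add_left)
  qed
  moreover have "\<bar>g p\<bar> \<le> B\<^sup>2 + 2 * \<bar>R\<bar> * B * B" for p
  proof (cases "p \<in> K")
    case True
    have "\<bar>(\<phi> p)\<^sup>2\<bar> \<le> B\<^sup>2" using power_mono[OF B(2)[of p], of 2] by simp
    moreover have "\<bar>2 * (p \<bullet> b) * \<phi> p * pd UNIV b \<phi> p\<bar> \<le> 2 * \<bar>R\<bar> * B * B"
      unfolding abs_mult using R[of p] K(2) True B(1) B(2)[of p] B(3)[OF assms(3), of p] by (intro mult_mono) auto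
    ultimately show ?thesis unfolding g_def by linarith
  next
    case False
    then show ?thesis using K B(1) by (simp add: g_def)
  qed
  ultimately have g: "integrable lebesgue g" "(LINT x|lebesgue. g x) = 0"
    using integral_line_derivative_eq_0[OF qc K(1), where N="{}" and b=b and g=g and C="B\<^sup>2 + 2 * \<bar>R\<bar> * B * B"] K(3) by (auto simp: q_def)
  have i: "integrable lebesgue (\<lambda>x. (\<phi> x)\<^sup>2)" "integrable lebesgue (\<lambda>x. (pd UNIV b \<phi> x)\<^sup>2)"
    using K \<phi>d assms(3) by (auto intro!: compactly_supported_integrable(2)[OF _ K(1)] continuous_intros)
  have pt: "(\<phi> x)\<^sup>2 \<le> g x + ((1/2) * (\<phi> x)\<^sup>2 + 2 * R\<^sup>2 * (pd UNIV b \<phi> x)\<^sup>2)" for x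
  proof (cases "x \<in> K")
    case True
    let ?d = "pd UNIV b \<phi> x"
    \<comment> \<open>Half of this square is the Young inequality with the weights chosen so that
      exactly one half of \<phi>^2 remains to be absorbed.\<close>
    have "0 \<le> (\<phi> x + 2 * (x \<bullet> b) * ?d)\<^sup>2" by simp
    moreover have "(x \<bullet> b)\<^sup>2 * ?d\<^sup>2 \<le> R\<^sup>2 * ?d\<^sup>2"
      using R[of x] True K(2) by (intro mult_right_mono) (auto simp: abs_le_square_iff[symmetric])
    ultimately show ?thesis unfolding g_def by (simp add: power2_eq_square algebra_simps)
  qed (simp add: K g_def)
  have "(LINT x|lebesgue. (\<phi> x)\<^sup>2) \<le> (LINT x|lebesgue. g x + ((1/2) * (\<phi> x)\<^sup>2 + 2 * R\<^sup>2 * (pd UNIV b \<phi> x)\<^sup>2))"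
    using g i pt by (intro integral_mono) auto
  also have "\<dots> = (1/2) * (LINT x|lebesgue. (\<phi> x)\<^sup>2) + 2 * R\<^sup>2 * (LINT x|lebesgue. (pd UNIV b \<phi> x)\<^sup>2)"
    using g i by simp
  finally have 1: "(LINT x|lebesgue. (\<phi> x)\<^sup>2) \<le> 4 * R\<^sup>2 * (LINT x|lebesgue. (pd UNIV b \<phi> x)\<^sup>2)" by simp
  have e: "(LINT x|lebesgue. (h x)\<^sup>2) = nsq (lebesgue_on \<Omega>) h" if "\<And>x. x \<notin> K \<Longrightarrow> h x = 0" for h :: "'a \<Rightarrow> real"
  proof -
    have "(\<lambda>x. indicator \<Omega> x * (h x)\<^sup>2) = (\<lambda>x. (h x)\<^sup>2)" using that K(2) by (force simp: indicator_def fun_eq_iff)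
    then show ?thesis using assms(1) by (simp add: lebesgue_on_integrable_iff(2) open_sets_lebesgue)
  qed
  have t: "sqint (lebesgue_on \<Omega>) (tgrad \<phi>)" using has_wgrad_test[OF assms(1,2)] by (simp add: has_wgrad_def)
  have "nsq (lebesgue_on \<Omega>) (pd UNIV b \<phi>) \<le> nsq (lebesgue_on \<Omega>) (tgrad \<phi>)"
  proof (rule integral_mono)
    show "integrable (lebesgue_on \<Omega>) (\<lambda>x. (norm (pd UNIV b \<phi> x))\<^sup>2)"
      using test_functions_sqint(2)[OF assms(1,2,3)] by (simp add: sqint_def)
    show "integrable (lebesgue_on \<Omega>) (\<lambda>x. (norm (tgrad \<phi> x))\<^sup>2)" using t by (simp add: sqint_def)
    show "(norm (pd UNIV b \<phi> x))\<^sup>2 \<le> (norm (tgrad \<phi> x))\<^sup>2" for x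
      using Basis_le_norm[OF assms(3), of "tgrad \<phi> x"] assms(3) by (intro power_mono) auto
  qed
  then have "4 * R\<^sup>2 * nsq (lebesgue_on \<Omega>) (pd UNIV b \<phi>) \<le> 4 * R\<^sup>2 * nsq (lebesgue_on \<Omega>) (tgrad \<phi>)"
    by (intro mult_left_mono) auto
  with 1 e[of \<phi>] e[of "pd UNIV b \<phi>"] K show ?thesis by (simp add: K)
qed

section \<open>The weighted Dirichlet problem\<close>

locale weighted =
  fixes \<Omega> :: "'a::euclidean_space set" and s :: "'a \<Rightarrow> real" and c C :: real
  assumes \<Omega>: "open \<Omega>" and s_meas: "s \<in> borel_measurable (lebesgue_on \<Omega>)"
    and c: "c > 0" and s_bounds: "\<And>x. x \<in> \<Omega> \<Longrightarrow> c \<le> s x" "\<And>x. x \<in> \<Omega> \<Longrightarrow> s x \<le> C"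
begin

abbreviation "M \<equiv> lebesgue_on \<Omega>"

text \<open>Multiplication by the root of the weight turns the weighted inner product into the plain
  one, so the L2 theory above applies without change. The two-sided bounds on \<open>s\<close> make
  it an isomorphism.\<close>

definition W :: "('a \<Rightarrow> 'a) \<Rightarrow> 'a \<Rightarrow> 'a" where
  "W f x = sqrt (s x) *\<^sub>R f x"

lemma W_linear: "W (\<lambda>x. f x + t *\<^sub>R g x) = (\<lambda>x. W f x + t *\<^sub>R W g x)"
  "W (\<lambda>x. f x - g x) = (\<lambda>x. W f x - W g x)" "W (\<lambda>x. f x + g x) = (\<lambda>x. W f x + W g x)"
  by (auto simp: W_def algebra_simps)

lemma W_norm_sq: "x \<in> \<Omega> \<Longrightarrow> (norm (W f x))\<^sup>2 = s x * (norm (f x))\<^sup>2"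
  using s_bounds(1)[of x] c by (simp add: W_def power_mult_distrib)

lemma W_inner: "x \<in> \<Omega> \<Longrightarrow> W f x \<bullet> W g x = s x * (f x \<bullet> g x)"
  using s_bounds(1)[of x] c by (simp add: W_def flip: mult.assoc real_sqrt_mult)

lemma nsq_W: "nsq M (W f) = (LINT x|M. s x * (norm (f x))\<^sup>2)"
  by (intro Bochner_Integration.integral_cong) (auto simp: W_norm_sq)

lemma integral_W_inner: "(LINT x|M. W f x \<bullet> W g x) = (LINT x|M. s x * (f x \<bullet> g x))"
  by (intro Bochner_Integration.integral_cong) (auto simp: W_inner)

lemma sqint_W:
  assumes "sqint M f" shows "sqint M (W f)" "c * nsq M f \<le> nsq M (W f)" "nsq M (W f) \<le> C * nsq M f"
proof -
  have m: "W f \<in> borel_measurable M"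
    unfolding W_def using assms s_meas by (intro borel_measurable_scaleR borel_measurable_sqrt) (auto simp: sqint_def)
  have up: "(norm (W f x))\<^sup>2 \<le> C * (norm (f x))\<^sup>2" and lo: "c * (norm (f x))\<^sup>2 \<le> (norm (W f x))\<^sup>2" if "x \<in> \<Omega>" for x
    unfolding W_norm_sq[OF that] using s_bounds[OF that] by (auto intro: mult_right_mono)
  have i: "integrable M (\<lambda>x. (norm (f x))\<^sup>2)" using assms by (simp add: sqint_def)
  show W: "sqint M (W f)"
    by (rule sqint_bound[OF m, of "\<lambda>x. C * (norm (f x))\<^sup>2"]) (use i up in \<open>auto intro!: AE_I2\<close>)
  have iW: "integrable M (\<lambda>x. (norm (W f x))\<^sup>2)" using W by (simp add: sqint_def)
  have "(LINT x|M. c * (norm (f x))\<^sup>2) \<le> nsq M (W f)" using i iW lo by (intro integral_mono) auto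
  then show "c * nsq M f \<le> nsq M (W f)" by simp
  have "nsq M (W f) \<le> (LINT x|M. C * (norm (f x))\<^sup>2)" using i iW up by (intro integral_mono) auto
  then show "nsq M (W f) \<le> C * nsq M f" by simp
qed

text \<open>The minimizer is found as a weighted field; dividing by the root of the weight, which is
  bounded away from zero, recovers a gradient from it.\<close>

lemma W_scaled_inverse:
  assumes "sqint M F"
  obtains \<Gamma> where "sqint M \<Gamma>" "\<And>x. x \<in> \<Omega> \<Longrightarrow> W \<Gamma> x = F x"
proof
  let ?\<Gamma> = "\<lambda>x. (1 / sqrt (s x)) *\<^sub>R F x"
  show "W ?\<Gamma> x = F x" if "x \<in> \<Omega>" for x using s_bounds(1)[OF that] c by (simp add: W_def)
  have m: "?\<Gamma> \<in> borel_measurable M"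
    using assms s_meas by (intro borel_measurable_scaleR borel_measurable_divide borel_measurable_sqrt) (auto simp: sqint_def)
  have "(norm (?\<Gamma> x))\<^sup>2 \<le> (1/c) * (norm (F x))\<^sup>2" if "x \<in> \<Omega>" for x
  proof -
    have "(norm (?\<Gamma> x))\<^sup>2 = (1 / s x) * (norm (F x))\<^sup>2"
      using s_bounds(1)[OF that] c by (simp add: power_mult_distrib power_divide)
    also have "\<dots> \<le> (1/c) * (norm (F x))\<^sup>2" using s_bounds(1)[OF that] c by (intro mult_right_mono) (auto simp: frac_le)
    finally show ?thesis .
  qed
  then show "sqint M ?\<Gamma>"
    by (intro sqint_bound[OF m, of "\<lambda>x. (1/c) * (norm (F x))\<^sup>2"])
       (use assms in \<open>auto simp: sqint_def intro!: AE_I2\<close>)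
qed

definition harmonic :: "('a \<Rightarrow> real) \<Rightarrow> ('a \<Rightarrow> real) \<Rightarrow> bool" where
  "harmonic h \<psi> \<longleftrightarrow> (\<lambda>p. \<psi> p - h p) \<in> H10 \<Omega> \<and>
     (\<forall>\<theta>\<in>H10 \<Omega>. (LINT p|M. s p * (weak_grad \<Omega> \<psi> p \<bullet> weak_grad \<Omega> \<theta> p)) = 0)"

lemma weak_grad_integrals:
  assumes "has_wgrad \<Omega> u F" "has_wgrad \<Omega> v G"
  shows "(LINT p|M. s p * (weak_grad \<Omega> u p \<bullet> weak_grad \<Omega> v p)) = (LINT x|M. W F x \<bullet> W G x)"
    "(LINT p|M. s p * (norm (weak_grad \<Omega> u p))\<^sup>2) = nsq M (W F)"
proof -
  note [measurable] = s_meas weak_grad_eq(2)[OF \<Omega> assms(1)] weak_grad_eq(2)[OF \<Omega> assms(2)]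
  have [measurable]: "F \<in> borel_measurable M" "G \<in> borel_measurable M"
    using assms by (auto simp: has_wgrad_def sqint_def)
  show "(LINT p|M. s p * (weak_grad \<Omega> u p \<bullet> weak_grad \<Omega> v p)) = (LINT x|M. W F x \<bullet> W G x)"
    unfolding integral_W_inner
  proof (rule integral_cong_AE)
    show "AE p in M. s p * (weak_grad \<Omega> u p \<bullet> weak_grad \<Omega> v p) = s p * (F p \<bullet> G p)"
      using weak_grad_eq(1)[OF \<Omega> assms(1)] weak_grad_eq(1)[OF \<Omega> assms(2)] by eventually_elim simp
  qed measurable
  show "(LINT p|M. s p * (norm (weak_grad \<Omega> u p))\<^sup>2) = nsq M (W F)"
    unfolding nsq_W
  proof (rule integral_cong_AE)
    show "AE p in M. s p * (norm (weak_grad \<Omega> u p))\<^sup>2 = s p * (norm (F p))\<^sup>2"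
      using weak_grad_eq(1)[OF \<Omega> assms(1)] by eventually_elim simp
  qed measurable
qed

text \<open>Pythagoras: writing \<psi> = h + v, the field of a competitor differs from that of
  \<psi> by the gradient of \<phi> - v, an element of H10 and hence orthogonal to the gradient of
  \<psi>. So \<open>J \<phi>\<close> exceeds \<open>I\<close> by the squared distance of the
  gradients, and density of the test functions makes the excess arbitrarily small. This holds for
  every solution \<psi>, in particular for the one selected by choice.\<close>

lemma harmonic_energy:
  assumes h: "has_wgrad \<Omega> h G" and \<psi>: "harmonic h \<psi>"
  defines "I \<equiv> (LINT p|M. s p * (norm (weak_grad \<Omega> \<psi> p))\<^sup>2)"
    and "J \<equiv> \<lambda>\<phi>. (LINT p|M. s p * (norm (G p + tgrad \<phi> p))\<^sup>2)"
  shows "\<And>\<phi>. \<phi> \<in> test_functions \<Omega> \<Longrightarrow> I \<le> J \<phi>"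
    "\<And>e. e > 0 \<Longrightarrow> \<exists>\<phi>\<in>test_functions \<Omega>. J \<phi> \<le> I + e"
proof -
  define v where "v p = \<psi> p - h p" for p
  have v: "v \<in> H10 \<Omega>" using \<psi> by (simp add: harmonic_def v_def[abs_def])
  obtain \<Gamma> where \<Gamma>: "has_wgrad \<Omega> v \<Gamma>" using H10_wgrad[OF \<Omega> v] by metis
  have "has_wgrad \<Omega> (\<lambda>p. h p + v p) (\<lambda>x. G x + \<Gamma> x)" by (rule has_wgrad_add[OF \<Omega> h \<Gamma>])
  then have \<psi>g: "has_wgrad \<Omega> \<psi> (\<lambda>x. G x + \<Gamma> x)" by (simp add: v_def)
  have I: "I = nsq M (W (\<lambda>x. G x + \<Gamma> x))" unfolding I_def by (rule weak_grad_integrals(2)[OF \<psi>g \<psi>g])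
  have J: "J \<phi> = I + nsq M (W (\<lambda>x. tgrad \<phi> x - \<Gamma> x))" if \<phi>: "\<phi> \<in> test_functions \<Omega>" for \<phi>
  proof -
    have g: "has_wgrad \<Omega> (\<lambda>x. \<phi> x - v x) (\<lambda>x. tgrad \<phi> x - \<Gamma> x)" by (rule has_wgrad_diff[OF \<Omega> has_wgrad_test[OF \<Omega> \<phi>] \<Gamma>])
    have "(\<lambda>x. \<phi> x - v x) \<in> H10 \<Omega>" by (rule test_diff_H10[OF \<Omega> v \<phi>])
    then have o: "(LINT x|M. W (\<lambda>x. G x + \<Gamma> x) x \<bullet> W (\<lambda>x. tgrad \<phi> x - \<Gamma> x) x) = 0"
      using \<psi> weak_grad_integrals(1)[OF \<psi>g g] by (simp add: harmonic_def)
    have sq: "sqint M (W (\<lambda>x. G x + \<Gamma> x))" "sqint M (W (\<lambda>x. tgrad \<phi> x - \<Gamma> x))"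
      using \<psi>g g by (auto simp: has_wgrad_def intro!: sqint_W)
    have "J \<phi> = nsq M (W (\<lambda>x. G x + tgrad \<phi> x))" unfolding J_def nsq_W ..
    also have "W (\<lambda>x. G x + tgrad \<phi> x) = (\<lambda>x. W (\<lambda>x. G x + \<Gamma> x) x + W (\<lambda>x. tgrad \<phi> x - \<Gamma> x) x)"
      by (auto simp: W_def algebra_simps)
    also have "nsq M \<dots> = I + nsq M (W (\<lambda>x. tgrad \<phi> x - \<Gamma> x))" using sqint_add(2)[OF sq] o I by simp
    finally show ?thesis .
  qed
  show "I \<le> J \<phi>" if "\<phi> \<in> test_functions \<Omega>" for \<phi>
    unfolding J[OF that] using nsq_nonneg[of M "W (\<lambda>x. tgrad \<phi> x - \<Gamma> x)"] by linarith
  show "\<exists>\<phi>\<in>test_functions \<Omega>. J \<phi> \<le> I + e" if "e > 0" for e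
  proof -
    have e': "e / (\<bar>C\<bar> + 1) > 0" using that by simp
    obtain \<phi> where \<phi>: "\<phi> \<in> test_functions \<Omega>" "nsq M (\<lambda>x. \<Gamma> x - tgrad \<phi> x) < e / (\<bar>C\<bar> + 1)"
      using H10_approx[OF \<Omega> v \<Gamma> e'] by metis
    have g: "has_wgrad \<Omega> (\<lambda>x. \<phi> x - v x) (\<lambda>x. tgrad \<phi> x - \<Gamma> x)" by (rule has_wgrad_diff[OF \<Omega> has_wgrad_test[OF \<Omega> \<phi>(1)] \<Gamma>])
    have "nsq M (W (\<lambda>x. tgrad \<phi> x - \<Gamma> x)) \<le> C * nsq M (\<lambda>x. tgrad \<phi> x - \<Gamma> x)"
      using g by (intro sqint_W) (auto simp: has_wgrad_def)
    also have "\<dots> \<le> (\<bar>C\<bar> + 1) * nsq M (\<lambda>x. tgrad \<phi> x - \<Gamma> x)" by (intro mult_right_mono) auto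
    also have "\<dots> \<le> (\<bar>C\<bar> + 1) * (e / (\<bar>C\<bar> + 1))"
      using \<phi>(2) by (intro mult_left_mono) (auto simp: norm_minus_commute)
    also have "\<dots> = e" by simp
    finally show ?thesis using J[OF \<phi>(1)] \<phi>(1) by (intro bexI[of _ \<phi>]) auto
  qed
qed

text \<open>Minimizing sequences of the weighted Dirichlet integral converge in L2 at the level of
  gradients. Poincare's inequality then makes the underlying test functions Cauchy as well, and
  closedness of weak differentiation identifies the limit of the gradients. Only boundedness of
  \<Omega> in one direction is assumed.\<close>

lemma harmonic_exists:
  assumes h: "has_wgrad \<Omega> h G" and b: "b \<in> Basis" and R: "\<And>x. x \<in> \<Omega> \<Longrightarrow> \<bar>x \<bullet> b\<bar> \<le> R"
  shows "\<exists>\<psi>. harmonic h \<psi>"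
proof -
  \<comment> \<open>The fields of all competitors. The property does not depend on the index, so it
    is used as a constant family of sets.\<close>
  define P where "P f \<longleftrightarrow> (\<exists>\<phi>\<in>test_functions \<Omega>. f = W (\<lambda>x. G x + tgrad \<phi> x))" for f
  have Gs: "sqint M G" using h by (simp add: has_wgrad_def)
  have ts: "sqint M (tgrad \<phi>)" if "\<phi> \<in> test_functions \<Omega>" for \<phi>
    using has_wgrad_test[OF \<Omega> that] by (simp add: has_wgrad_def)
  have Ps: "sqint M f" if "P f" for f
    using that unfolding P_def by (auto intro!: sqint_W sqint_add Gs ts)
  \<comment> \<open>The competitors form an affine space. This serves for midpoints as well as for
    the first variation.\<close>
  have Pt: "P (\<lambda>x. f x + t *\<^sub>R W (tgrad \<eta>) x)" if fP: "P f" and e\<eta>: "\<eta> \<in> test_functions \<Omega>" for f t \<eta>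
  proof -
    obtain \<phi> where \<phi>: "\<phi> \<in> test_functions \<Omega>" "f = W (\<lambda>x. G x + tgrad \<phi> x)" using fP by (auto simp: P_def)
    note l = tgrad_linear[OF \<phi>(1) e\<eta>, of t]
    have "(\<lambda>x. f x + t *\<^sub>R W (tgrad \<eta>) x) = W (\<lambda>x. G x + tgrad (\<lambda>x. \<phi> x + t * \<eta> x) x)"
      unfolding l(2) \<phi>(2) by (auto simp: W_def algebra_simps)
    then show ?thesis using l(1) by (auto simp: P_def)
  qed
  have mid: "P (\<lambda>x. (1/2) *\<^sub>R (f x + g x))" if fP: "P f" and gP: "P g" for f g
  proof -
    obtain \<phi> where \<phi>: "\<phi> \<in> test_functions \<Omega>" "f = W (\<lambda>x. G x + tgrad \<phi> x)" using fP by (auto simp: P_def)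
    obtain \<eta> where \<eta>: "\<eta> \<in> test_functions \<Omega>" "g = W (\<lambda>x. G x + tgrad \<eta> x)" using gP by (auto simp: P_def)
    note l1 = tgrad_linear[OF \<eta>(1) \<phi>(1), of "-1"]
    \<comment> \<open>The midpoint is reached from \<open>f\<close> along half the difference of the
      two test functions, a case of the affine structure above.\<close>
    have "(\<lambda>x. (1/2) *\<^sub>R (f x + g x)) = (\<lambda>x. f x + (1/2) *\<^sub>R W (tgrad (\<lambda>x. \<eta> x + (-1) * \<phi> x)) x)"
    proof
      fix x
      have half: "(1/2) *\<^sub>R (X + Y) = X + (1/2) *\<^sub>R (Y - X)" for X Y :: 'a
        by (rule euclidean_eqI) (simp add: inner_add_left inner_diff_left field_simps)
      have "g x - f x = W (tgrad (\<lambda>x. \<eta> x + (-1) * \<phi> x)) x"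
        unfolding l1(2) \<phi>(2) \<eta>(2) W_def by (simp flip: scaleR_diff_right)
      then show "(1/2) *\<^sub>R (f x + g x) = f x + (1/2) *\<^sub>R W (tgrad (\<lambda>x. \<eta> x + (-1) * \<phi> x)) x"
        by (simp only: half)
    qed
    then show ?thesis using Pt[OF fP l1(1), of "1/2"] by simp
  qed
  have "P (W G)" unfolding P_def
    by (intro bexI[of _ "\<lambda>x. 0"]) (auto simp: tgrad_def zero_test_function)
  then have bd: "\<exists>f. P f \<and> nsq M f \<le> nsq M (W G)" by blast
  obtain f F where f: "\<And>k::nat. P (f k)" and F: "sqint M F" "(\<lambda>k. nsq M (\<lambda>x. f k x - F x)) \<longlonglongrightarrow> 0"
    "\<And>h. P h \<Longrightarrow> nsq M F \<le> nsq M h"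
  proof (rule midpoint_minimizer[of "\<lambda>k. P" M, OF _ Ps mid bd])
    fix f F assume a: "\<And>k::nat. P (f k)" "sqint M F" "(\<lambda>k. nsq M (\<lambda>x. f k x - F x)) \<longlonglongrightarrow> 0"
      "\<And>h. (\<And>k::nat. P h) \<Longrightarrow> nsq M F \<le> nsq M h"
    show thesis by (rule that[OF a(1-3)]) (rule a(4))
  qed
  obtain \<phi> where \<phi>: "\<And>k. \<phi> k \<in> test_functions \<Omega>" "\<And>k. f k = W (\<lambda>x. G x + tgrad (\<phi> k) x)"
    using f unfolding P_def by metis
  obtain \<Gamma>' where \<Gamma>': "sqint M \<Gamma>'" "\<And>x. x \<in> \<Omega> \<Longrightarrow> W \<Gamma>' x = F x" using W_scaled_inverse[OF F(1)] by metis
  \<comment> \<open>The candidate for the gradient of v = \<psi> - h: the unweighted limit field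
    minus the gradient of h.\<close>
  define \<Gamma> where "\<Gamma> x = \<Gamma>' x - G x" for x
  have \<Gamma>s: "sqint M \<Gamma>" unfolding \<Gamma>_def by (intro sqint_diff \<Gamma>' Gs)
  have conv\<Gamma>: "(\<lambda>k. nsq M (\<lambda>x. tgrad (\<phi> k) x - \<Gamma> x)) \<longlonglongrightarrow> 0"
  proof (rule Lim_null_comparison)
    have "norm (nsq M (\<lambda>x. tgrad (\<phi> k) x - \<Gamma> x)) \<le> (1/c) * nsq M (\<lambda>x. f k x - F x)" for k
    proof -
      have "c * nsq M (\<lambda>x. tgrad (\<phi> k) x - \<Gamma> x) \<le> nsq M (W (\<lambda>x. tgrad (\<phi> k) x - \<Gamma> x))"
        by (intro sqint_W sqint_diff ts \<phi> \<Gamma>s)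
      also have "\<dots> = nsq M (\<lambda>x. f k x - F x)"
      proof (intro Bochner_Integration.integral_cong refl)
        fix x assume "x \<in> space M"
        then have "F x = W \<Gamma>' x" using \<Gamma>'(2) by simp
        then have "W (\<lambda>x. tgrad (\<phi> k) x - \<Gamma> x) x = f k x - F x"
          by (simp add: \<phi>(2) W_def \<Gamma>_def algebra_simps)
        then show "(norm (W (\<lambda>x. tgrad (\<phi> k) x - \<Gamma> x) x))\<^sup>2 = (norm (f k x - F x))\<^sup>2" by simp
      qed
      finally show ?thesis using c by (simp add: field_simps)
    qed
    then show "\<forall>\<^sub>F k in sequentially. norm (nsq M (\<lambda>x. tgrad (\<phi> k) x - \<Gamma> x)) \<le> (1/c) * nsq M (\<lambda>x. f k x - F x)"
      by (intro always_eventually) blast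
    show "(\<lambda>k. (1/c) * nsq M (\<lambda>x. f k x - F x)) \<longlonglongrightarrow> 0" using tendsto_mult_right_zero[OF F(2), of "1/c"] .
  qed
  have cauchy: "\<exists>N. \<forall>m\<ge>N. \<forall>n\<ge>N. nsq M (\<lambda>x. \<phi> m x - \<phi> n x) \<le> e" if e: "e > 0" for e
  proof -
    have le: "nsq M (\<lambda>x. \<phi> m x - \<phi> n x) \<le> 4 * R\<^sup>2 * (2 * nsq M (\<lambda>x. tgrad (\<phi> m) x - \<Gamma> x) + 2 * nsq M (\<lambda>x. tgrad (\<phi> n) x - \<Gamma> x))" for m n
    proof -
      note l = tgrad_linear[OF \<phi>(1)[of m] \<phi>(1)[of n], of "-1"]
      have "nsq M (\<lambda>x. \<phi> m x - \<phi> n x) \<le> 4 * R\<^sup>2 * nsq M (\<lambda>x. tgrad (\<phi> m) x - tgrad (\<phi> n) x)"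
        using Poincare_test[OF \<Omega> l(1) b R] l(2) by simp
      also have "nsq M (\<lambda>x. tgrad (\<phi> m) x - tgrad (\<phi> n) x) \<le> 2 * nsq M (\<lambda>x. tgrad (\<phi> m) x - \<Gamma> x) + 2 * nsq M (\<lambda>x. tgrad (\<phi> n) x - \<Gamma> x)"
      proof -
        have q: "sqint M (\<lambda>x. tgrad (\<phi> k) x - \<Gamma> x)" for k by (intro sqint_diff ts \<phi> \<Gamma>s)
        have "nsq M (\<lambda>x. (tgrad (\<phi> m) x - \<Gamma> x) - (tgrad (\<phi> n) x - \<Gamma> x)) + nsq M (\<lambda>x. (tgrad (\<phi> m) x - \<Gamma> x) + (tgrad (\<phi> n) x - \<Gamma> x))
          = 2 * nsq M (\<lambda>x. tgrad (\<phi> m) x - \<Gamma> x) + 2 * nsq M (\<lambda>x. tgrad (\<phi> n) x - \<Gamma> x)"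
          unfolding nsq_diff[OF q q] sqint_add(2)[OF q q] by simp
        moreover have "nsq M (\<lambda>x. (tgrad (\<phi> m) x - \<Gamma> x) + (tgrad (\<phi> n) x - \<Gamma> x)) \<ge> 0" by (rule nsq_nonneg)
        moreover have "nsq M (\<lambda>x. (tgrad (\<phi> m) x - \<Gamma> x) - (tgrad (\<phi> n) x - \<Gamma> x)) = nsq M (\<lambda>x. tgrad (\<phi> m) x - tgrad (\<phi> n) x)"
          by simp
        ultimately show ?thesis by linarith
      qed
      finally show ?thesis by (simp add: mult_left_mono)
    qed
    \<comment> \<open>16 R^2 is the Poincare constant 4 R^2 times the total factor 2 + 2 of the two
      gradient errors; the summand 1 prevents a zero denominator.\<close>
    have e': "e / (16 * R\<^sup>2 + 1) > 0" using e by (intro divide_pos_pos) (auto intro: add_nonneg_pos)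
    obtain N where N: "\<And>n. n \<ge> N \<Longrightarrow> nsq M (\<lambda>x. tgrad (\<phi> n) x - \<Gamma> x) < e / (16 * R\<^sup>2 + 1)"
      using order_tendstoD(2)[OF conv\<Gamma> e'] by (auto simp: eventually_sequentially)
    have "nsq M (\<lambda>x. \<phi> m x - \<phi> n x) \<le> e" if "m \<ge> N" "n \<ge> N" for m n
    proof -
      have "4 * R\<^sup>2 * (2 * nsq M (\<lambda>x. tgrad (\<phi> m) x - \<Gamma> x) + 2 * nsq M (\<lambda>x. tgrad (\<phi> n) x - \<Gamma> x))
        \<le> 4 * R\<^sup>2 * (2 * (e / (16 * R\<^sup>2 + 1)) + 2 * (e / (16 * R\<^sup>2 + 1)))"
        using N[OF that(1)] N[OF that(2)] by (intro mult_left_mono add_mono) auto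
      also have "\<dots> = 16 * R\<^sup>2 * (e / (16 * R\<^sup>2 + 1))" by simp
      also have "\<dots> \<le> (16 * R\<^sup>2 + 1) * (e / (16 * R\<^sup>2 + 1))" using e' by (intro mult_right_mono) auto
      also have "\<dots> = e" by (simp add: add_nonneg_eq_0_iff)
      finally show ?thesis using le[of m n] by linarith
    qed
    then show ?thesis by blast
  qed
  have \<phi>s: "sqint M (\<phi> k)" for k by (rule test_functions_sqint[OF \<Omega> \<phi>(1)])
  obtain v where v: "sqint M v" "(\<lambda>n. nsq M (\<lambda>x. \<phi> n x - v x)) \<longlonglongrightarrow> 0"
    by (rule sqint_complete[of M \<phi>, OF \<phi>s cauchy])
  have v\<Gamma>: "has_wgrad \<Omega> v \<Gamma>"
    unfolding has_wgrad_def
  proof (intro conjI ballI v \<Gamma>s)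
    fix b' :: 'a assume b': "b' \<in> Basis"
    show "has_weak_pderiv \<Omega> b' v (\<lambda>x. \<Gamma> x \<bullet> b')"
    proof (rule has_weak_pderiv_L2_limit[OF \<Omega> b', of \<phi> "\<lambda>k x. tgrad (\<phi> k) x \<bullet> b'"])
      show "has_weak_pderiv \<Omega> b' (\<phi> n) (\<lambda>x. tgrad (\<phi> n) x \<bullet> b')" for n
        using has_wgrad_test[OF \<Omega> \<phi>(1)] b' by (simp add: has_wgrad_def)
      show "(\<lambda>n. nsq M (\<lambda>x. tgrad (\<phi> n) x \<bullet> b' - \<Gamma> x \<bullet> b')) \<longlonglongrightarrow> 0"
      proof (rule Lim_null_comparison[OF _ conv\<Gamma>], intro always_eventually allI)
        fix n
        have q: "sqint M (\<lambda>x. tgrad (\<phi> n) x - \<Gamma> x)" by (intro sqint_diff ts \<phi> \<Gamma>s)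
        have "nsq M (\<lambda>x. (tgrad (\<phi> n) x - \<Gamma> x) \<bullet> b') \<le> nsq M (\<lambda>x. tgrad (\<phi> n) x - \<Gamma> x)"
          unfolding nsq_components[OF q] using b' by (intro member_le_sum) auto
        then show "norm (nsq M (\<lambda>x. tgrad (\<phi> n) x \<bullet> b' - \<Gamma> x \<bullet> b')) \<le> nsq M (\<lambda>x. tgrad (\<phi> n) x - \<Gamma> x)"
          by (simp add: inner_diff_left abs_of_nonneg)
      qed
    qed (intro \<phi>s v sqint_component[OF _ b'] ts \<phi> \<Gamma>s)+
  qed
  have v0: "v \<in> H10 \<Omega>"
  proof (rule H10I[OF \<Omega> v\<Gamma>])
    fix e :: real assume "e > 0"
    have "(\<lambda>n. nsq M (\<lambda>x. \<phi> n x - v x) + nsq M (\<lambda>x. tgrad (\<phi> n) x - \<Gamma> x)) \<longlonglongrightarrow> 0"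
      using tendsto_add[OF v(2) conv\<Gamma>] by simp
    from order_tendstoD(2)[OF this \<open>e > 0\<close>] obtain n where "nsq M (\<lambda>x. \<phi> n x - v x) + nsq M (\<lambda>x. tgrad (\<phi> n) x - \<Gamma> x) < e"
      by (auto simp: eventually_sequentially)
    then show "\<exists>\<phi>\<in>test_functions \<Omega>. nsq M (\<lambda>x. v x - \<phi> x) + nsq M (\<lambda>x. \<Gamma> x - tgrad \<phi> x) < e"
      using \<phi>(1) by (intro bexI[of _ "\<phi> n"]) (auto simp: norm_minus_commute power2_commute[of "v x" for x])
  qed
  define \<psi> where "\<psi> p = h p + v p" for p
  have \<psi>g: "has_wgrad \<Omega> \<psi> (\<lambda>x. G x + \<Gamma> x)" unfolding \<psi>_def by (rule has_wgrad_add[OF \<Omega> h v\<Gamma>])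
  \<comment> \<open>First variation. The limit \<open>F\<close> need not be a competitor, so the
    variation is applied to the approximants \<open>f k\<close>; in the limit a nonnegative
    quadratic polynomial in t with constant term 0 remains, whose linear coefficient must
    vanish.\<close>
  have ortho_t: "(LINT x|M. W (tgrad \<eta>) x \<bullet> F x) = 0" if \<eta>: "\<eta> \<in> test_functions \<Omega>" for \<eta>
  proof -
    have Ws: "sqint M (W (tgrad \<eta>))" by (intro sqint_W ts \<eta>)
    have "0 \<le> 0 + 2 * t * (LINT x|M. F x \<bullet> W (tgrad \<eta>) x) + t\<^sup>2 * nsq M (W (tgrad \<eta>))" for t
    proof -
      have "nsq M F \<le> nsq M (f k) + 2 * t * (LINT x|M. f k x \<bullet> W (tgrad \<eta>) x) + t\<^sup>2 * nsq M (W (tgrad \<eta>))" for k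
        using F(3)[OF Pt[OF f \<eta>]] nsq_add_scaleR[OF Ps[OF f] Ws] by simp
      moreover have "(\<lambda>k. nsq M (f k) + 2 * t * (LINT x|M. f k x \<bullet> W (tgrad \<eta>) x) + t\<^sup>2 * nsq M (W (tgrad \<eta>)))
          \<longlonglongrightarrow> nsq M F + 2 * t * (LINT x|M. F x \<bullet> W (tgrad \<eta>) x) + t\<^sup>2 * nsq M (W (tgrad \<eta>))"
        by (intro tendsto_intros sqint_tendsto_nsq[OF Ps[OF f] F(1,2)] sqint_tendsto_inner[OF Ps[OF f] F(1) Ws F(2)])
      ultimately have "nsq M F \<le> nsq M F + 2 * t * (LINT x|M. F x \<bullet> W (tgrad \<eta>) x) + t\<^sup>2 * nsq M (W (tgrad \<eta>))"
        by (intro LIMSEQ_le_const) auto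
      then show ?thesis by simp
    qed
    then have "(LINT x|M. F x \<bullet> W (tgrad \<eta>) x)\<^sup>2 \<le> 0 * nsq M (W (tgrad \<eta>))" by (rule discriminant_bound)
    then show ?thesis by (simp add: inner_commute)
  qed
  have "harmonic h \<psi>" unfolding harmonic_def
  proof (intro conjI ballI)
    show "(\<lambda>p. \<psi> p - h p) \<in> H10 \<Omega>" using v0 by (simp add: \<psi>_def)
    fix \<theta> assume \<theta>: "\<theta> \<in> H10 \<Omega>"
    obtain T where T: "has_wgrad \<Omega> \<theta> T" using H10_wgrad[OF \<Omega> \<theta>] by metis
    have Tq: "sqint M T" using T by (simp add: has_wgrad_def)
    have "\<exists>\<eta>\<in>test_functions \<Omega>. nsq M (\<lambda>x. T x - tgrad \<eta> x) < 1 / (real n + 1)" for n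
    proof -
      have "1 / (real n + 1) > 0" by simp
      from H10_approx[OF \<Omega> \<theta> T this] show ?thesis by metis
    qed
    then obtain \<eta> where \<eta>: "\<And>n. \<eta> n \<in> test_functions \<Omega>" "\<And>n. nsq M (\<lambda>x. T x - tgrad (\<eta> n) x) < 1 / (real n + 1)" by metis
    have lim: "(\<lambda>n. nsq M (\<lambda>x. W (tgrad (\<eta> n)) x - W T x)) \<longlonglongrightarrow> 0"
    proof (rule Lim_null_comparison)
      have "norm (nsq M (\<lambda>x. W (tgrad (\<eta> n)) x - W T x)) \<le> \<bar>C\<bar> * (1 / (real n + 1))" for n
      proof -
        have "nsq M (W (\<lambda>x. tgrad (\<eta> n) x - T x)) \<le> C * nsq M (\<lambda>x. tgrad (\<eta> n) x - T x)"
          by (intro sqint_W sqint_diff ts \<eta> Tq)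
        also have "\<dots> \<le> \<bar>C\<bar> * nsq M (\<lambda>x. tgrad (\<eta> n) x - T x)" by (intro mult_right_mono) auto
        also have "\<dots> \<le> \<bar>C\<bar> * (1 / (real n + 1))" using \<eta>(2)[of n]
          by (intro mult_left_mono) (auto simp: norm_minus_commute)
        finally show ?thesis by (simp add: W_linear)
      qed
      then show "\<forall>\<^sub>F n in sequentially. norm (nsq M (\<lambda>x. W (tgrad (\<eta> n)) x - W T x)) \<le> \<bar>C\<bar> * (1 / (real n + 1))"
        by (intro always_eventually) blast
      show "(\<lambda>n. \<bar>C\<bar> * (1 / (real n + 1))) \<longlonglongrightarrow> 0"
        using tendsto_mult_right_zero[OF LIMSEQ_inverse_real_of_nat, of "\<bar>C\<bar>"] by (simp add: inverse_eq_divide add.commute)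
    qed
    \<comment> \<open>Orthogonality passes from test functions to H10 by density.\<close>
    have "(\<lambda>n. LINT x|M. W (tgrad (\<eta> n)) x \<bullet> F x) \<longlonglongrightarrow> (LINT x|M. W T x \<bullet> F x)"
      by (intro sqint_tendsto_inner[OF _ _ F(1) lim] sqint_W ts \<eta> Tq)
    then have z: "(LINT x|M. W T x \<bullet> F x) = 0" using ortho_t[OF \<eta>(1)] LIMSEQ_unique[of "\<lambda>n. 0::real"] by auto
    have "(LINT p|M. s p * (weak_grad \<Omega> \<psi> p \<bullet> weak_grad \<Omega> \<theta> p)) = (LINT x|M. W (\<lambda>x. G x + \<Gamma> x) x \<bullet> W T x)"
      by (rule weak_grad_integrals(1)[OF \<psi>g T])
    also have "\<dots> = (LINT x|M. W T x \<bullet> F x)"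
      using \<Gamma>'(2) by (intro Bochner_Integration.integral_cong) (auto simp: \<Gamma>_def inner_commute)
    finally show "(LINT p|M. s p * (weak_grad \<Omega> \<psi> p \<bullet> weak_grad \<Omega> \<theta> p)) = 0" using z by simp
  qed
  then show ?thesis by blast
qed

end

section \<open>Deflections\<close>

lemma smooth_step:
  assumes e: "e > 0"
  obtains \<Theta> \<rho> :: "real \<Rightarrow> real" where "\<And>k. Ck_on k \<Theta> UNIV" "\<And>t. (\<Theta> has_real_derivative \<rho> t) (at t)"
    "continuous_on UNIV \<rho>" "\<And>t. \<rho> t \<ge> 0" "\<And>t. t \<le> 0 \<Longrightarrow> \<Theta> t = 0 \<and> \<rho> t = 0" "\<And>t. t \<ge> e \<Longrightarrow> \<Theta> t = 1 \<and> \<rho> t = 0"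
    "\<And>t. 0 \<le> \<Theta> t" "\<And>t. \<Theta> t \<le> 1" "mono \<Theta>"
proof -
  define \<theta> where "\<theta> = box_bump 0 e"
  have Ck: "Ck_on k \<theta> UNIV" for k unfolding \<theta>_def by (rule Ck_on_box_bump)
  have c: "continuous_on S \<theta>" for S using Ck[of 0] by (auto intro: continuous_on_subset)
  have z: "\<theta> t = 0" if "t \<le> 0 \<or> t \<ge> e" for t
    unfolding \<theta>_def using that by (intro box_bump_bounds(4)) (auto simp: mem_box)
  have pos: "\<theta> t > 0" if "0 < t" "t < e" for t
    unfolding \<theta>_def using that by (intro box_bump_bounds(3)) (auto simp: mem_box)
  have nn: "\<theta> t \<ge> 0" for t unfolding \<theta>_def by (rule box_bump_bounds)
  \<comment> \<open>Starting at -1 instead of 0 makes 0 an interior point, so that the primitive is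
    differentiable on the whole line.\<close>
  define F where "F t = integral {-1..t} \<theta>" for t
  have F0: "F t = 0" if "t \<le> 0" for t
  proof -
    have "F t = integral {-1..t} (\<lambda>x. 0)" unfolding F_def using that z by (intro integral_cong) auto
    then show ?thesis by simp
  qed
  have dF: "(F has_real_derivative \<theta> t) (at t)" for t
  proof (cases "t < 0")
    case True
    have "((\<lambda>t. 0) has_real_derivative \<theta> t) (at t)" using z[of t] True by simp
    then show ?thesis
      by (rule has_field_derivative_transform_within_open[of _ _ _ "{..<0}"]) (use True F0 in auto)
  next
    case False
    have "((\<lambda>u. integral {-1..u} \<theta>) has_real_derivative \<theta> t) (at t within {-1..t+1})"
      by (rule integral_has_real_derivative[OF c]) (use False in auto)
    moreover have "at t within {-1..t+1} = at t" using False by (intro at_within_interior) auto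
    ultimately show ?thesis by (simp add: F_def[abs_def])
  qed
  have dFw: "(F has_real_derivative \<theta> t) (at t within T)" for t T
    by (rule has_field_derivative_at_within[OF dF])
  have mono: "F s \<le> F t" if "s \<le> t" for s t
    using DERIV_nonneg_imp_nondecreasing[OF that, of F] dF nn by blast
  define I where "I = F e"
  have "F 0 < F e"
  proof (rule DERIV_pos_imp_increasing_open[OF e])
    show "\<exists>y. (F has_real_derivative y) (at x) \<and> 0 < y" if "0 < x" "x < e" for x using dF pos[OF that] by blast
    show "continuous_on {0..e} F" by (rule DERIV_continuous_on[OF dFw])
  qed
  then have I: "I > 0" using F0[of 0] by (simp add: I_def)
  have Fe: "F t = I" if "t \<ge> e" for t
  proof -
    have "((\<lambda>x. \<theta> x) has_integral (F t - F e)) {e..t}"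
      by (rule fundamental_theorem_of_calculus[OF that dFw[unfolded has_real_derivative_iff_has_vector_derivative]])
    moreover have "((\<lambda>x. \<theta> x) has_integral 0) {e..t}"
      by (rule has_integral_is_0) (use z in auto)
    ultimately have "F t - F e = 0" by (rule has_integral_unique)
    then show ?thesis by (simp add: I_def)
  qed
  show ?thesis
  proof (rule that[of "\<lambda>t. F t / I" "\<lambda>t. \<theta> t / I"])
    show d: "((\<lambda>t. F t / I) has_real_derivative \<theta> t / I) (at t)" for t
      using dF[of t] by (rule DERIV_cdivide)
    show "continuous_on UNIV (\<lambda>t. \<theta> t / I)" using c I by (intro continuous_intros) auto
    show "\<theta> t / I \<ge> 0" for t using nn I by simp
    show "Ck_on k (\<lambda>t. F t / I) UNIV" for k
    proof (cases k)
      case 0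
      then show ?thesis using d by (auto intro!: DERIV_continuous_on)
    next
      case (Suc j)
      have "pd UNIV 1 (\<lambda>t. F t / I) = (\<lambda>t. \<theta> t * (1 / I))" by (intro ext pd_real_eqI) (use d in simp)
      moreover have "Ck_on j (\<lambda>t. \<theta> t * (1 / I)) UNIV" by (intro Ck_on_mult Ck Ck_on_const)
      moreover have "(\<lambda>t. F t / I) differentiable_on UNIV" using d
        unfolding differentiable_on_def by (meson has_field_derivative_imp_has_derivative differentiable_def)
      ultimately show ?thesis using Suc by simp
    qed
    show "t \<le> 0 \<Longrightarrow> F t / I = 0 \<and> \<theta> t / I = 0" for t using F0 z by simp
    show "t \<ge> e \<Longrightarrow> F t / I = 1 \<and> \<theta> t / I = 0" for t using Fe z I by simp
    show "0 \<le> F t / I" for t using I mono[of 0 t] F0[of t] F0[of 0] by (cases "t \<le> 0") auto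
    show "F t / I \<le> 1" for t using I mono[of t e] Fe[of t] by (cases "t \<le> e") (auto simp: I_def)
    show "mono (\<lambda>t. F t / I)" using mono I by (auto intro!: monoI divide_right_mono)
  qed
qed

text \<open>The kernel \<rho>(t - x) has integral one and lives on the interval from x to x + e, so
  the integral is an average of v to the right of x. The one-sided kernel needs room on one side
  only.\<close>

lemma mollified_value:
  fixes v \<rho> \<Theta> :: "real \<Rightarrow> real"
  assumes e: "e > 0" and \<Theta>: "\<And>t. (\<Theta> has_real_derivative \<rho> t) (at t)" "continuous_on UNIV \<rho>" "\<And>t. \<rho> t \<ge> 0"
    "\<And>t. t \<le> 0 \<Longrightarrow> \<Theta> t = 0 \<and> \<rho> t = 0" "\<And>t. t \<ge> e \<Longrightarrow> \<Theta> t = 1 \<and> \<rho> t = 0"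
    and S: "{x..x+e} \<subseteq> S" "S \<in> sets lebesgue" and v: "continuous_on {x..x+e} v"
    and \<eta>: "\<And>t. t \<in> {x..x+e} \<Longrightarrow> \<bar>v t - v x\<bar> \<le> \<eta>"
  shows "\<bar>(LINT t|lebesgue_on S. v t * \<rho> (t - x)) - v x\<bar> \<le> \<eta>" "integrable (lebesgue_on S) (\<lambda>t. v t * \<rho> (t - x))"
proof -
  have \<rho>c: "continuous_on T (\<lambda>t. \<rho> (t - x))" for T
    by (intro continuous_on_compose2[OF \<Theta>(2)] continuous_intros) auto
  have vc: "continuous_on {x..x+e} (\<lambda>t. v t * \<rho> (t - x))" using v \<rho>c by (intro continuous_intros)
  have eq: "(\<lambda>t. indicator S t * (v t * \<rho> (t - x))) = (\<lambda>t. indicator {x..x+e} t *\<^sub>R (v t * \<rho> (t - x)))"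
  proof
    fix t
    show "indicator S t * (v t * \<rho> (t - x)) = indicator {x..x+e} t *\<^sub>R (v t * \<rho> (t - x))"
      using S(1) \<Theta>(4)[of "t - x"] \<Theta>(5)[of "t - x"] by (cases "t \<in> {x..x+e}") (auto simp: indicator_def)
  qed
  have b: "integrable lborel (\<lambda>t. indicator {x..x+e} t *\<^sub>R (v t * \<rho> (t - x)))"
    by (intro borel_integrable_compact vc) auto
  then show "integrable (lebesgue_on S) (\<lambda>t. v t * \<rho> (t - x))"
    using S(2) by (simp only: lebesgue_on_integrable_iff(1) eq) (subst integrable_completion, auto)
  have "(LINT t|lebesgue_on S. v t * \<rho> (t - x)) = (LINT t|lborel. indicator {x..x+e} t *\<^sub>R (v t * \<rho> (t - x)))"
    using S(2) b by (simp only: lebesgue_on_integrable_iff(2) eq) (subst integral_completion, auto)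
  also have "\<dots> = integral {x..x+e} (\<lambda>t. v t * \<rho> (t - x))"
    using set_borel_integral_eq_integral(2)[of "{x..x+e}" "\<lambda>t. v t * \<rho> (t - x)"] b
    by (simp add: set_integrable_def set_lebesgue_integral_def)
  finally have 1: "(LINT t|lebesgue_on S. v t * \<rho> (t - x)) = integral {x..x+e} (\<lambda>t. v t * \<rho> (t - x))" .
  have d: "((\<lambda>t. \<Theta> (t - x)) has_real_derivative \<rho> (t - x)) (at t within T)" for t T
    using DERIV_shift[of "\<lambda>t. \<Theta> (t - x)" "\<rho> (t - x)" "t - x" x] \<Theta>(1)[of "t - x"]
    by (intro has_field_derivative_at_within[of _ _ _ T]) simp
  have "((\<lambda>t. \<rho> (t - x)) has_integral (\<Theta> (x + e - x) - \<Theta> (x - x))) {x..x+e}"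
    by (rule fundamental_theorem_of_calculus[OF _ d[unfolded has_real_derivative_iff_has_vector_derivative]])
      (use e in simp)
  then have 2: "((\<lambda>t. \<rho> (t - x)) has_integral 1) {x..x+e}" using \<Theta>(4)[of 0] \<Theta>(5)[of e] by simp
  have "((\<lambda>t. v t * \<rho> (t - x)) has_integral integral {x..x+e} (\<lambda>t. v t * \<rho> (t - x))) {x..x+e}"
    by (intro integrable_integral integrable_continuous_real vc)
  from has_integral_diff[OF this has_integral_mult_right[OF 2, of "v x"]]
  have 3: "((\<lambda>t. v t * \<rho> (t - x) - v x * \<rho> (t - x)) has_integral (integral {x..x+e} (\<lambda>t. v t * \<rho> (t - x)) - v x)) {x..x+e}" by simp
  have "norm (integral {x..x+e} (\<lambda>t. v t * \<rho> (t - x) - v x * \<rho> (t - x))) \<le> integral {x..x+e} (\<lambda>t. \<eta> * \<rho> (t - x))"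
  proof (rule integral_norm_bound_integral)
    show "(\<lambda>t. v t * \<rho> (t - x) - v x * \<rho> (t - x)) integrable_on {x..x+e}" using 3 by blast
    show "(\<lambda>t. \<eta> * \<rho> (t - x)) integrable_on {x..x+e}" using has_integral_mult_right[OF 2, of \<eta>] by blast
    show "norm (v t * \<rho> (t - x) - v x * \<rho> (t - x)) \<le> \<eta> * \<rho> (t - x)" if "t \<in> {x..x+e}" for t
      using mult_right_mono[OF \<eta>[OF that] \<Theta>(3)[of "t - x"]] \<Theta>(3)[of "t - x"]
      by (simp add: abs_mult flip: left_diff_distrib)
  qed
  then show "\<bar>(LINT t|lebesgue_on S. v t * \<rho> (t - x)) - v x\<bar> \<le> \<eta>"
    using integral_unique[OF 3] integral_unique[OF 2] by (simp add: 1)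
qed

text \<open>Tested with a smoothed indicator of the interval between x and y, the weak derivative
  identity has on one side approximately v x - v y, and on the other side an integral that
  Cauchy-Schwarz bounds by the norm of w times the root of the length.\<close>

lemma weak_Hoelder_open:
  assumes v: "continuous_on (D L) v" "has_weak_pderiv (D L) 1 v w" and w: "sqint (lebesgue_on (D L)) w"
    and xy: "x \<in> D L" "y \<in> D L" "x < y"
  shows "(v y - v x)\<^sup>2 \<le> (y - x) * nsq (lebesgue_on (D L)) w"
proof -
  let ?M = "lebesgue_on (D L)" let ?N = "nsq (lebesgue_on (D L)) w"
  have Do: "open (D L)" "D L \<in> sets lebesgue" by (auto simp: D_def)
  have step: "\<bar>v y - v x\<bar> \<le> sqrt ((y - x) * ?N) + \<epsilon>" if \<epsilon>: "\<epsilon> > 0" for \<epsilon>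
  proof -
    have cx: "isCont v x" "isCont v y" using v(1) xy Do(1) by (auto simp: continuous_on_eq_continuous_at)
    obtain d1 where d1: "d1 > 0" "\<And>t. \<bar>t - x\<bar> < d1 \<Longrightarrow> \<bar>v t - v x\<bar> < \<epsilon>/4"
      using cx(1) \<epsilon> unfolding continuous_at_eps_delta by (metis (no_types) dist_real_def divide_pos_pos zero_less_numeral)
    obtain d2 where d2: "d2 > 0" "\<And>t. \<bar>t - y\<bar> < d2 \<Longrightarrow> \<bar>v t - v y\<bar> < \<epsilon>/4"
      using cx(2) \<epsilon> unfolding continuous_at_eps_delta by (metis (no_types) dist_real_def divide_pos_pos zero_less_numeral)
    \<comment> \<open>The first two entries give an error of \<epsilon>/4 at each endpoint, the
      third keeps the support inside D, and the last makes the excess length e cost at most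
      \<epsilon>/2; its +1 covers w = 0.\<close>
    define e where "e = Min {d1/2, d2/2, (L - y)/2, (\<epsilon>/2)\<^sup>2 / (?N + 1)}"
    have N1: "?N + 1 > 0" using nsq_nonneg[of ?M w] by linarith
    have pos: "d1/2 > 0" "d2/2 > 0" "(L - y)/2 > 0" "(\<epsilon>/2)\<^sup>2 / (?N + 1) > 0" using d1 d2 \<epsilon> xy N1 by (auto simp: D_def)
    have le: "e \<le> d1/2" "e \<le> d2/2" "e \<le> (L - y)/2" "e \<le> (\<epsilon>/2)\<^sup>2 / (?N + 1)"
      unfolding e_def by (rule Min_le; simp)+
    have e: "e > 0" using pos by (auto simp: e_def)
    obtain \<Theta> \<rho> where \<Theta>: "\<And>k. Ck_on k \<Theta> UNIV" "\<And>t. (\<Theta> has_real_derivative \<rho> t) (at t)"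
      "continuous_on UNIV \<rho>" "\<And>t. \<rho> t \<ge> 0" "\<And>t. t \<le> 0 \<Longrightarrow> \<Theta> t = 0 \<and> \<rho> t = 0" "\<And>t. t \<ge> e \<Longrightarrow> \<Theta> t = 1 \<and> \<rho> t = 0"
      "\<And>t. 0 \<le> \<Theta> t" "\<And>t. \<Theta> t \<le> 1" "mono \<Theta>" using smooth_step[OF e] by metis
    define \<phi> where "\<phi> t = \<Theta> (t - x) - \<Theta> (t - y)" for t
    have yL: "y + e < L" "x > - L" using le(3) pos(3) xy by (auto simp: D_def)
    have \<phi>0: "\<phi> t = 0" if "t \<notin> {x..y+e}" for t
      using that \<Theta>(5)[of "t - x"] \<Theta>(5)[of "t - y"] \<Theta>(6)[of "t - x"] \<Theta>(6)[of "t - y"] xy(3) unfolding \<phi>_def by auto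
    have \<phi>: "\<phi> \<in> test_functions (D L)"
    proof (rule test_functionsI[of _ "{x..y+e}"])
      show "Ck_on k \<phi> UNIV" for k
        unfolding \<phi>_def[abs_def] using Ck_on_affine[OF \<Theta>(1)[of k], of "1::real" "-x"] Ck_on_affine[OF \<Theta>(1)[of k], of "1::real" "-y"]
        by (intro Ck_on_diff) simp_all
    qed (use \<phi>0 yL in \<open>auto simp: D_def\<close>)
    have \<phi>b: "\<bar>\<phi> t\<bar> \<le> 1" for t using \<Theta>(7,8)[of "t - x"] \<Theta>(7,8)[of "t - y"] unfolding \<phi>_def by linarith
    have d: "(\<phi> has_real_derivative (\<rho> (t - x) - \<rho> (t - y))) (at t)" for t
      using DERIV_shift[of "\<lambda>t. \<Theta> (t - x)" "\<rho> (t - x)" "t - x" x] \<Theta>(2)[of "t - x"]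
        DERIV_shift[of "\<lambda>t. \<Theta> (t - y)" "\<rho> (t - y)" "t - y" y] \<Theta>(2)[of "t - y"]
      unfolding \<phi>_def[abs_def] by (intro DERIV_diff) auto
    have pd\<phi>: "pd UNIV 1 \<phi> t = \<rho> (t - x) - \<rho> (t - y)" for t by (rule pd_real_eqI[OF d])
    have vc: "continuous_on {x..x+e} v" "continuous_on {y..y+e} v" "{x..x+e} \<subseteq> D L" "{y..y+e} \<subseteq> D L"
      using yL xy(3) by (auto intro!: continuous_on_subset[OF v(1)] simp: D_def)
    have close: "\<bar>v t - v x\<bar> \<le> \<epsilon>/4" if "t \<in> {x..x+e}" for t using d1(2)[of t] d1(1) le(1) that by force
    have close2: "\<bar>v t - v y\<bar> \<le> \<epsilon>/4" if "t \<in> {y..y+e}" for t using d2(2)[of t] d2(1) le(2) that by force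
    note m1 = mollified_value[OF e \<Theta>(2-6) vc(3) Do(2) vc(1) close]
    note m2 = mollified_value[OF e \<Theta>(2-6) vc(4) Do(2) vc(2) close2]
    have "(LINT t|?M. v t * \<rho> (t - x)) - (LINT t|?M. v t * \<rho> (t - y)) = (LINT t|?M. v t * pd UNIV 1 \<phi> t)"
      using m1(2) m2(2) by (simp add: pd\<phi> right_diff_distrib)
    also have "\<dots> = - (LINT t|?M. w t * \<phi> t)" using v(2) \<phi> by (simp add: has_weak_pderiv_def)
    finally have 1: "(LINT t|?M. v t * \<rho> (t - x)) - (LINT t|?M. v t * \<rho> (t - y)) = - (LINT t|?M. w t * \<phi> t)" .
    have \<phi>s: "sqint ?M \<phi>" by (rule test_functions_sqint[OF Do(1) \<phi>])
    have "(LINT t|?M. w t * \<phi> t)\<^sup>2 \<le> ?N * nsq ?M \<phi>" using integral_Cauchy_Schwarz[OF w \<phi>s] by simp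
    also have "\<dots> \<le> ?N * (y + e - x)"
    proof (rule mult_left_mono[OF _ nsq_nonneg])
      have "nsq ?M \<phi> = (LINT t|lebesgue. indicator (D L) t * (\<phi> t)\<^sup>2)" using Do(2) by (simp add: lebesgue_on_integrable_iff(2))
      also have "\<dots> \<le> (LINT t|lebesgue. indicator {x..y+e} t)"
      proof (rule integral_mono)
        show "integrable lebesgue (\<lambda>t. indicator (D L) t * (\<phi> t)\<^sup>2)" using \<phi>s Do(2) by (simp add: sqint_def lebesgue_on_integrable_iff(1))
        show "integrable lebesgue (indicat_real {x..y+e})" using e xy(3) by (intro integrable_real_indicator) auto
        show "indicator (D L) t * (\<phi> t)\<^sup>2 \<le> indicat_real {x..y+e} t" for t
          using \<phi>0[of t] \<phi>b[of t] by (auto simp: indicator_def abs_square_le_1)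
      qed
      also have "\<dots> = y + e - x" using e xy(3) by simp
      finally show "nsq ?M \<phi> \<le> y + e - x" .
    qed
    finally have "\<bar>LINT t|?M. w t * \<phi> t\<bar> \<le> sqrt (?N * (y + e - x))" by (simp add: real_le_rsqrt)
    also have "\<dots> \<le> sqrt ((y - x) * ?N) + sqrt (?N * e)"
    proof -
      have "0 \<le> (y - x) * ?N" "0 \<le> ?N * e" using xy(3) e by simp_all
      moreover have "?N * (y + e - x) = (y - x) * ?N + ?N * e" by (simp add: algebra_simps)
      ultimately show ?thesis using sqrt_add_le_add_sqrt by simp
    qed
    also have "sqrt (?N * e) \<le> \<epsilon>/2"
    proof (rule real_le_lsqrt)
      have "?N * e \<le> (?N + 1) * ((\<epsilon>/2)\<^sup>2 / (?N + 1))" using le(4) e N1 by (intro mult_mono) auto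
      then show "?N * e \<le> (\<epsilon>/2)\<^sup>2" using N1 by simp
    qed (use \<epsilon> e in auto)
    finally have "\<bar>LINT t|?M. w t * \<phi> t\<bar> \<le> sqrt ((y - x) * ?N) + \<epsilon>/2" by simp
    then show ?thesis using 1 m1(1) m2(1) by linarith
  qed
  have "\<bar>v y - v x\<bar> \<le> sqrt ((y - x) * ?N)" using step by (rule field_le_epsilon)
  then have "\<bar>v y - v x\<bar>\<^sup>2 \<le> (sqrt ((y - x) * ?N))\<^sup>2" by (rule power_mono) simp
  then show ?thesis using xy(3) by simp
qed

text \<open>The inequality is a closed condition on the pair (x, y), so it extends from the open
  square to its closure. The endpoints matter because the boundary conditions are imposed
  there.\<close>

lemma weak_Hoelder:
  assumes L: "L > 0" and v: "continuous_on {-L..L} v" "has_weak_pderiv (D L) 1 v w" and w: "sqint (lebesgue_on (D L)) w"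
    and xy: "x \<in> {-L..L}" "y \<in> {-L..L}"
  shows "(v y - v x)\<^sup>2 \<le> \<bar>y - x\<bar> * nsq (lebesgue_on (D L)) w"
proof -
  let ?S = "{-L<..<L} \<times> {-L<..<L}"
  let ?f = "\<lambda>(x, y). \<bar>y - x\<bar> * nsq (lebesgue_on (D L)) w - (v y - v x)\<^sup>2"
  have cD: "continuous_on (D L) v" by (rule continuous_on_subset[OF v(1)]) (auto simp: D_def)
  have open_le: "?f p \<ge> 0" if "p \<in> ?S" for p
  proof (cases p)
    case (Pair x y)
    consider "x < y" | "y < x" | "x = y" by linarith
    then show ?thesis
    proof cases
      case 1
      then show ?thesis using weak_Hoelder_open[OF cD v(2) w, of x y] that Pair by (auto simp: D_def)
    next
      case 2
      then show ?thesis using weak_Hoelder_open[OF cD v(2) w, of y x] that Pair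
        by (auto simp: D_def power2_commute)
    qed (use Pair in auto)
  qed
  have cl: "closure ?S = {-L..L} \<times> {-L..L}" using L by (simp add: closure_Times)
  have "?f (x, y) \<ge> 0"
  proof (rule continuous_ge_on_closure[of ?S ?f])
    have v1: "continuous_on ({-L..L} \<times> {-L..L}) (\<lambda>p. v (fst p))" "continuous_on ({-L..L} \<times> {-L..L}) (\<lambda>p. v (snd p))"
      by (rule continuous_on_compose2[OF v(1)]; auto intro!: continuous_intros)+
    then have "continuous_on ({-L..L} \<times> {-L..L}) (\<lambda>p. \<bar>snd p - fst p\<bar> * nsq (lebesgue_on (D L)) w - (v (snd p) - v (fst p))\<^sup>2)"
      by (intro continuous_intros)
    then show "continuous_on (closure ?S) ?f" unfolding cl by (simp add: case_prod_beta')
    show "(x, y) \<in> closure ?S" unfolding cl using xy by simp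
  qed (rule open_le)
  then show ?thesis by simp
qed

section \<open>Classical representatives of H^2 deflections\<close>

lemma D_basic: "open (D L)" "D L \<in> sets lebesgue" "D L \<in> lmeasurable" "D L \<subseteq> {-L..L}"
  "L \<ge> 0 \<Longrightarrow> measure lebesgue (D L) = 2 * L"
  by (auto simp: D_def)

lemma bounded_sqint:
  fixes f :: "'a::euclidean_space \<Rightarrow> 'b::euclidean_space"
  assumes "\<Omega> \<in> lmeasurable" "f \<in> borel_measurable (lebesgue_on \<Omega>)" "\<And>x. x \<in> \<Omega> \<Longrightarrow> (norm (f x))\<^sup>2 \<le> B"
  shows "sqint (lebesgue_on \<Omega>) f" "nsq (lebesgue_on \<Omega>) f \<le> B * measure lebesgue \<Omega>"
proof -
  interpret finite_measure "lebesgue_on \<Omega>" by (rule finite_measure_lebesgue_on[OF assms(1)])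
  have i: "integrable (lebesgue_on \<Omega>) (\<lambda>x. B)" by (rule integrable_const)
  show s: "sqint (lebesgue_on \<Omega>) f"
    by (rule sqint_bound[OF assms(2) i]) (use assms(3) in auto)
  have "nsq (lebesgue_on \<Omega>) f \<le> (LINT x|lebesgue_on \<Omega>. B)"
    using s i assms(3) by (intro integral_mono) (auto simp: sqint_def)
  also have "\<dots> = B * measure (lebesgue_on \<Omega>) \<Omega>" by simp
  also have "measure (lebesgue_on \<Omega>) \<Omega> = measure lebesgue \<Omega>"
    using assms(1) by (simp add: measure_restrict_space fmeasurableD)
  finally show "nsq (lebesgue_on \<Omega>) f \<le> B * measure lebesgue \<Omega>" .
qed

lemma continuous_interval_sqint:
  fixes f :: "real \<Rightarrow> real"
  assumes "continuous_on {-L..L} f"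
  shows "sqint (lebesgue_on (D L)) f"
proof -
  have "bounded (f ` {-L..L})" by (intro compact_imp_bounded compact_continuous_image assms compact_Icc)
  then obtain B where B: "\<And>x. x \<in> {-L..L} \<Longrightarrow> norm (f x) \<le> B" unfolding bounded_iff by blast
  show ?thesis
  proof (rule bounded_sqint(1)[OF D_basic(3)])
    show "f \<in> borel_measurable (lebesgue_on (D L))"
      by (rule continuous_imp_measurable_on_sets_lebesgue[OF continuous_on_subset[OF assms D_basic(4)] D_basic(2)])
    show "(norm (f x))\<^sup>2 \<le> B\<^sup>2" if "x \<in> D L" for x
      using B[of x] that D_basic(4)[of L] by (intro power_mono) auto
  qed
qed

lemma has_weak_pderiv_cong_AE:
  fixes g :: "'a::euclidean_space \<Rightarrow> real"
  assumes "open \<Omega>" "has_weak_pderiv \<Omega> b u g" "AE x in lebesgue_on \<Omega>. u x = u' x"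
    "u' \<in> borel_measurable (lebesgue_on \<Omega>)" "b \<in> Basis"
  shows "has_weak_pderiv \<Omega> b u' g"
  unfolding has_weak_pderiv_def
proof (intro conjI ballI)
  have l: "loc_integrable \<Omega> u" "loc_integrable \<Omega> g" using assms(2) by (auto simp: has_weak_pderiv_def)
  have e: "AE x in lebesgue_on \<Omega>. u' x = u x" using assms(3) by eventually_elim simp
  show l': "loc_integrable \<Omega> u'" by (rule loc_integrable_cong_AE[OF assms(1) e assms(4) l(1)])
  show "loc_integrable \<Omega> g" by (rule l)
  fix \<phi> assume \<phi>: "\<phi> \<in> test_functions \<Omega>"
  have m: "pd UNIV b \<phi> \<in> borel_measurable (lebesgue_on \<Omega>)"
    using test_functions_sqint(2)[OF assms(1) \<phi> assms(5)] by (simp add: sqint_def)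
  have mu: "u \<in> borel_measurable (lebesgue_on \<Omega>)" by (rule loc_integrable_measurable[OF assms(1) l(1)])
  have "(LINT x|lebesgue_on \<Omega>. u' x * pd UNIV b \<phi> x) = (LINT x|lebesgue_on \<Omega>. u x * pd UNIV b \<phi> x)"
    by (rule integral_cong_AE) (use m mu assms(4) e in \<open>auto elim: eventually_mono\<close>)
  then show "(LINT x|lebesgue_on \<Omega>. u' x * pd UNIV b \<phi> x) = - (LINT x|lebesgue_on \<Omega>. g x * \<phi> x)"
    using assms(2) \<phi> by (simp add: has_weak_pderiv_def)
qed

lemma pd_interval_eq:
  assumes "L > 0" "t \<in> {-L..L}" "(u has_real_derivative c) (at t within {-L..L})"
  shows "pd {-L..L} 1 u t = c"
proof -
  have d: "(u has_derivative (*) c) (at t within cbox (-L) L)" using assms(3) by (simp add: has_field_derivative_def)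
  then have "(u has_derivative frechet_derivative u (at t within cbox (-L) L)) (at t within cbox (-L) L)"
    using frechet_derivative_works by (auto simp: differentiable_def)
  from frechet_derivative_unique_within_closed_interval[OF _ _ this d] assms(1,2)
  have "frechet_derivative u (at t within cbox (-L) L) = (*) c" by auto
  then show ?thesis by (simp add: pd_def)
qed

lemma pd_interval_deriv:
  assumes "u differentiable_on {-L..L}" "t \<in> {-L..L}"
  shows "(u has_real_derivative pd {-L..L} 1 u t) (at t within {-L..L})"
proof -
  have d: "(u has_derivative frechet_derivative u (at t within {-L..L})) (at t within {-L..L})"
    using assms by (auto simp: differentiable_on_def frechet_derivative_works[symmetric])
  have "frechet_derivative u (at t within {-L..L}) h = pd {-L..L} 1 u t * h" for h
    using linear_scale[OF has_derivative_linear[OF d], of h 1] by (simp add: pd_def)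
  then have "frechet_derivative u (at t within {-L..L}) = (*) (pd {-L..L} 1 u t)" by auto
  with d show ?thesis by (simp add: has_field_derivative_def)
qed

text \<open>Explicit representatives v of the first and w of the second derivative replace the chosen weak
  derivatives in the energy.\<close>

definition defl :: "real \<Rightarrow> real \<Rightarrow> (real \<Rightarrow> real) \<Rightarrow> (real \<Rightarrow> real) \<Rightarrow> (real \<Rightarrow> real) \<Rightarrow> bool" where
  "defl H L u v w \<longleftrightarrow> continuous_on {-L..L} v \<and>
     (\<forall>t\<in>{-L..L}. (u has_real_derivative v t) (at t within {-L..L})) \<and>
     u (-L) = 0 \<and> u L = 0 \<and> v (-L) = 0 \<and> v L = 0 \<and> (\<forall>x\<in>D L. u x \<ge> -H) \<and>
     sqint (lebesgue_on (D L)) w \<and> has_weak_pderiv (D L) 1 v w"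

lemma deflD:
  assumes "defl H L u v w"
  shows "continuous_on {-L..L} v" "\<And>t. t \<in> {-L..L} \<Longrightarrow> (u has_real_derivative v t) (at t within {-L..L})"
    "u (-L) = 0" "u L = 0" "v (-L) = 0" "v L = 0" "\<And>x. x \<in> D L \<Longrightarrow> u x \<ge> -H"
    "sqint (lebesgue_on (D L)) w" "has_weak_pderiv (D L) 1 v w" "continuous_on {-L..L} u"
    "sqint (lebesgue_on (D L)) u" "sqint (lebesgue_on (D L)) v"
proof -
  show "continuous_on {-L..L} v" "\<And>t. t \<in> {-L..L} \<Longrightarrow> (u has_real_derivative v t) (at t within {-L..L})"
    "u (-L) = 0" "u L = 0" "v (-L) = 0" "v L = 0" "\<And>x. x \<in> D L \<Longrightarrow> u x \<ge> -H"
    "sqint (lebesgue_on (D L)) w" "has_weak_pderiv (D L) 1 v w" using assms by (auto simp: defl_def)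
  then show u: "continuous_on {-L..L} u" by (intro DERIV_continuous_on) auto
  show "sqint (lebesgue_on (D L)) u" by (rule continuous_interval_sqint[OF u])
  show "sqint (lebesgue_on (D L)) v" using assms by (auto simp: defl_def intro: continuous_interval_sqint)
qed

lemma C1_has_weak_pderiv:
  assumes v: "continuous_on {-L..L} v" and d: "\<And>t. t \<in> {-L..L} \<Longrightarrow> (u has_real_derivative v t) (at t within {-L..L})"
  shows "has_weak_pderiv (D L) 1 u v"
proof -
  have u: "continuous_on {-L..L} u" by (intro DERIV_continuous_on[OF d])
  have b: "\<exists>B. \<forall>x\<in>{-L..L}. \<bar>f x\<bar> \<le> B" if "continuous_on {-L..L} f" for f :: "real \<Rightarrow> real"
  proof -
    have "bounded (f ` {-L..L})" by (intro compact_imp_bounded compact_continuous_image that compact_Icc)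
    then show ?thesis by (auto simp: bounded_iff)
  qed
  obtain Bu where Bu: "\<And>x. x \<in> {-L..L} \<Longrightarrow> \<bar>u x\<bar> \<le> Bu" using b[OF u] by metis
  obtain Bv where Bv: "\<And>x. x \<in> {-L..L} \<Longrightarrow> \<bar>v x\<bar> \<le> Bv" using b[OF v] by metis
  show ?thesis
  proof (rule has_weak_pderivI_lines[OF D_basic(1), where B="max Bu Bv" and N="{}"])
    show "continuous_on (D L) u" by (rule continuous_on_subset[OF u D_basic(4)])
    show "loc_integrable (D L) u" "loc_integrable (D L) v"
      using u v by (auto intro!: sqint_loc_integrable[OF D_basic(1)] continuous_interval_sqint)
    fix p assume "p \<in> D L - {}"
    then have p: "p \<in> D L" "p \<in> {-L..L}" using D_basic(4)[of L] by auto
    have "at p within {-L..L} = at p" using p(1) by (intro at_within_interior) (auto simp: D_def)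
    then have "(u has_real_derivative v p) (at (0 + p))" using d[OF p(2)] by simp
    then have "((\<lambda>x. u (x + p)) has_real_derivative v p) (at 0)" by (simp only: DERIV_shift)
    then show "((\<lambda>t. u (p + t *\<^sub>R 1)) has_real_derivative v p) (at 0)" by (simp add: add.commute)
  qed (use Bu Bv D_basic(4)[of L] in \<open>force simp: le_max_iff_disj\<close>)+
qed

text \<open>Membership in H^2 provides some weak derivative of u that is weakly differentiable. By
  uniqueness it agrees almost everywhere with the classical derivative v, which therefore has the
  same weak derivative w.\<close>

lemma S0bar_iff:
  assumes L: "L > 0"
  shows "u \<in> S0bar H L \<longleftrightarrow> (\<exists>v w. defl H L u v w)"
proof
  assume u: "u \<in> S0bar H L"
  define v where "v = pd {-L..L} 1 u"
  have v: "continuous_on {-L..L} v" and ud: "u differentiable_on {-L..L}" using u by (auto simp: S0bar_def v_def)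
  have d: "(u has_real_derivative v t) (at t within {-L..L})" if "t \<in> {-L..L}" for t
    unfolding v_def by (rule pd_interval_deriv[OF ud that])
  have wv: "has_weak_pderiv (D L) 1 u v" by (rule C1_has_weak_pderiv[OF v d])
  have "u \<in> Hk (Suc 1) (D L)" using u by (simp add: S0bar_def numeral_2_eq_2)
  moreover have "(1::real) \<in> Basis" by simp
  ultimately obtain g where g: "g \<in> Hk 1 (D L)" "has_weak_pderiv (D L) 1 u g" unfolding Hk.simps(2) by blast
  then obtain w where w: "sqint (lebesgue_on (D L)) w" "has_weak_pderiv (D L) 1 g w"
    by (auto simp: L2_iff_sqint Bex_def)
  have "has_weak_pderiv (D L) 1 v w"
  proof (rule has_weak_pderiv_cong_AE[OF D_basic(1) w(2)])
    show "AE x in lebesgue_on (D L). g x = v x" by (rule has_weak_pderiv_unique[OF D_basic(1) g(2) wv])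
    show "v \<in> borel_measurable (lebesgue_on (D L))" using continuous_interval_sqint[OF v] by (simp add: sqint_def)
  qed simp
  then have "defl H L u v w" unfolding defl_def using u v d w by (auto simp: S0bar_def v_def[symmetric])
  then show "\<exists>v w. defl H L u v w" by blast
next
  assume "\<exists>v w. defl H L u v w"
  then obtain v w where dv: "defl H L u v w" by blast
  note a = deflD[OF dv]
  have pv: "pd {-L..L} 1 u t = v t" if "t \<in> {-L..L}" for t by (rule pd_interval_eq[OF L that a(2)[OF that]])
  have 1: "v \<in> Hk 1 (D L)" using a(8,9,12) by (auto simp: L2_iff_sqint Bex_def)
  have "has_weak_pderiv (D L) 1 u v" by (rule C1_has_weak_pderiv[OF a(1,2)])
  then have "u \<in> Hk (Suc 1) (D L)" using 1 a(11) by (subst Hk.simps) (auto simp: L2_iff_sqint simp del: Hk.simps)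
  then have "u \<in> Hk 2 (D L)" by (simp add: numeral_2_eq_2)
  moreover have "Ck_on 1 u {-L..L}"
  proof -
    have "u differentiable_on {-L..L}"
      unfolding differentiable_on_def using a(2) by (meson differentiable_def has_field_derivative_imp_has_derivative)
    moreover have "continuous_on {-L..L} (pd {-L..L} 1 u)" by (rule continuous_on_eq[OF a(1)]) (use pv in auto)
    ultimately show ?thesis by simp
  qed
  ultimately show "u \<in> S0bar H L" unfolding S0bar_def using a(3-7) pv L by auto
qed

lemma E_m_eq:
  assumes "defl H L u v w"
  shows "E_m L \<beta> \<tau> a u = \<beta> / 2 * nsq (lebesgue_on (D L)) w
     + (\<tau> / 2 + a / 4 * nsq (lebesgue_on (D L)) v) * nsq (lebesgue_on (D L)) v"
proof -
  let ?M = "lebesgue_on (D L)"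
  note a = deflD[OF assms]
  have uv: "has_weak_pderiv (D L) 1 u v" by (rule C1_has_weak_pderiv[OF a(1,2)])
  note m1 = weak_pd_measurable[OF D_basic(1) uv] and p1 = weak_pd[OF D_basic(1) uv]
  have n1: "nsq ?M (weak_pd (D L) 1 u) = nsq ?M v" by (rule sqint_cong_AE(2)[OF m1 a(12) p1(2)])
  have "AE x in ?M. v x = weak_pd (D L) 1 u x" using p1(2) by eventually_elim simp
  then have w: "has_weak_pderiv (D L) 1 (weak_pd (D L) 1 u) w"
    by (rule has_weak_pderiv_cong_AE[OF D_basic(1) a(9) _ m1]) simp
  have n2: "nsq ?M (weak_pd (D L) 1 (weak_pd (D L) 1 u)) = nsq ?M w"
    by (rule sqint_cong_AE(2)[OF weak_pd_measurable[OF D_basic(1) w] a(8) weak_pd(2)[OF D_basic(1) w]])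
  show ?thesis unfolding E_m_def L2_norm_sq n1 n2 ..
qed

text \<open>A function that vanishes at -L has square at most 2L times the squared norm of its
  derivative by the Hoelder estimate; integrating over the interval of length 2L yields the constant
  4L^2 that appears in \<open>frak_K\<close>. The argument is applied once to v and once to
  u.\<close>

lemma defl_bounds:
  assumes L: "L > 0" and dv: "defl H L u v w"
  defines "M \<equiv> lebesgue_on (D L)"
  shows "\<And>x y. x \<in> {-L..L} \<Longrightarrow> y \<in> {-L..L} \<Longrightarrow> (v y - v x)\<^sup>2 \<le> \<bar>y - x\<bar> * nsq M w"
    "\<And>x. x \<in> {-L..L} \<Longrightarrow> (v x)\<^sup>2 \<le> 2 * L * nsq M w" "nsq M v \<le> 4 * L\<^sup>2 * nsq M w"
    "\<And>x. x \<in> {-L..L} \<Longrightarrow> (u x)\<^sup>2 \<le> 2 * L * nsq M v" "nsq M u \<le> 4 * L\<^sup>2 * nsq M v"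
proof -
  note a = deflD[OF dv]
  have uv: "has_weak_pderiv (D L) 1 u v" by (rule C1_has_weak_pderiv[OF a(1,2)])
  have gen: "(\<forall>x\<in>{-L..L}. (f x)\<^sup>2 \<le> 2 * L * nsq M g) \<and> nsq M f \<le> 4 * L\<^sup>2 * nsq M g"
    if f: "continuous_on {-L..L} f" "f (-L) = 0" and g: "has_weak_pderiv (D L) 1 f g" "sqint M g" for f g :: "real \<Rightarrow> real"
  proof -
    have pt: "(f x)\<^sup>2 \<le> 2 * L * nsq M g" if x: "x \<in> {-L..L}" for x
    proof -
      have "(f x - f (-L))\<^sup>2 \<le> \<bar>x - (-L)\<bar> * nsq M g"
        using weak_Hoelder[OF L f(1) g(1) g(2)[unfolded M_def], of "-L" x] x L by (simp add: M_def)
      also have "\<dots> \<le> 2 * L * nsq M g" using x by (intro mult_right_mono nsq_nonneg) auto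
      finally show ?thesis using f(2) by simp
    qed
    have "nsq M f \<le> (2 * L * nsq M g) * measure lebesgue (D L)"
      unfolding M_def
    proof (rule bounded_sqint(2)[OF D_basic(3)])
      show "f \<in> borel_measurable (lebesgue_on (D L))" using continuous_interval_sqint[OF f(1)] by (simp add: sqint_def)
      show "(norm (f x))\<^sup>2 \<le> 2 * L * nsq (lebesgue_on (D L)) g" if "x \<in> D L" for x
        using pt[of x] that D_basic(4)[of L] by (auto simp: M_def)
    qed
    then show ?thesis using pt L by (simp add: D_basic(5) power2_eq_square mult_ac)
  qed
  show "(v y - v x)\<^sup>2 \<le> \<bar>y - x\<bar> * nsq M w" if "x \<in> {-L..L}" "y \<in> {-L..L}" for x y
    unfolding M_def by (rule weak_Hoelder[OF L a(1,9,8) that])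
  note gv = gen[OF a(1,5,9) a(8)[folded M_def]] and gu = gen[OF a(10,3) uv a(12)[folded M_def]]
  show "x \<in> {-L..L} \<Longrightarrow> (v x)\<^sup>2 \<le> 2 * L * nsq M w" for x using gv by blast
  show "nsq M v \<le> 4 * L\<^sup>2 * nsq M w" using gv by blast
  show "x \<in> {-L..L} \<Longrightarrow> (u x)\<^sup>2 \<le> 2 * L * nsq M v" for x using gu by blast
  show "nsq M u \<le> 4 * L\<^sup>2 * nsq M v" using gu by blast
qed

lemma zero_weak_pderiv:
  "has_weak_pderiv (D L) 1 (\<lambda>x. 0) (\<lambda>x. 0)" "sqint (lebesgue_on (D L)) (\<lambda>x. 0::real)"
proof -
  have t: "(\<lambda>x::real. 0) \<in> test_functions (D L)" by (rule zero_test_function)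
  have "pd UNIV 1 (\<lambda>x::real. 0) = (\<lambda>x. 0)" by (intro ext zero_test_function(2))
  then show "has_weak_pderiv (D L) 1 (\<lambda>x. 0) (\<lambda>x. 0)"
    using has_weak_pderiv_test_function[OF D_basic(1) _ t, of 1] by simp
  show "sqint (lebesgue_on (D L)) (\<lambda>x. 0::real)" by (rule test_functions_sqint(1)[OF D_basic(1) t])
qed

text \<open>Convexity of the admissible set, including the obstacle condition. It is what allows the
  parallelogram argument to act on second derivatives while u and v are carried along.\<close>

lemma defl_midpoint:
  assumes "defl H L u v w" "defl H L u' v' w'"
  shows "defl H L (\<lambda>x. (u x + u' x) / 2) (\<lambda>x. (v x + v' x) / 2) (\<lambda>x. (1/2) *\<^sub>R (w x + w' x))"
proof -
  note a = deflD[OF assms(1)] and a' = deflD[OF assms(2)]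
  have 1: "has_weak_pderiv (D L) 1 (\<lambda>x. v x + 1 * v' x) (\<lambda>x. w x + 1 * w' x)"
    using a a' by (intro has_weak_pderiv_linear[OF D_basic(1)]) auto
  have s: "sqint (lebesgue_on (D L)) (\<lambda>x. v x + v' x)" "sqint (lebesgue_on (D L)) (\<lambda>x. w x + w' x)"
    using a a' by (auto intro: sqint_add)
  note z = zero_weak_pderiv[of L]
  \<comment> \<open>Linearity is available in the form u + c v, so the scaling is written as an
    addition to zero.\<close>
  have "has_weak_pderiv (D L) 1 (\<lambda>x. 0 + (1/2) * (v x + 1 * v' x)) (\<lambda>x. 0 + (1/2) * (w x + 1 * w' x))"
    by (rule has_weak_pderiv_linear[OF D_basic(1) _ z(1) 1 z(2) _ z(2)]) (use s in auto)
  then have w: "has_weak_pderiv (D L) 1 (\<lambda>x. (v x + v' x) / 2) (\<lambda>x. (1/2) *\<^sub>R (w x + w' x))" by simp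
  have ge: "(u x + u' x) / 2 \<ge> - H" if "x \<in> D L" for x using a(7)[OF that] a'(7)[OF that] by simp
  have c: "continuous_on {-L..L} (\<lambda>x. (v x + v' x) / 2)" using a(1) a'(1) by (intro continuous_intros) auto
  have d: "((\<lambda>x. (u x + u' x) / 2) has_real_derivative (v t + v' t) / 2) (at t within {-L..L})" if "t \<in> {-L..L}" for t
    by (intro DERIV_cdivide DERIV_add a(2) a'(2) that)
  show ?thesis unfolding defl_def using w ge c d a(3-6) a'(3-6) sqint_scaleR[OF s(2), of "1/2"] by auto
qed

section \<open>The electrostatic energy\<close>

text \<open>The third argument of the boundary data is u x, which may equal -H and thus lie on the
  boundary of the domain S, where only the derivative within S exists. The chain rule is therefore
  applied along a curve that stays in S near the parameter 0.\<close>

lemma curve_derivative: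
  fixes h :: "real \<times> real \<times> real \<Rightarrow> real"
  assumes h: "h differentiable_on S" and T: "open T" "0 \<in> T" "\<And>t. t \<in> T \<Longrightarrow> \<gamma> t \<in> S"
    and \<gamma>: "(\<gamma> has_derivative (\<lambda>t. t *\<^sub>R (a, b, c))) (at 0)"
  shows "((\<lambda>t. h (\<gamma> t)) has_real_derivative (a * d_x S h (\<gamma> 0) + b * d_z S h (\<gamma> 0) + c * d_w S h (\<gamma> 0))) (at 0)"
proof -
  define h' where "h' p = frechet_derivative h (at p within S)" for p
  have hd: "(h has_derivative h' p) (at p within S)" if "p \<in> S" for p
    using h that unfolding h'_def by (auto simp: differentiable_on_def frechet_derivative_works[symmetric])
  have "((\<lambda>t. h (\<gamma> t)) has_derivative (\<lambda>y. h' (\<gamma> 0) (y *\<^sub>R (a, b, c)))) (at 0 within T)"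
  proof (rule has_derivative_in_compose2[of S h h', OF hd])
    show "\<gamma> ` T \<subseteq> S" using T(3) by (rule image_subsetI)
    show "(\<gamma> has_derivative (\<lambda>t. t *\<^sub>R (a, b, c))) (at 0 within T)" using \<gamma> by (rule has_derivative_at_withinI)
  qed (assumption, rule T(2))
  then have 1: "((\<lambda>t. h (\<gamma> t)) has_derivative (\<lambda>y. h' (\<gamma> 0) (y *\<^sub>R (a, b, c)))) (at 0)"
    unfolding at_within_open[OF T(2,1)] .
  have lin: "linear (h' (\<gamma> 0))" using hd[OF T(3)[OF T(2)]] by (rule has_derivative_linear)
  have "h' (\<gamma> 0) (y *\<^sub>R (a, b, c)) = (a * d_x S h (\<gamma> 0) + b * d_z S h (\<gamma> 0) + c * d_w S h (\<gamma> 0)) * y" for y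
  proof -
    have "y *\<^sub>R (a, b, c) = (y * a) *\<^sub>R (1, 0, 0) + ((y * b) *\<^sub>R (0, 1, 0) + (y * c) *\<^sub>R (0, 0, 1))" by simp
    then show ?thesis unfolding pd_def h'_def[symmetric]
      by (simp only: linear_add[OF lin] linear_scale[OF lin]) (simp add: algebra_simps)
  qed
  with 1 show ?thesis by (simp add: has_field_derivative_def)
qed

lemma measurable_lebesgue_on_Un:
  fixes f :: "'a::euclidean_space \<Rightarrow> 'b::topological_space"
  assumes "A \<in> sets lebesgue" "B \<in> sets lebesgue" "f \<in> borel_measurable (lebesgue_on A)" "f \<in> borel_measurable (lebesgue_on B)"
  shows "f \<in> borel_measurable (lebesgue_on (A \<union> B))"
proof (rule measurableI)
  fix X :: "'b set" assume X: "X \<in> sets borel"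
  have "f -` X \<inter> A \<in> sets lebesgue"
    using measurable_sets[OF assms(3) X] unfolding space_lebesgue_on
    by (subst (asm) sets_restrict_space_iff) (use assms(1) in auto)
  moreover have "f -` X \<inter> B \<in> sets lebesgue"
    using measurable_sets[OF assms(4) X] unfolding space_lebesgue_on
    by (subst (asm) sets_restrict_space_iff) (use assms(2) in auto)
  ultimately have "(f -` X \<inter> A) \<union> (f -` X \<inter> B) \<in> sets lebesgue" by (rule sets.Un)
  moreover have "(f -` X \<inter> A) \<union> (f -` X \<inter> B) = f -` X \<inter> (A \<union> B)" by auto
  ultimately show "f -` X \<inter> space (lebesgue_on (A \<union> B)) \<in> sets (lebesgue_on (A \<union> B))"
    unfolding space_lebesgue_on
    by (subst sets_restrict_space_iff) (use sets.Un[OF assms(1,2)] in auto)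
qed simp

lemma Omega_open:
  assumes "continuous_on (D L) u"
  shows "open (Omega H L d u)"
proof -
  have c: "continuous_on (D L \<times> UNIV) (\<lambda>p. u (fst p) - snd p)"
    by (intro continuous_intros continuous_on_compose2[OF assms]) auto
  have o: "open (D L \<times> (UNIV::real set))" by (intro open_Times D_basic open_UNIV)
  have o1: "open ((\<lambda>p. u (fst p) - snd p) -` {0<..} \<inter> (D L \<times> UNIV))"
    by (rule continuous_on_open_vimage[OF o, THEN iffD1, OF c, rule_format, OF open_greaterThan])
  have "open (snd -` {-H-d<..} :: (real \<times> real) set)" by (intro open_vimage_snd open_greaterThan)
  with o1 have "open (((\<lambda>p. u (fst p) - snd p) -` {0<..} \<inter> (D L \<times> UNIV)) \<inter> snd -` {-H-d<..})" by (rule open_Int)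
  moreover have "((\<lambda>p. u (fst p) - snd p) -` {0<..} \<inter> (D L \<times> UNIV)) \<inter> snd -` {-H-d<..} = Omega H L d u"
    by (auto simp: Omega_def)
  ultimately show ?thesis by simp
qed

lemma open_snd_cmp: "open {p::real \<times> real. snd p > c}" "open {p::real \<times> real. snd p < c}"
  by (auto intro!: open_Collect_less continuous_intros)

lemma negligible_snd: "negligible {p::real \<times> real. snd p = c}"
proof -
  have "negligible {p::real \<times> real. p \<bullet> (0, 1) = c}" by (rule negligible_standard_hyperplane) (simp add: Basis_prod_def)
  then show ?thesis by (simp add: inner_prod_def)
qed

locale mems =
  fixes H L d \<sigma>\<^sub>2 :: real and \<sigma>\<^sub>1 :: "real \<times> real \<Rightarrow> real" and h\<^sub>1 h\<^sub>2 :: "real \<times> real \<times> real \<Rightarrow> real"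
  assumes H: "H > 0" and L: "L > 0" and d: "d > 0"
    and adm: "admissible_sigma H L d \<sigma>\<^sub>1 \<sigma>\<^sub>2" and A1: "A1 H L d \<sigma>\<^sub>1 \<sigma>\<^sub>2 h\<^sub>1 h\<^sub>2"
begin

abbreviation "S1 \<equiv> dom_h1 H L d"
abbreviation "S2 \<equiv> dom_h2 H L"
abbreviation "Om \<equiv> Omega H L d"
abbreviation "sig \<equiv> sigma H L d \<sigma>\<^sub>1 \<sigma>\<^sub>2"
abbreviation "smax \<equiv> sigma_max H L d \<sigma>\<^sub>1 \<sigma>\<^sub>2"

text \<open>The chain rule gradient with v in the role of the derivative of u. Being an explicit
  pointwise expression in u and v, it can be followed through limits, unlike a gradient defined up
  to null sets.\<close>

definition gradh :: "(real \<Rightarrow> real) \<Rightarrow> (real \<Rightarrow> real) \<Rightarrow> real \<times> real \<Rightarrow> real \<times> real" where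
  "gradh u v = (\<lambda>(x, z). if z \<le> -H
     then (d_x S1 h\<^sub>1 (x, z, u x) + v x * d_w S1 h\<^sub>1 (x, z, u x), d_z S1 h\<^sub>1 (x, z, u x))
     else (d_x S2 h\<^sub>2 (x, z, u x) + v x * d_w S2 h\<^sub>2 (x, z, u x), d_z S2 h\<^sub>2 (x, z, u x)))"

section \<open>The boundary data along a deflection: bounds, continuity, weak gradient\<close>

lemma C2_facts:
  fixes h :: "real \<times> real \<times> real \<Rightarrow> real"
  assumes "Ck_on 2 h S"
  shows "h differentiable_on S" "continuous_on S h" "continuous_on S (d_x S h)" "continuous_on S (d_z S h)" "continuous_on S (d_w S h)"
proof -
  have c: "Ck_on (Suc (Suc 0)) h S" using assms by (simp only: numeral_2_eq_2)
  then show "h differentiable_on S" by simp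
  then show "continuous_on S h" by (rule differentiable_imp_continuous_on)
  have pc: "continuous_on S (pd S b h)" if "b \<in> Basis" for b
  proof -
    have "Ck_on (Suc 0) (pd S b h) S" using c that by auto
    from Ck_on_SucD[OF this] show ?thesis by simp
  qed
  show "continuous_on S (d_x S h)" "continuous_on S (d_z S h)" "continuous_on S (d_w S h)"
    by (rule pc; simp add: Basis_prod_def zero_prod_def)+
qed

lemmas h1 = C2_facts[of h\<^sub>1 S1] and h2 = C2_facts[of h\<^sub>2 S2]

lemma C2: "Ck_on 2 h\<^sub>1 S1" "Ck_on 2 h\<^sub>2 S2" using A1 by (auto simp: A1_def)

lemma Om_mem: "(x, z) \<in> Om u \<longleftrightarrow> x \<in> D L \<and> -H-d < z \<and> z < u x"
  by (simp add: Omega_def)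

lemma D_mem: "x \<in> D L \<longleftrightarrow> -L < x \<and> x < L" by (simp add: D_def)

lemma in_S1: "\<lbrakk>x \<in> {-L..L}; -H-d \<le> z; z \<le> -H; w \<ge> -H\<rbrakk> \<Longrightarrow> (x, z, w) \<in> S1"
  and in_S2: "\<lbrakk>x \<in> {-L..L}; -H \<le> z; w \<ge> -H\<rbrakk> \<Longrightarrow> (x, z, w) \<in> S2"
  by (auto simp: dom_h1_def dom_h2_def)

lemma derivative_bounds:
  obtains B where "\<And>x z w. \<lbrakk>(x, z, w) \<in> S1; w \<le> R\<rbrakk> \<Longrightarrow>
      \<bar>h\<^sub>1 (x, z, w)\<bar> \<le> B \<and> \<bar>d_x S1 h\<^sub>1 (x, z, w)\<bar> \<le> B \<and> \<bar>d_z S1 h\<^sub>1 (x, z, w)\<bar> \<le> B \<and> \<bar>d_w S1 h\<^sub>1 (x, z, w)\<bar> \<le> B"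
    "\<And>x z w. \<lbrakk>(x, z, w) \<in> S2; z \<le> R; w \<le> R\<rbrakk> \<Longrightarrow>
      \<bar>h\<^sub>2 (x, z, w)\<bar> \<le> B \<and> \<bar>d_x S2 h\<^sub>2 (x, z, w)\<bar> \<le> B \<and> \<bar>d_z S2 h\<^sub>2 (x, z, w)\<bar> \<le> B \<and> \<bar>d_w S2 h\<^sub>2 (x, z, w)\<bar> \<le> B"
    "B \<ge> 0"
proof -
  define K1 where "K1 = {-L..L} \<times> {-H-d..-H} \<times> {-H..R}"
  define K2 where "K2 = {-L..L} \<times> {-H..R} \<times> {-H..R}"
  have K: "compact K1" "compact K2" "K1 \<subseteq> S1" "K2 \<subseteq> S2"
    unfolding K1_def K2_def by (auto intro!: compact_Times simp: dom_h1_def dom_h2_def)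
  have bd: "\<exists>B\<ge>0. \<forall>p\<in>K. \<bar>h p\<bar> + \<bar>d_x S h p\<bar> + \<bar>d_z S h p\<bar> + \<bar>d_w S h p\<bar> \<le> B"
    if h: "Ck_on 2 h S" and K: "compact K" "K \<subseteq> S" for h K S
  proof -
    have "continuous_on S (\<lambda>p. \<bar>h p\<bar> + \<bar>d_x S h p\<bar> + \<bar>d_z S h p\<bar> + \<bar>d_w S h p\<bar>)"
      by (intro continuous_intros C2_facts[OF h])
    then have "bounded ((\<lambda>p. \<bar>h p\<bar> + \<bar>d_x S h p\<bar> + \<bar>d_z S h p\<bar> + \<bar>d_w S h p\<bar>) ` K)"
      using K by (intro compact_imp_bounded compact_continuous_image) (rule continuous_on_subset)
    then obtain B where B: "\<forall>p\<in>K. norm (\<bar>h p\<bar> + \<bar>d_x S h p\<bar> + \<bar>d_z S h p\<bar> + \<bar>d_w S h p\<bar>) \<le> B"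
      unfolding bounded_iff by blast
    show ?thesis
    proof (intro exI[of _ "max B 0"] conjI ballI)
      show "\<bar>h p\<bar> + \<bar>d_x S h p\<bar> + \<bar>d_z S h p\<bar> + \<bar>d_w S h p\<bar> \<le> max B 0" if "p \<in> K" for p
        using bspec[OF B that] by (simp add: le_max_iff_disj)
    qed simp
  qed
  obtain B1 where B1: "B1 \<ge> 0" "\<forall>p\<in>K1. \<bar>h\<^sub>1 p\<bar> + \<bar>d_x S1 h\<^sub>1 p\<bar> + \<bar>d_z S1 h\<^sub>1 p\<bar> + \<bar>d_w S1 h\<^sub>1 p\<bar> \<le> B1"
    using bd[OF C2(1) K(1,3)] by blast
  obtain B2 where B2: "B2 \<ge> 0" "\<forall>p\<in>K2. \<bar>h\<^sub>2 p\<bar> + \<bar>d_x S2 h\<^sub>2 p\<bar> + \<bar>d_z S2 h\<^sub>2 p\<bar> + \<bar>d_w S2 h\<^sub>2 p\<bar> \<le> B2"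
    using bd[OF C2(2) K(2,4)] by blast
  have le: "p \<le> B1 + B2 \<and> q \<le> B1 + B2 \<and> r \<le> B1 + B2 \<and> s \<le> B1 + B2"
    if "p + q + r + s \<le> B1 \<or> p + q + r + s \<le> B2" "0 \<le> p" "0 \<le> q" "0 \<le> r" "0 \<le> s" for p q r s
    using that B1(1) B2(1) by auto
  show ?thesis
  proof (rule that[of "B1 + B2"])
    fix x z w assume "(x, z, w) \<in> S1" "w \<le> R"
    then have "(x, z, w) \<in> K1" by (auto simp: K1_def dom_h1_def)
    with B1(2) show "\<bar>h\<^sub>1 (x, z, w)\<bar> \<le> B1 + B2 \<and> \<bar>d_x S1 h\<^sub>1 (x, z, w)\<bar> \<le> B1 + B2 \<and> \<bar>d_z S1 h\<^sub>1 (x, z, w)\<bar> \<le> B1 + B2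
        \<and> \<bar>d_w S1 h\<^sub>1 (x, z, w)\<bar> \<le> B1 + B2"
      by (intro le) auto
  next
    fix x z w assume "(x, z, w) \<in> S2" "z \<le> R" "w \<le> R"
    then have "(x, z, w) \<in> K2" by (auto simp: K2_def dom_h2_def)
    with B2(2) show "\<bar>h\<^sub>2 (x, z, w)\<bar> \<le> B1 + B2 \<and> \<bar>d_x S2 h\<^sub>2 (x, z, w)\<bar> \<le> B1 + B2 \<and> \<bar>d_z S2 h\<^sub>2 (x, z, w)\<bar> \<le> B1 + B2
        \<and> \<bar>d_w S2 h\<^sub>2 (x, z, w)\<bar> \<le> B1 + B2"
      by (intro le) auto
  qed (use B1(1) B2(1) in simp)
qed

text \<open>The constant depends on the bound R of u and v only. It serves a single deflection, for
  square-integrability, and a whole sequence, for dominated convergence.\<close>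

lemma h_gradh_bounds:
  obtains B where "B \<ge> 0" "\<And>u v x z. \<lbrakk>(x, z) \<in> Om u; u x \<ge> -H; u x \<le> R; \<bar>v x\<bar> \<le> R\<rbrakk> \<Longrightarrow>
     \<bar>h_of H h\<^sub>1 h\<^sub>2 u (x, z)\<bar> \<le> B \<and> \<bar>fst (gradh u v (x, z))\<bar> \<le> B \<and> \<bar>snd (gradh u v (x, z))\<bar> \<le> B"
proof -
  obtain B where B: "\<And>x z w. \<lbrakk>(x, z, w) \<in> S1; w \<le> R\<rbrakk> \<Longrightarrow>
      \<bar>h\<^sub>1 (x, z, w)\<bar> \<le> B \<and> \<bar>d_x S1 h\<^sub>1 (x, z, w)\<bar> \<le> B \<and> \<bar>d_z S1 h\<^sub>1 (x, z, w)\<bar> \<le> B \<and> \<bar>d_w S1 h\<^sub>1 (x, z, w)\<bar> \<le> B"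
    "\<And>x z w. \<lbrakk>(x, z, w) \<in> S2; z \<le> R; w \<le> R\<rbrakk> \<Longrightarrow>
      \<bar>h\<^sub>2 (x, z, w)\<bar> \<le> B \<and> \<bar>d_x S2 h\<^sub>2 (x, z, w)\<bar> \<le> B \<and> \<bar>d_z S2 h\<^sub>2 (x, z, w)\<bar> \<le> B \<and> \<bar>d_w S2 h\<^sub>2 (x, z, w)\<bar> \<le> B"
    "B \<ge> 0" using derivative_bounds by metis
  have comb: "\<bar>p + v * q\<bar> \<le> B + \<bar>R\<bar> * B" if "\<bar>p\<bar> \<le> B" "\<bar>q\<bar> \<le> B" "\<bar>v\<bar> \<le> R" for p q v :: real
  proof -
    have "\<bar>v * q\<bar> \<le> \<bar>R\<bar> * B" unfolding abs_mult using that by (intro mult_mono) auto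
    then show ?thesis using that(1) by linarith
  qed
  have le: "B \<le> B + \<bar>R\<bar> * B" using B(3) by simp
  show ?thesis
  proof (rule that[of "B + \<bar>R\<bar> * B"])
    show "0 \<le> B + \<bar>R\<bar> * B" using B(3) by simp
    fix u v :: "real \<Rightarrow> real" and x z assume a: "(x, z) \<in> Om u" "u x \<ge> -H" "u x \<le> R" "\<bar>v x\<bar> \<le> R"
    then have xz: "x \<in> {-L..L}" "-H-d < z" "z < u x" by (auto simp: Om_mem D_mem)
    show "\<bar>h_of H h\<^sub>1 h\<^sub>2 u (x, z)\<bar> \<le> B + \<bar>R\<bar> * B \<and> \<bar>fst (gradh u v (x, z))\<bar> \<le> B + \<bar>R\<bar> * B \<and> \<bar>snd (gradh u v (x, z))\<bar> \<le> B + \<bar>R\<bar> * B"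
    proof (cases "z \<le> -H")
      case True
      have "(x, z, u x) \<in> S1" using xz a True by (intro in_S1) auto
      from B(1)[OF this a(3)] True show ?thesis using comb[OF _ _ a(4)] le by (auto simp: h_of_def gradh_def intro: order_trans)
    next
      case False
      have "(x, z, u x) \<in> S2" "z \<le> R" using xz a False by (auto intro: in_S2)
      from B(2)[OF this a(3)] False show ?thesis using comb[OF _ _ a(4)] le by (auto simp: h_of_def gradh_def intro: order_trans)
    qed
  qed
qed

lemma defl_Om:
  assumes "defl H L u v w"
  shows "open (Om u)" "Om u \<in> lmeasurable"
proof -
  note a = deflD[OF assms]
  have c: "continuous_on (D L) u" by (rule continuous_on_subset[OF a(10) D_basic(4)])
  show o: "open (Om u)" by (rule Omega_open[OF c])
  have "bounded (u ` {-L..L})" by (intro compact_imp_bounded compact_continuous_image a(10) compact_Icc)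
  then obtain B where B: "\<And>x. x \<in> {-L..L} \<Longrightarrow> norm (u x) \<le> B" unfolding bounded_iff by blast
  have "z \<le> B" if "(x, z) \<in> Om u" for x z using B[of x] that by (auto simp: Om_mem D_mem)
  then have "Om u \<subseteq> {-L..L} \<times> {-H-d..B}" by (auto simp: Omega_def D_mem)
  then have "bounded (Om u)" by (rule bounded_subset[rotated]) (intro bounded_Times bounded_closed_interval)
  then show "Om u \<in> lmeasurable" using o by (intro bounded_set_imp_lmeasurable) (auto simp: borel_open)
qed

lemma triple_cont:
  assumes "continuous_on {-L..L} u" "T \<subseteq> D L \<times> UNIV" "continuous_on S f" "\<And>x z. (x, z) \<in> T \<Longrightarrow> (x, z, u x) \<in> S"
  shows "continuous_on T (\<lambda>p. f (fst p, snd p, u (fst p)) :: real)"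
proof (rule continuous_on_compose2[OF assms(3)])
  have "continuous_on T (\<lambda>p. u (fst p))"
    by (rule continuous_on_compose2[OF assms(1)]) (use assms(2) D_basic(4)[of L] in \<open>auto intro!: continuous_intros\<close>)
  then show "continuous_on T (\<lambda>p. (fst p, snd p, u (fst p)))" by (intro continuous_intros)
qed (use assms(4) in auto)

lemma gradh_cont:
  assumes "defl H L u v w"
  shows "continuous_on (Om u \<inter> {p. snd p \<le> -H}) (gradh u v)" "continuous_on (Om u \<inter> {p. snd p > -H}) (gradh u v)"
proof -
  note a = deflD[OF assms] and c1 = h1[OF C2(1)] and c2 = h2[OF C2(2)]
  let ?A = "Om u \<inter> {p. snd p \<le> -H}" and ?B = "Om u \<inter> {p. snd p > -H}"
  have A: "?A \<subseteq> D L \<times> UNIV" "?B \<subseteq> D L \<times> UNIV" by (auto simp: Omega_def)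
  have AS: "(x, z, u x) \<in> S1" if "(x, z) \<in> ?A" for x z using that a(7)[of x] by (intro in_S1) (auto simp: Om_mem D_mem)
  have BS: "(x, z, u x) \<in> S2" if "(x, z) \<in> ?B" for x z using that a(7)[of x] by (intro in_S2) (auto simp: Om_mem D_mem)
  have vc: "continuous_on T (\<lambda>p. v (fst p))" if "T \<subseteq> D L \<times> (UNIV :: real set)" for T
    by (rule continuous_on_compose2[OF a(1)]) (use that D_basic(4)[of L] in \<open>auto intro!: continuous_intros\<close>)
  have "continuous_on ?A (\<lambda>p. (d_x S1 h\<^sub>1 (fst p, snd p, u (fst p)) + v (fst p) * d_w S1 h\<^sub>1 (fst p, snd p, u (fst p)), d_z S1 h\<^sub>1 (fst p, snd p, u (fst p))))"
    by (intro continuous_intros vc A triple_cont[OF a(10) A(1) _ AS] c1)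
  then show "continuous_on ?A (gradh u v)" by (rule continuous_on_eq) (auto simp: gradh_def)
  have "continuous_on ?B (\<lambda>p. (d_x S2 h\<^sub>2 (fst p, snd p, u (fst p)) + v (fst p) * d_w S2 h\<^sub>2 (fst p, snd p, u (fst p)), d_z S2 h\<^sub>2 (fst p, snd p, u (fst p))))"
    by (intro continuous_intros vc A triple_cont[OF a(10) A(2) _ BS] c2)
  then show "continuous_on ?B (gradh u v)" by (rule continuous_on_eq) (auto simp: gradh_def)
qed

lemma split_sets:
  assumes "defl H L u v w"
  shows "Om u \<inter> {p. snd p \<le> -H} \<in> sets lebesgue" "Om u \<inter> {p. snd p > -H} \<in> sets lebesgue"
    "Om u = (Om u \<inter> {p. snd p \<le> -H}) \<union> (Om u \<inter> {p. snd p > -H})"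
proof -
  have o: "Om u \<in> sets lebesgue" using defl_Om[OF assms] by (simp add: fmeasurableD)
  have g: "{p::real \<times> real. snd p > -H} \<in> sets lebesgue" by (intro open_sets_lebesgue open_snd_cmp)
  show "Om u \<inter> {p. snd p > -H} \<in> sets lebesgue" using o g by (rule sets.Int)
  have "Om u \<inter> {p. snd p \<le> -H} = Om u - {p. snd p > -H}" by auto
  then show "Om u \<inter> {p. snd p \<le> -H} \<in> sets lebesgue" using sets.Diff[OF o g] by simp
qed auto

lemma gradh_measurable:
  assumes "defl H L u v w"
  shows "gradh u v \<in> borel_measurable (lebesgue_on (Om u))"
  by (subst split_sets(3)[OF assms], rule measurable_lebesgue_on_Un[OF split_sets(1,2)[OF assms]])
     (intro continuous_imp_measurable_on_sets_lebesgue gradh_cont[OF assms] split_sets[OF assms])+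

lemma h_of_cont:
  assumes "defl H L u v w"
  shows "continuous_on (Om u) (h_of H h\<^sub>1 h\<^sub>2 u)"
proof -
  note a = deflD[OF assms]
  have "continuous_on (Om u) (\<lambda>p. if snd p \<le> -H then h\<^sub>1 (fst p, snd p, u (fst p)) else h\<^sub>2 (fst p, snd p, u (fst p)))"
  proof (rule continuous_on_cases_le)
    show "continuous_on {p \<in> Om u. snd p \<le> -H} (\<lambda>p. h\<^sub>1 (fst p, snd p, u (fst p)))"
    proof (rule triple_cont[OF a(10) _ h1(2)[OF C2(1)]])
      show "(x, z, u x) \<in> S1" if "(x, z) \<in> {p \<in> Om u. snd p \<le> -H}" for x z
        using that a(7)[of x] by (intro in_S1) (auto simp: Om_mem D_mem)
    qed (auto simp: Omega_def)
    show "continuous_on {p \<in> Om u. -H \<le> snd p} (\<lambda>p. h\<^sub>2 (fst p, snd p, u (fst p)))"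
    proof (rule triple_cont[OF a(10) _ h2(2)[OF C2(2)]])
      show "(x, z, u x) \<in> S2" if "(x, z) \<in> {p \<in> Om u. -H \<le> snd p}" for x z
        using that a(7)[of x] by (intro in_S2) (auto simp: Om_mem D_mem)
    qed (auto simp: Omega_def)
    show "h\<^sub>1 (fst p, snd p, u (fst p)) = h\<^sub>2 (fst p, snd p, u (fst p))" if "p \<in> Om u" "snd p = -H" for p
      using A1 that a(7)[of "fst p"] by (cases p) (auto simp: A1_def Om_mem)
  qed (intro continuous_intros)
  then show ?thesis by (rule continuous_on_eq) (auto simp: h_of_def split: prod.splits)
qed

lemma defl_bounded:
  assumes "defl H L u v w"
  obtains R where "\<And>x. x \<in> D L \<Longrightarrow> \<bar>u x\<bar> \<le> R" "\<And>x. x \<in> D L \<Longrightarrow> \<bar>v x\<bar> \<le> R" "R \<ge> 0"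
proof -
  note a = deflD[OF assms]
  have "bounded (u ` {-L..L})" "bounded (v ` {-L..L})"
    by (intro compact_imp_bounded compact_continuous_image a(10,1) compact_Icc)+
  then obtain B B' where "\<And>x. x \<in> {-L..L} \<Longrightarrow> norm (u x) \<le> B" "\<And>x. x \<in> {-L..L} \<Longrightarrow> norm (v x) \<le> B'"
    unfolding bounded_iff by blast
  then show ?thesis using D_basic(4)[of L] by (intro that[of "max 0 (max B B')"]) (auto simp: le_max_iff_disj subset_iff)
qed

lemma h_of_derivative_x:
  assumes "defl H L u v w" "(x, z) \<in> Om u" "z \<noteq> -H"
  shows "((\<lambda>t. h_of H h\<^sub>1 h\<^sub>2 u (x + t, z)) has_real_derivative fst (gradh u v (x, z))) (at 0)"
proof -
  note a = deflD[OF assms(1)]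
  have x: "x \<in> D L" "x \<in> {-L..L}" and z: "-H-d < z" "z < u x" using assms(2) by (auto simp: Om_mem D_mem)
  have "at x within {-L..L} = at x" using x(1) by (intro at_within_interior) (auto simp: D_def)
  then have "(u has_real_derivative v x) (at (0 + x))" using a(2)[OF x(2)] by simp
  then have "((\<lambda>t. u (t + x)) has_real_derivative v x) (at 0)" by (simp only: DERIV_shift)
  then have ud: "((\<lambda>t. u (x + t)) has_derivative (\<lambda>t. t *\<^sub>R v x)) (at 0)"
    by (simp add: has_field_derivative_def add.commute mult_commute_abs)
  have \<gamma>: "((\<lambda>t. (x + t, z, u (x + t))) has_derivative (\<lambda>t. t *\<^sub>R (1, 0, v x))) (at 0)"
  proof -
    have "((\<lambda>t. (x + t, z, u (x + t))) has_derivative (\<lambda>t. (t, 0, t *\<^sub>R v x))) (at 0)"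
      by (intro has_derivative_Pair ud) (auto intro!: derivative_eq_intros)
    then show ?thesis by simp
  qed
  define T where "T = {-L - x<..<L - x}"
  have T: "open T" "0 \<in> T" "\<And>t. t \<in> T \<Longrightarrow> x + t \<in> D L" using x by (auto simp: T_def D_mem)
  have TS: "x + t \<in> {-L..L} \<and> u (x + t) \<ge> -H" if "t \<in> T" for t using T(3)[OF that] a(7) by (auto simp: D_mem)
  show ?thesis
  proof (cases "z \<le> -H")
    case True
    have "((\<lambda>t. h\<^sub>1 (x + t, z, u (x + t))) has_real_derivative (1 * d_x S1 h\<^sub>1 (x + 0, z, u (x + 0)) + 0 * d_z S1 h\<^sub>1 (x + 0, z, u (x + 0)) + v x * d_w S1 h\<^sub>1 (x + 0, z, u (x + 0)))) (at 0)"
      by (rule curve_derivative[OF h1(1)[OF C2(1)] T(1,2) _ \<gamma>]) (use TS z True in \<open>auto intro!: in_S1\<close>)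
    then show ?thesis using True by (simp add: h_of_def gradh_def)
  next
    case False
    have "((\<lambda>t. h\<^sub>2 (x + t, z, u (x + t))) has_real_derivative (1 * d_x S2 h\<^sub>2 (x + 0, z, u (x + 0)) + 0 * d_z S2 h\<^sub>2 (x + 0, z, u (x + 0)) + v x * d_w S2 h\<^sub>2 (x + 0, z, u (x + 0)))) (at 0)"
      by (rule curve_derivative[OF h2(1)[OF C2(2)] T(1,2) _ \<gamma>]) (use TS z False in \<open>auto intro!: in_S2\<close>)
    then show ?thesis using False by (simp add: h_of_def gradh_def)
  qed
qed

lemma h_of_derivative_z:
  assumes "defl H L u v w" "(x, z) \<in> Om u" "z \<noteq> -H"
  shows "((\<lambda>t. h_of H h\<^sub>1 h\<^sub>2 u (x, z + t)) has_real_derivative snd (gradh u v (x, z))) (at 0)"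
proof -
  note a = deflD[OF assms(1)]
  have x: "x \<in> D L" "x \<in> {-L..L}" "u x \<ge> -H" and z: "-H-d < z" "z < u x" using assms(2) a(7) by (auto simp: Om_mem D_mem)
  have \<gamma>: "((\<lambda>t. (x, z + t, u x)) has_derivative (\<lambda>t. t *\<^sub>R (0, 1, 0))) (at 0)"
  proof -
    have "((\<lambda>t. (x, z + t, u x)) has_derivative (\<lambda>t. (0, t, 0))) (at 0)"
      by (intro has_derivative_Pair) (auto intro!: derivative_eq_intros)
    then show ?thesis by simp
  qed
  show ?thesis
  proof (cases "z \<le> -H")
    case True
    define T where "T = {-H-d-z<..<-H-z}"
    have T: "open T" "0 \<in> T" using True z assms(3) by (auto simp: T_def)
    have "((\<lambda>t. h\<^sub>1 (x, z + t, u x)) has_real_derivative (0 * d_x S1 h\<^sub>1 (x, z + 0, u x) + 1 * d_z S1 h\<^sub>1 (x, z + 0, u x) + 0 * d_w S1 h\<^sub>1 (x, z + 0, u x))) (at 0)"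
      by (rule curve_derivative[OF h1(1)[OF C2(1)] T(1,2) _ \<gamma>]) (use x in \<open>auto intro!: in_S1 simp: T_def\<close>)
    then have "((\<lambda>t. h\<^sub>1 (x, z + t, u x)) has_real_derivative snd (gradh u v (x, z))) (at 0)" using True by (simp add: gradh_def)
    then show ?thesis
      by (rule has_field_derivative_transform_within_open[OF _ T]) (auto simp: h_of_def T_def)
  next
    case False
    define T where "T = {-H-z<..}"
    have T: "open T" "0 \<in> T" using False by (auto simp: T_def)
    have "((\<lambda>t. h\<^sub>2 (x, z + t, u x)) has_real_derivative (0 * d_x S2 h\<^sub>2 (x, z + 0, u x) + 1 * d_z S2 h\<^sub>2 (x, z + 0, u x) + 0 * d_w S2 h\<^sub>2 (x, z + 0, u x))) (at 0)"
      by (rule curve_derivative[OF h2(1)[OF C2(2)] T(1,2) _ \<gamma>]) (use x in \<open>auto intro!: in_S2 simp: T_def\<close>)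
    then have "((\<lambda>t. h\<^sub>2 (x, z + t, u x)) has_real_derivative snd (gradh u v (x, z))) (at 0)" using False by (simp add: gradh_def)
    then show ?thesis
      by (rule has_field_derivative_transform_within_open[OF _ T]) (auto simp: h_of_def T_def)
  qed
qed

text \<open>The two pieces match continuously at z = -H, so the kink adds no singular part to the
  gradient. The interface is a null set; a horizontal line starting off it never meets it, a
  vertical one meets it once, as the criterion by lines asks.\<close>

lemma h_of_wgrad:
  assumes dv: "defl H L u v w"
  shows "has_wgrad (Om u) (h_of H h\<^sub>1 h\<^sub>2 u) (gradh u v)"
proof -
  note a = deflD[OF dv] and Om = defl_Om[OF dv]
  obtain R where R: "\<And>x. x \<in> D L \<Longrightarrow> \<bar>u x\<bar> \<le> R" "\<And>x. x \<in> D L \<Longrightarrow> \<bar>v x\<bar> \<le> R" "R \<ge> 0" using defl_bounded[OF dv] by metis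
  obtain B where B: "B \<ge> 0" "\<And>u v x z. \<lbrakk>(x, z) \<in> Om u; u x \<ge> -H; u x \<le> R; \<bar>v x\<bar> \<le> R\<rbrakk> \<Longrightarrow>
     \<bar>h_of H h\<^sub>1 h\<^sub>2 u (x, z)\<bar> \<le> B \<and> \<bar>fst (gradh u v (x, z))\<bar> \<le> B \<and> \<bar>snd (gradh u v (x, z))\<bar> \<le> B" using h_gradh_bounds by metis
  have bd: "\<bar>h_of H h\<^sub>1 h\<^sub>2 u (x, z)\<bar> \<le> B" "\<bar>fst (gradh u v (x, z))\<bar> \<le> B" "\<bar>snd (gradh u v (x, z))\<bar> \<le> B" if "(x, z) \<in> Om u" for x z
  proof -
    have x: "x \<in> D L" using that by (simp add: Om_mem)
    show "\<bar>h_of H h\<^sub>1 h\<^sub>2 u (x, z)\<bar> \<le> B" "\<bar>fst (gradh u v (x, z))\<bar> \<le> B" "\<bar>snd (gradh u v (x, z))\<bar> \<le> B"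
      using B(2)[where u=u and v=v, OF that a(7)[OF x] _ R(2)[OF x]] R(1)[OF x] by auto
  qed
  have hs: "sqint (lebesgue_on (Om u)) (h_of H h\<^sub>1 h\<^sub>2 u)"
  proof (rule bounded_sqint(1)[OF Om(2)])
    show "h_of H h\<^sub>1 h\<^sub>2 u \<in> borel_measurable (lebesgue_on (Om u))"
      by (rule continuous_imp_measurable_on_sets_lebesgue[OF h_of_cont[OF dv] open_sets_lebesgue[OF Om(1)]])
    show "(norm (h_of H h\<^sub>1 h\<^sub>2 u p))\<^sup>2 \<le> B\<^sup>2" if "p \<in> Om u" for p
      using bd(1)[of "fst p" "snd p"] that by (intro power_mono) auto
  qed
  have gs: "sqint (lebesgue_on (Om u)) (gradh u v)"
  proof (rule bounded_sqint(1)[OF Om(2) gradh_measurable[OF dv]])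
    show "(norm (gradh u v p))\<^sup>2 \<le> B\<^sup>2 + B\<^sup>2" if "p \<in> Om u" for p
    proof -
      have "\<bar>fst (gradh u v p)\<bar>\<^sup>2 \<le> B\<^sup>2" "\<bar>snd (gradh u v p)\<bar>\<^sup>2 \<le> B\<^sup>2"
        using bd(2,3)[of "fst p" "snd p"] that B(1) by (auto simp: abs_le_square_iff[symmetric])
      then show ?thesis by (cases "gradh u v p") (simp add: norm_Pair)
    qed
  qed
  define N where "N = {p::real \<times> real. snd p = -H}"
  have Nn: "negligible N" unfolding N_def by (rule negligible_snd)
  have loc: "loc_integrable (Om u) (h_of H h\<^sub>1 h\<^sub>2 u)" "b \<in> Basis \<Longrightarrow> loc_integrable (Om u) (\<lambda>p. gradh u v p \<bullet> b)" for b
    using hs gs by (auto intro!: sqint_loc_integrable[OF Om(1)] sqint_component)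
  have Bx: "(1, 0) \<in> (Basis :: (real \<times> real) set)" "(0, 1) \<in> (Basis :: (real \<times> real) set)" by (auto simp: Basis_prod_def)
  have "has_weak_pderiv (Om u) (1, 0) (h_of H h\<^sub>1 h\<^sub>2 u) (\<lambda>p. gradh u v p \<bullet> (1, 0))"
  proof (rule has_weak_pderivI_lines[OF Om(1) Bx(1) h_of_cont[OF dv], where B=B, OF _ Nn])
    show "\<bar>h_of H h\<^sub>1 h\<^sub>2 u p\<bar> \<le> B" if "p \<in> Om u" for p using bd(1)[of "fst p" "snd p"] that by auto
    show "finite {t. p + t *\<^sub>R (1, 0) \<in> N}" if "p \<notin> N" for p using that by (auto simp: N_def)
    show "((\<lambda>t. h_of H h\<^sub>1 h\<^sub>2 u (p + t *\<^sub>R (1, 0))) has_real_derivative gradh u v p \<bullet> (1, 0)) (at 0)" if "p \<in> Om u - N" for p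
      using h_of_derivative_x[OF dv, of "fst p" "snd p"] that by (cases p) (auto simp: N_def inner_prod_def)
    show "\<bar>gradh u v p \<bullet> (1, 0)\<bar> \<le> B" if "p \<in> Om u - N" for p
      using bd(2)[of "fst p" "snd p"] that by (auto simp: inner_prod_def)
  qed (intro loc Bx)+
  moreover have "has_weak_pderiv (Om u) (0, 1) (h_of H h\<^sub>1 h\<^sub>2 u) (\<lambda>p. gradh u v p \<bullet> (0, 1))"
  proof (rule has_weak_pderivI_lines[OF Om(1) Bx(2) h_of_cont[OF dv], where B=B, OF _ Nn])
    show "\<bar>h_of H h\<^sub>1 h\<^sub>2 u p\<bar> \<le> B" if "p \<in> Om u" for p using bd(1)[of "fst p" "snd p"] that by auto
    show "finite {t. p + t *\<^sub>R (0, 1) \<in> N}" if "p \<notin> N" for p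
    proof -
      have "{t. p + t *\<^sub>R (0, 1) \<in> N} \<subseteq> {-H - snd p}" by (auto simp: N_def)
      then show ?thesis by (rule finite_subset) simp
    qed
    show "((\<lambda>t. h_of H h\<^sub>1 h\<^sub>2 u (p + t *\<^sub>R (0, 1))) has_real_derivative gradh u v p \<bullet> (0, 1)) (at 0)" if "p \<in> Om u - N" for p
      using h_of_derivative_z[OF dv, of "fst p" "snd p"] that by (cases p) (auto simp: N_def inner_prod_def)
    show "\<bar>gradh u v p \<bullet> (0, 1)\<bar> \<le> B" if "p \<in> Om u - N" for p
      using bd(3)[of "fst p" "snd p"] that by (auto simp: inner_prod_def)
  qed (intro loc Bx)+
  ultimately show ?thesis unfolding has_wgrad_def using hs gs by (auto simp: Basis_prod_def)
qed

section \<open>Permittivity bounds and the variational form of the electrostatic energy\<close>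

lemma cl_Omega1: "closure (Omega1 H L d) = {-L..L} \<times> {-H-d..-H}"
  using L d by (simp add: Omega1_def D_def closure_Times)

lemma sigma1_cont: "continuous_on ({-L..L} \<times> {-H-d..-H}) \<sigma>\<^sub>1"
  using adm unfolding admissible_sigma_def cl_Omega1 numeral_2_eq_2 by (auto intro: differentiable_imp_continuous_on)

lemma sigma_lower:
  obtains c where "c > 0" "\<And>p. c \<le> sig p"
proof -
  let ?K = "{-L..L} \<times> {-H-d..-H}"
  have "compact ?K" "?K \<noteq> {}" using L d by (auto intro!: compact_Times)
  then obtain q where q: "q \<in> ?K" "\<And>p. p \<in> ?K \<Longrightarrow> \<sigma>\<^sub>1 q \<le> \<sigma>\<^sub>1 p" using continuous_attains_inf[OF _ _ sigma1_cont] by metis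
  have "\<sigma>\<^sub>1 q > 0" "\<sigma>\<^sub>2 > 0" using adm q(1) unfolding admissible_sigma_def cl_Omega1 by auto
  moreover have "Omega1 H L d \<subseteq> ?K" by (auto simp: Omega1_def D_def)
  ultimately show ?thesis using q(2)
    by (intro that[of "min (\<sigma>\<^sub>1 q) \<sigma>\<^sub>2"]) (auto simp: sigma_def min_le_iff_disj)
qed

lemma sigma_upper: "sig p \<le> smax"
proof -
  let ?K = "{-L..L} \<times> {-H-d..-H}"
  have "compact ?K" by (auto intro!: compact_Times)
  then have "bounded ((\<lambda>p. \<bar>\<sigma>\<^sub>1 p\<bar>) ` ?K)"
    by (intro compact_imp_bounded compact_continuous_image continuous_intros sigma1_cont)
  then have bdd: "bdd_above ((\<lambda>p. \<bar>\<sigma>\<^sub>1 p\<bar>) ` ?K)" by (rule bounded_imp_bdd_above)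
  have "Ck_norm (Suc 1) \<sigma>\<^sub>1 ?K \<ge> (SUP p\<in>?K. \<bar>\<sigma>\<^sub>1 p\<bar>)" by (subst Ck_norm.simps(2)) (rule max.cobounded1)
  then have sup: "Ck_norm 2 \<sigma>\<^sub>1 ?K \<ge> (SUP p\<in>?K. \<bar>\<sigma>\<^sub>1 p\<bar>)" unfolding Suc_1 .
  have "\<sigma>\<^sub>1 p \<le> Ck_norm 2 \<sigma>\<^sub>1 ?K" if "p \<in> ?K" for p
  proof -
    have "\<bar>\<sigma>\<^sub>1 p\<bar> \<le> (SUP p\<in>?K. \<bar>\<sigma>\<^sub>1 p\<bar>)" by (rule cSUP_upper[OF that bdd])
    with sup show ?thesis by linarith
  qed
  moreover have "Omega1 H L d \<subseteq> ?K" by (auto simp: Omega1_def D_def)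
  ultimately show ?thesis unfolding sigma_def sigma_max_def cl_Omega1 by (auto simp: le_max_iff_disj)
qed

lemma sigma_measurable:
  assumes "defl H L u v w"
  shows "sig \<in> borel_measurable (lebesgue_on (Om u))"
proof -
  let ?A = "Om u \<inter> {p. snd p < -H}" and ?B = "Om u - {p. snd p < -H}"
  have o: "Om u \<in> sets lebesgue" using defl_Om[OF assms] by (simp add: fmeasurableD)
  have g: "{p::real \<times> real. snd p < -H} \<in> sets lebesgue" by (intro open_sets_lebesgue open_snd_cmp)
  have AB: "?A \<in> sets lebesgue" "?B \<in> sets lebesgue" using o g by auto
  have "continuous_on ?A \<sigma>\<^sub>1" by (rule continuous_on_subset[OF sigma1_cont]) (auto simp: Omega_def D_def)
  then have "continuous_on ?A sig" by (rule continuous_on_eq) (auto simp: sigma_def Omega1_def Omega_def)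
  moreover have "continuous_on ?B sig"
    by (rule continuous_on_eq[OF continuous_on_const[of _ \<sigma>\<^sub>2]]) (auto simp: sigma_def Omega1_def)
  ultimately have "sig \<in> borel_measurable (lebesgue_on (?A \<union> ?B))"
    by (intro measurable_lebesgue_on_Un[OF AB] continuous_imp_measurable_on_sets_lebesgue AB)
  moreover have "?A \<union> ?B = Om u" by auto
  ultimately show ?thesis by simp
qed

definition J :: "(real \<Rightarrow> real) \<Rightarrow> (real \<Rightarrow> real) \<Rightarrow> (real \<times> real \<Rightarrow> real) \<Rightarrow> real" where
  "J u v \<phi> = (LINT p|lebesgue_on (Om u). sig p * (norm (gradh u v p + tgrad \<phi> p))\<^sup>2)"

text \<open>The minus sign turns the minimum of Dirichlet's principle into a supremum over test
  functions. Existence of a potential enters because \<open>psi\<close> is selected by choice and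
  only then is known to solve the problem. The horizontal extent L of the domain is the bound used
  for Poincare's inequality.\<close>

lemma E_e_variational:
  assumes dv: "defl H L u v w"
  shows "\<And>\<phi>. \<phi> \<in> test_functions (Om u) \<Longrightarrow> - (1/2) * J u v \<phi> \<le> E_e H L d \<sigma>\<^sub>1 \<sigma>\<^sub>2 h\<^sub>1 h\<^sub>2 u"
    "\<And>e. e > 0 \<Longrightarrow> \<exists>\<phi>\<in>test_functions (Om u). E_e H L d \<sigma>\<^sub>1 \<sigma>\<^sub>2 h\<^sub>1 h\<^sub>2 u \<le> - (1/2) * J u v \<phi> + e"
proof -
  obtain c where c: "c > 0" "\<And>p. c \<le> sig p" using sigma_lower by metis
  interpret weighted "Om u" sig c smax
    by unfold_locales (use c sigma_upper sigma_measurable[OF dv] defl_Om[OF dv] in auto)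
  have eq: "is_potential H L d \<sigma>\<^sub>1 \<sigma>\<^sub>2 h\<^sub>1 h\<^sub>2 u \<psi> \<longleftrightarrow> harmonic (h_of H h\<^sub>1 h\<^sub>2 u) \<psi>" for \<psi>
    unfolding is_potential_def harmonic_def ..
  have "\<exists>\<psi>. harmonic (h_of H h\<^sub>1 h\<^sub>2 u) \<psi>"
  proof (rule harmonic_exists[OF h_of_wgrad[OF dv], of "(1, 0)" L])
    show "\<bar>p \<bullet> (1, 0)\<bar> \<le> L" if "p \<in> Om u" for p using that by (auto simp: Omega_def D_def inner_prod_def)
  qed (simp add: Basis_prod_def)
  then have \<psi>: "harmonic (h_of H h\<^sub>1 h\<^sub>2 u) (psi H L d \<sigma>\<^sub>1 \<sigma>\<^sub>2 h\<^sub>1 h\<^sub>2 u)"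
    unfolding psi_def eq by (rule someI_ex)
  note E = harmonic_energy[OF h_of_wgrad[OF dv] \<psi>]
  show "- (1/2) * J u v \<phi> \<le> E_e H L d \<sigma>\<^sub>1 \<sigma>\<^sub>2 h\<^sub>1 h\<^sub>2 u" if "\<phi> \<in> test_functions (Om u)" for \<phi>
    using E(1)[OF that] by (simp add: E_e_def J_def)
  show "\<exists>\<phi>\<in>test_functions (Om u). E_e H L d \<sigma>\<^sub>1 \<sigma>\<^sub>2 h\<^sub>1 h\<^sub>2 u \<le> - (1/2) * J u v \<phi> + e" if e: "e > 0" for e
  proof -
    obtain \<phi> where \<phi>: "\<phi> \<in> test_functions (Om u)"
      "J u v \<phi> \<le> (LINT p|lebesgue_on (Om u). sig p * (norm (weak_grad (Om u) (psi H L d \<sigma>\<^sub>1 \<sigma>\<^sub>2 h\<^sub>1 h\<^sub>2 u) p))\<^sup>2) + 2 * e"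
      using E(2)[of "2 * e"] e unfolding J_def by auto
    from \<phi>(2) have "E_e H L d \<sigma>\<^sub>1 \<sigma>\<^sub>2 h\<^sub>1 h\<^sub>2 u \<le> - (1/2) * J u v \<phi> + e"
      unfolding E_e_def by linarith
    then show ?thesis by (rule bexI[of _ \<phi>]) (rule \<phi>(1))
  qed
qed

end

section \<open>Growth conditions and the Dirichlet integral of the boundary data\<close>

lemma chain_rule_square_bound:
  assumes "\<bar>a\<bar> + \<bar>b\<bar> \<le> sqrt P" "\<bar>c\<bar> \<le> sqrt Q" "P \<ge> 0" "Q \<ge> 0"
  shows "(a + v * c)\<^sup>2 + b\<^sup>2 \<le> 2 * (P + Q * v\<^sup>2)"
proof -
  have "(\<bar>a\<bar> + \<bar>b\<bar>)\<^sup>2 \<le> (sqrt P)\<^sup>2" using assms(1) by (intro power_mono) auto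
  then have 1: "a\<^sup>2 + 2 * (\<bar>a\<bar> * \<bar>b\<bar>) + b\<^sup>2 \<le> P" using assms(3) by (simp add: power2_sum)
  have "\<bar>c\<bar>\<^sup>2 \<le> (sqrt Q)\<^sup>2" using assms(2) by (intro power_mono) auto
  then have "v\<^sup>2 * c\<^sup>2 \<le> v\<^sup>2 * Q" using assms(4) by (intro mult_left_mono) auto
  \<comment> \<open>The factor 2 of the final bound arises here. The second component b costs
    nothing extra, as (A3) bounds the sum of the two absolute values.\<close>
  moreover have "(a + v * c)\<^sup>2 \<le> 2 * a\<^sup>2 + 2 * (v\<^sup>2 * c\<^sup>2)"
    using zero_le_power2[of "a - v * c"] by (simp add: power2_sum power2_diff power_mult_distrib mult.commute)
  moreover have "0 \<le> \<bar>a\<bar> * \<bar>b\<bar>" "0 \<le> b\<^sup>2" by simp_all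
  moreover have "Q * v\<^sup>2 = v\<^sup>2 * Q" by (rule mult.commute)
  moreover have "s + b2 \<le> 2 * (P + qv)" if "vc \<le> vq" "s \<le> 2 * a2 + 2 * vc" "0 \<le> ab" "0 \<le> b2" "qv = vq" "a2 + 2 * ab + b2 \<le> P"
    for s b2 qv vq vc a2 ab :: real using that by (simp add: algebra_simps)
  ultimately show ?thesis using 1 by blast
qed

lemma continuous_interval_nsq_le:
  fixes f :: "real \<Rightarrow> real"
  assumes "L \<ge> 0" "continuous_on {-L..L} f" "\<And>x. x \<in> {-L..L} \<Longrightarrow> \<bar>f x\<bar> \<le> e"
  shows "nsq (lebesgue_on (D L)) f \<le> 2 * L * e\<^sup>2"
proof -
  have "nsq (lebesgue_on (D L)) f \<le> e\<^sup>2 * measure lebesgue (D L)"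
  proof (rule bounded_sqint(2)[OF D_basic(3)])
    show "f \<in> borel_measurable (lebesgue_on (D L))" using continuous_interval_sqint[OF assms(2)] by (simp add: sqint_def)
    show "(norm (f x))\<^sup>2 \<le> e\<^sup>2" if "x \<in> D L" for x
      using assms(3)[of x] that D_basic(4)[of L] by (intro power_mono) auto
  qed
  then show ?thesis using D_basic(5)[OF assms(1)] by (simp add: mult_ac)
qed

context mems
begin

text \<open>A point of the domain with z > -H lies strictly below the graph, so H + u x is positive
  there and the weighted bounds of (A3) are available.\<close>

lemma grad_bound:
  assumes dv: "defl H L u v w" and A3: "A3 H L d m\<^sub>1 m\<^sub>2 m\<^sub>3 h\<^sub>1 h\<^sub>2" and m: "m\<^sub>1 > 0" "m\<^sub>2 > 0" "m\<^sub>3 > 0"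
    and p: "(x, z) \<in> Om u"
  shows "(norm (gradh u v (x, z)))\<^sup>2 \<le> 2 * (m\<^sub>1 + m\<^sub>2 * (u x)\<^sup>2 + m\<^sub>3 * (v x)\<^sup>2) * (if z \<le> -H then 1 else 1 / (H + u x))"
proof -
  have x: "x \<in> {-L..L}" "u x \<ge> -H" and z: "-H-d < z" "z < u x" using p deflD(7)[OF dv] by (auto simp: Om_mem D_mem)
  have P: "m\<^sub>1 + m\<^sub>2 * (u x)\<^sup>2 \<ge> 0" using m by simp
  show ?thesis
  proof (cases "z \<le> -H")
    case True
    have S: "(x, z, u x) \<in> S1" using x z True by (intro in_S1) auto
    have A: "\<bar>d_x S1 h\<^sub>1 (x, z, u x)\<bar> + \<bar>d_z S1 h\<^sub>1 (x, z, u x)\<bar> \<le> sqrt (m\<^sub>1 + m\<^sub>2 * (u x)\<^sup>2)" "\<bar>d_w S1 h\<^sub>1 (x, z, u x)\<bar> \<le> sqrt m\<^sub>3"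
      using A3 S unfolding A3_def by blast+
    show ?thesis using chain_rule_square_bound[OF A P, of "v x"] m True by (simp add: gradh_def norm_Pair)
  next
    case False
    have S: "(x, z, u x) \<in> S2" and u: "u x > -H" using x z False by (auto intro: in_S2)
    have A: "\<bar>d_x S2 h\<^sub>2 (x, z, u x)\<bar> + \<bar>d_z S2 h\<^sub>2 (x, z, u x)\<bar> \<le> sqrt ((m\<^sub>1 + m\<^sub>2 * (u x)\<^sup>2) / (H + u x))" "\<bar>d_w S2 h\<^sub>2 (x, z, u x)\<bar> \<le> sqrt (m\<^sub>3 / (H + u x))"
      using A3 S u unfolding A3_def by blast+
    have "(norm (gradh u v (x, z)))\<^sup>2 \<le> 2 * ((m\<^sub>1 + m\<^sub>2 * (u x)\<^sup>2) / (H + u x) + m\<^sub>3 / (H + u x) * (v x)\<^sup>2)"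
      using chain_rule_square_bound[OF A, of "v x"] P m u False by (simp add: gradh_def norm_Pair)
    also have "\<dots> = 2 * (m\<^sub>1 + m\<^sub>2 * (u x)\<^sup>2 + m\<^sub>3 * (v x)\<^sup>2) * (1 / (H + u x))" by (simp add: add_divide_distrib)
    finally show ?thesis using False by simp
  qed
qed

lemma smax_pos: "smax > 0"
proof -
  obtain c where "c > 0" "\<And>p. c \<le> sig p" using sigma_lower by metis
  with sigma_upper[of "(0, 0)"] show ?thesis by (meson less_le_trans)
qed

lemma sig_nonneg: "sig p \<ge> 0"
proof -
  obtain c where "c > 0" "\<And>p. c \<le> sig p" using sigma_lower by metis
  then show ?thesis by (meson less_imp_le order_trans)
qed

lemma tgrad_zero [simp]: "tgrad (\<lambda>x::real \<times> real. 0) p = 0"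
  by (simp add: tgrad_def zero_test_function(2))

text \<open>Tonelli by columns: the part below the interface has height d, and above it the weight
  1/(H + u) times the height H + u is at most 1. Since the weight may be unbounded near contact
  points, nonnegative integrals are used, for which no integrability has to be known
  beforehand.\<close>

lemma nn_integral_columns:
  fixes K u :: "real \<Rightarrow> real"
  assumes u: "continuous_on (D L) u" "\<And>x. x \<in> D L \<Longrightarrow> u x \<ge> -H" and K: "continuous_on (D L) K" "\<And>x. x \<in> D L \<Longrightarrow> K x \<ge> 0"
  shows "(\<integral>\<^sup>+p. ennreal (indicator (Om u) p * (K (fst p) * (if snd p \<le> -H then 1 else 1 / (H + u (fst p))))) \<partial>lebesgue)
    \<le> ennreal (d + 1) * (\<integral>\<^sup>+x. ennreal (indicator (D L) x * K x) \<partial>lborel)"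
proof -
  define Kt where "Kt x = indicator (D L) x * K x" for x
  define ut where "ut x = indicator (D L) x * u x" for x
  define A where "A = {p::real \<times> real. -H < snd p \<and> snd p < ut (fst p)}"
  have Km [measurable]: "Kt \<in> borel_measurable borel"
    using borel_measurable_continuous_on_indicator[OF _ K(1)] D_basic(1) unfolding Kt_def by (auto simp: borel_open)
  have um [measurable]: "ut \<in> borel_measurable borel"
    using borel_measurable_continuous_on_indicator[OF _ u(1)] D_basic(1) unfolding ut_def by (auto simp: borel_open)
  have Am: "A \<in> sets (borel \<Otimes>\<^sub>M borel)"
  proof -
    have "Measurable.pred (borel \<Otimes>\<^sub>M borel) (\<lambda>p::real \<times> real. -H < snd p \<and> snd p < ut (fst p))" by measurable
    then show ?thesis by (simp add: A_def pred_def space_pair_measure)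
  qed
  then have Am' [measurable]: "A \<in> sets (lborel \<Otimes>\<^sub>M lborel)" by simp
  \<comment> \<open>\<open>A\<close> also has columns above points outside D, where
    \<open>ut\<close> is 0; the factor \<open>Kt\<close> vanishes there.\<close>
  define F where "F p = ennreal (Kt (fst p)) * (indicator {-H-d..-H} (snd p) + ennreal (1 / (H + ut (fst p))) * indicator A p)" for p :: "real \<times> real"
  have Fm [measurable]: "F \<in> borel_measurable (lborel \<Otimes>\<^sub>M lborel)" unfolding F_def by measurable
  have "(\<integral>\<^sup>+p. ennreal (indicator (Om u) p * (K (fst p) * (if snd p \<le> -H then 1 else 1 / (H + u (fst p))))) \<partial>lebesgue) \<le> (\<integral>\<^sup>+p. F p \<partial>lebesgue)"
  proof (rule nn_integral_mono)
    fix p :: "real \<times> real"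
    show "ennreal (indicator (Om u) p * (K (fst p) * (if snd p \<le> -H then 1 else 1 / (H + u (fst p))))) \<le> F p"
    proof (cases "p \<in> Om u")
      case True
      obtain x z where p: "p = (x, z)" by (cases p)
      have x: "x \<in> D L" "-H-d < z" "z < u x" using True p by (auto simp: Om_mem)
      have e: "Kt x = K x" "ut x = u x" using x(1) by (auto simp: Kt_def ut_def)
      show ?thesis
      proof (cases "z \<le> -H")
        case True
        then show ?thesis using x p e \<open>p \<in> Om u\<close> by (simp add: F_def A_def)
      next
        case False
        have "K x \<ge> 0" "H + u x > 0" using K(2) x False by auto
        then show ?thesis using x p e \<open>p \<in> Om u\<close> False by (simp add: F_def A_def flip: ennreal_mult)
      qed
    qed simp
  qed
  also have "\<dots> = (\<integral>\<^sup>+p. F p \<partial>lborel)"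
    by (rule nn_integral_completion)
  also have "\<dots> = (\<integral>\<^sup>+p. F p \<partial>(lborel \<Otimes>\<^sub>M lborel))" by (simp add: lborel_prod)
  also have "\<dots> = (\<integral>\<^sup>+x. \<integral>\<^sup>+z. F (x, z) \<partial>lborel \<partial>lborel)"
    by (rule lborel.nn_integral_fst[symmetric]) (rule Fm)
  also have "\<dots> \<le> (\<integral>\<^sup>+x. ennreal (d + 1) * ennreal (Kt x) \<partial>lborel)"
  proof (rule nn_integral_mono)
    fix x :: real
    have col: "(indicator A (x, z) :: ennreal) = indicator {-H<..<ut x} z" for z by (auto simp: A_def indicator_def)
    have "(\<integral>\<^sup>+z. F (x, z) \<partial>lborel) = ennreal (Kt x) * ((\<integral>\<^sup>+z. indicator {-H-d..-H} z \<partial>lborel) + ennreal (1 / (H + ut x)) * (\<integral>\<^sup>+z. indicator A (x, z) \<partial>lborel))"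
      unfolding F_def col fst_conv snd_conv by (simp add: nn_integral_cmult nn_integral_add)
    also have "\<dots> \<le> ennreal (Kt x) * (ennreal d + 1)"
    proof (intro mult_left_mono add_mono)
      show "(\<integral>\<^sup>+z. indicator {-H-d..-H} z \<partial>lborel) \<le> ennreal d" using d by simp
      show "ennreal (1 / (H + ut x)) * (\<integral>\<^sup>+z. indicator A (x, z) \<partial>lborel) \<le> 1"
      proof (cases "ut x > -H")
        case True
        then show ?thesis unfolding col by (simp flip: ennreal_mult)
      next
        case False
        then show ?thesis unfolding col by simp
      qed
    qed auto
    also have "\<dots> = ennreal (d + 1) * ennreal (Kt x)" using d by (simp add: mult.commute ennreal_plus)
    finally show "(\<integral>\<^sup>+z. F (x, z) \<partial>lborel) \<le> ennreal (d + 1) * ennreal (Kt x)" .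
  qed
  also have "\<dots> = ennreal (d + 1) * (\<integral>\<^sup>+x. ennreal (Kt x) \<partial>lborel)" by (rule nn_integral_cmult) measurable
  finally show ?thesis by (simp add: Kt_def)
qed

text \<open>Of the factor in front, 2 comes from squaring the chain rule, d + 1 from the columns and
  \<open>smax\<close> from the permittivity. It is the value at \<phi> = 0 that bounds the
  electrostatic energy from below.\<close>

lemma J_zero_bound:
  assumes dv: "defl H L u v w" and A3: "A3 H L d m\<^sub>1 m\<^sub>2 m\<^sub>3 h\<^sub>1 h\<^sub>2" and m: "m\<^sub>1 > 0" "m\<^sub>2 > 0" "m\<^sub>3 > 0"
  shows "J u v (\<lambda>x. 0) \<le> 2 * (d + 1) * smax * (2 * L * m\<^sub>1 + m\<^sub>2 * nsq (lebesgue_on (D L)) u + m\<^sub>3 * nsq (lebesgue_on (D L)) v)"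
proof -
  note a = deflD[OF dv]
  define K where "K x = 2 * smax * (m\<^sub>1 + m\<^sub>2 * (u x)\<^sup>2 + m\<^sub>3 * (v x)\<^sup>2)" for x
  let ?M = "lebesgue_on (D L)" and ?f = "\<lambda>p. sig p * (norm (gradh u v p))\<^sup>2"
  have c: "continuous_on (D L) u" "continuous_on (D L) v"
    by (rule continuous_on_subset[OF a(10) D_basic(4)], rule continuous_on_subset[OF a(1) D_basic(4)])
  have Kc: "continuous_on (D L) K" unfolding K_def using c by (intro continuous_intros)
  have K0: "K x \<ge> 0" for x unfolding K_def using smax_pos m by (intro mult_nonneg_nonneg add_nonneg_nonneg) auto
  have gm: "?f \<in> borel_measurable (lebesgue_on (Om u))"
  proof -
    note [measurable] = gradh_measurable[OF dv] sigma_measurable[OF dv]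
    show ?thesis by measurable
  qed
  have Os: "Om u \<in> sets lebesgue" using defl_Om[OF dv] by (simp add: fmeasurableD)
  have Kint: "integrable ?M K" "(LINT x|?M. K x) = 2 * smax * (2 * L * m\<^sub>1 + m\<^sub>2 * nsq ?M u + m\<^sub>3 * nsq ?M v)"
  proof -
    interpret finite_measure ?M by (rule finite_measure_lebesgue_on[OF D_basic(3)])
    have i: "integrable ?M (\<lambda>x. (u x)\<^sup>2)" "integrable ?M (\<lambda>x. (v x)\<^sup>2)" "integrable ?M (\<lambda>x. m\<^sub>1)"
      using a(11,12) by (auto simp: sqint_def)
    have "measure ?M (D L) = 2 * L" using L D_basic(2,5)[of L] by (simp add: measure_restrict_space)
    then have m1: "(LINT x|?M. m\<^sub>1) = 2 * L * m\<^sub>1" by simp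
    show "integrable ?M K" unfolding K_def using i by simp
    show "(LINT x|?M. K x) = 2 * smax * (2 * L * m\<^sub>1 + m\<^sub>2 * nsq ?M u + m\<^sub>3 * nsq ?M v)"
      unfolding K_def using i m1 by simp
  qed
  have "(\<integral>\<^sup>+p. ennreal (?f p) \<partial>lebesgue_on (Om u)) = (\<integral>\<^sup>+p. ennreal (?f p) * indicator (Om u) p \<partial>lebesgue)"
    using Os by (simp add: nn_integral_restrict_space)
  also have "\<dots> \<le> (\<integral>\<^sup>+p. ennreal (indicator (Om u) p * (K (fst p) * (if snd p \<le> -H then 1 else 1 / (H + u (fst p))))) \<partial>lebesgue)"
  proof (rule nn_integral_mono)
    fix p :: "real \<times> real"
    show "ennreal (?f p) * indicator (Om u) p \<le> ennreal (indicator (Om u) p * (K (fst p) * (if snd p \<le> -H then 1 else 1 / (H + u (fst p)))))"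
    proof (cases "p \<in> Om u")
      case True
      obtain x z where p: "p = (x, z)" by (cases p)
      have "?f p \<le> smax * (2 * (m\<^sub>1 + m\<^sub>2 * (u x)\<^sup>2 + m\<^sub>3 * (v x)\<^sup>2) * (if z \<le> -H then 1 else 1 / (H + u x)))"
        unfolding p using grad_bound[OF dv A3 m, of x z] True p smax_pos
        by (intro mult_mono sigma_upper) auto
      also have "\<dots> = K (fst p) * (if snd p \<le> -H then 1 else 1 / (H + u (fst p)))" by (simp add: K_def p)
      finally show ?thesis using True by (simp add: ennreal_leI)
    qed simp
  qed
  also have "\<dots> \<le> ennreal (d + 1) * (\<integral>\<^sup>+x. ennreal (indicator (D L) x * K x) \<partial>lborel)"
    by (rule nn_integral_columns[OF c(1) a(7) Kc K0])
  also have "(\<integral>\<^sup>+x. ennreal (indicator (D L) x * K x) \<partial>lborel) = ennreal (LINT x|?M. K x)"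
  proof -
    have bm: "(\<lambda>x. indicator (D L) x *\<^sub>R K x) \<in> borel_measurable borel"
      by (rule borel_measurable_continuous_on_indicator[OF _ Kc]) (simp add: borel_open D_basic(1))
    have "(\<integral>\<^sup>+x. ennreal (indicator (D L) x * K x) \<partial>lborel) = (\<integral>\<^sup>+x. ennreal (indicator (D L) x * K x) \<partial>lebesgue)"
      using bm by (intro nn_integral_completion[symmetric])
    also have "\<dots> = (\<integral>\<^sup>+x. ennreal (K x) \<partial>?M)"
      using D_basic(2) by (subst nn_integral_restrict_space) (auto intro!: nn_integral_cong simp: indicator_def)
    also have "\<dots> = ennreal (LINT x|?M. K x)" using Kint(1) K0 by (intro nn_integral_eq_integral) auto
    finally show ?thesis .
  qed
  also have "ennreal (d + 1) * ennreal (LINT x|?M. K x) = ennreal ((d + 1) * (LINT x|?M. K x))"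
    using d K0 by (intro ennreal_mult[symmetric]) (auto intro: integral_nonneg_AE)
  finally have le: "(\<integral>\<^sup>+p. ennreal (?f p) \<partial>lebesgue_on (Om u)) \<le> ennreal ((d + 1) * (LINT x|?M. K x))" .
  have "J u v (\<lambda>x. 0) = enn2real (\<integral>\<^sup>+p. ennreal (?f p) \<partial>lebesgue_on (Om u))"
    unfolding J_def tgrad_zero add_0_right using gm sig_nonneg by (intro integral_eq_nn_integral) auto
  also have "\<dots> \<le> enn2real (ennreal ((d + 1) * (LINT x|?M. K x)))" using le by (rule enn2real_mono) simp
  also have "\<dots> = (d + 1) * (LINT x|?M. K x)" using d K0 by (intro enn2real_ennreal mult_nonneg_nonneg integral_nonneg_AE) auto
  finally have "J u v (\<lambda>x. 0) \<le> (d + 1) * (2 * smax * (2 * L * m\<^sub>1 + m\<^sub>2 * nsq ?M u + m\<^sub>3 * nsq ?M v))"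
    unfolding Kint(2) .
  then show ?thesis by (simp only: mult_ac)
qed

section \<open>Continuity of the Dirichlet integral in the deflection\<close>

lemma graph_negligible:
  assumes "defl H L u v w"
  shows "negligible ((\<lambda>x. (x, u x)) ` {-L..L})"
proof (rule negligible_differentiable_image_lowdim)
  have "((\<lambda>x. (x, u x)) has_derivative (\<lambda>h. (h, v t * h))) (at t within {-L..L})" if "t \<in> {-L..L}" for t
    using deflD(2)[OF assms that] by (intro has_derivative_Pair has_derivative_ident) (simp add: has_field_derivative_def)
  then show "(\<lambda>x. (x, u x)) differentiable_on {-L..L}"
    unfolding differentiable_on_def differentiable_def by blast
qed simp

text \<open>The domains vary, but extended by zero all integrands live in one fixed box under a
  common constant bound. Off the graph of u a point is eventually either inside or outside all the
  domains, so the integrands converge almost everywhere; inside, convergence of u and v at the given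
  x is all that the explicit gradient requires.\<close>

lemma J_tendsto:
  assumes dv: "defl H L u v w" and dvn: "\<And>n. defl H L (un n) (vn n) (wn n)"
    and unif: "\<And>e. e > 0 \<Longrightarrow> \<forall>\<^sub>F n in sequentially. \<forall>x\<in>{-L..L}. \<bar>un n x - u x\<bar> < e"
    and pt: "\<And>x. x \<in> {-L..L} \<Longrightarrow> (\<lambda>n. vn n x) \<longlonglongrightarrow> v x"
    and R: "\<And>n x. x \<in> {-L..L} \<Longrightarrow> \<bar>un n x\<bar> \<le> R" "\<And>n x. x \<in> {-L..L} \<Longrightarrow> \<bar>vn n x\<bar> \<le> R"
    and \<phi>: "\<phi> \<in> test_functions (Om u)"
  shows "\<forall>\<^sub>F n in sequentially. \<phi> \<in> test_functions (Om (un n))"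
    "(\<lambda>n. J (un n) (vn n) \<phi>) \<longlonglongrightarrow> J u v \<phi>"
proof -
  note a = deflD[OF dv] and an = deflD[OF dvn]
  have ut: "(\<lambda>n. un n x) \<longlonglongrightarrow> u x" if "x \<in> {-L..L}" for x
  proof (rule LIMSEQ_I)
    fix r :: real assume "r > 0"
    then obtain N where "\<forall>n\<ge>N. \<forall>x\<in>{-L..L}. \<bar>un n x - u x\<bar> < r"
      using unif[of r] by (auto simp: eventually_sequentially)
    then show "\<exists>no. \<forall>n\<ge>no. norm (un n x - u x) < r" using that by (intro exI[of _ N]) auto
  qed
  obtain K where K: "compact K" "K \<subseteq> Om u" "\<And>x. x \<notin> K \<Longrightarrow> \<phi> x = 0" using test_functionsE[OF \<phi>] by metis
  show "\<forall>\<^sub>F n in sequentially. \<phi> \<in> test_functions (Om (un n))"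
  proof (cases "K = {}")
    case True
    then show ?thesis using K test_functions_Ck[OF \<phi>]
      by (intro always_eventually allI test_functionsI[of _ "{}"]) auto
  next
    case False
    have "fst p \<in> {-L..L}" if "p \<in> K" for p
      using subsetD[OF K(2) that] by (cases p) (simp add: Om_mem D_mem)
    then have "fst ` K \<subseteq> {-L..L}" by (rule image_subsetI)
    then have "continuous_on K (\<lambda>p. u (fst p))"
      by (rule continuous_on_compose2[OF a(10) continuous_on_fst[OF continuous_on_id]])
    then have "continuous_on K (\<lambda>p. u (fst p) - snd p)"
      by (intro continuous_on_diff continuous_on_snd continuous_on_id)
    \<comment> \<open>The least vertical distance from the support of \<phi> to the graph of u.
      Deflections uniformly closer to u than this still lie above the support.\<close>
    from continuous_attains_inf[OF K(1) False this]
    obtain q where q: "q \<in> K" "\<And>p. p \<in> K \<Longrightarrow> u (fst q) - snd q \<le> u (fst p) - snd p" by blast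
    have pos: "u (fst q) - snd q > 0" using subsetD[OF K(2) q(1)] by (cases q) (simp add: Om_mem)
    show ?thesis using unif[OF pos]
    proof eventually_elim
      case (elim n)
      have "K \<subseteq> Om (un n)"
      proof
        fix p assume p: "p \<in> K"
        obtain x z where xz: "p = (x, z)" by (cases p)
        have m: "x \<in> D L" "-H-d < z" using subsetD[OF K(2) p] xz by (auto simp: Om_mem)
        then have "\<bar>un n x - u x\<bar> < u x - z" using elim q(2)[OF p] xz D_basic(4)[of L] by force
        then show "p \<in> Om (un n)" using m xz by (auto simp: Om_mem)
      qed
      then show ?case using K test_functions_Ck[OF \<phi>] by (intro test_functionsI[of _ K]) auto
    qed
  qed
  define f where "f n p = indicator (Om (un n)) p * (sig p * (norm (gradh (un n) (vn n) p + tgrad \<phi> p))\<^sup>2)" for n p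
  define g where "g p = indicator (Om u) p * (sig p * (norm (gradh u v p + tgrad \<phi> p))\<^sup>2)" for p
  have t\<phi>: "tgrad \<phi> \<in> borel_measurable lebesgue"
    unfolding tgrad_def using test_functions_differentiable(4)[OF \<phi>]
    by (intro borel_measurable_sum borel_measurable_scaleR borel_measurable_const)
       (simp add: borel_measurable_continuous_onI measurable_completion)
  have meas: "(\<lambda>p. indicator (Om u') p * (sig p * (norm (gradh u' v' p + tgrad \<phi> p))\<^sup>2)) \<in> borel_measurable lebesgue"
    and JI: "J u' v' \<phi> = (LINT p|lebesgue. indicator (Om u') p * (sig p * (norm (gradh u' v' p + tgrad \<phi> p))\<^sup>2))"
    if dv': "defl H L u' v' w'" for u' v' w'
  proof -
    have Os: "Om u' \<in> sets lebesgue" using defl_Om[OF dv'] by (simp add: fmeasurableD)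
    have t: "tgrad \<phi> \<in> borel_measurable (lebesgue_on (Om u'))" using t\<phi> by (rule measurable_restrict_space1)
    note [measurable] = gradh_measurable[OF dv'] sigma_measurable[OF dv'] t
    have "(\<lambda>p. sig p * (norm (gradh u' v' p + tgrad \<phi> p))\<^sup>2) \<in> borel_measurable (lebesgue_on (Om u'))"
      by measurable
    then show "(\<lambda>p. indicator (Om u') p * (sig p * (norm (gradh u' v' p + tgrad \<phi> p))\<^sup>2)) \<in> borel_measurable lebesgue"
      by (subst (asm) borel_measurable_restrict_space_iff) (use Os in auto)
    show "J u' v' \<phi> = (LINT p|lebesgue. indicator (Om u') p * (sig p * (norm (gradh u' v' p + tgrad \<phi> p))\<^sup>2))"
      unfolding J_def by (rule lebesgue_on_integrable_iff(2)[OF Os])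
  qed
  obtain B where B: "B \<ge> 0" "\<And>u v x z. \<lbrakk>(x, z) \<in> Om u; u x \<ge> -H; u x \<le> R; \<bar>v x\<bar> \<le> R\<rbrakk> \<Longrightarrow>
     \<bar>h_of H h\<^sub>1 h\<^sub>2 u (x, z)\<bar> \<le> B \<and> \<bar>fst (gradh u v (x, z))\<bar> \<le> B \<and> \<bar>snd (gradh u v (x, z))\<bar> \<le> B" using h_gradh_bounds by metis
  obtain B' where B': "B' \<ge> 0" "\<And>x b. b \<in> Basis \<Longrightarrow> \<bar>pd UNIV b \<phi> x\<bar> \<le> B'"
    using test_functions_bounded[OF \<phi>] by metis
  have tb: "norm (tgrad \<phi> p) \<le> 2 * B'" for p
  proof -
    have "norm (tgrad \<phi> p) \<le> (\<Sum>b\<in>Basis. \<bar>tgrad \<phi> p \<bullet> b\<bar>)" by (rule norm_le_l1)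
    also have "\<dots> \<le> (\<Sum>b\<in>(Basis::(real \<times> real) set). B')" using B' by (intro sum_mono) simp
    finally show ?thesis by simp
  qed
  \<comment> \<open>Contains every domain of the sequence, because R bounds all the
    deflections.\<close>
  define Box where "Box = {-L..L} \<times> {-H-d..R}"
  define Cst where "Cst = smax * (2 * B + 2 * B')\<^sup>2"
  have dom: "norm (f n p) \<le> indicator Box p * Cst" for n p
  proof (cases "p \<in> Om (un n)")
    case True
    obtain x z where p: "p = (x, z)" by (cases p)
    have x: "x \<in> D L" "x \<in> {-L..L}" "-H-d < z" "z < un n x" using True p by (auto simp: Om_mem D_mem)
    have le: "un n x \<le> R" using R(1)[OF x(2), of n] by simp
    have in_box: "p \<in> Box" using x le p by (auto simp: Box_def)
    have gb: "\<bar>fst (gradh (un n) (vn n) p)\<bar> \<le> B" "\<bar>snd (gradh (un n) (vn n) p)\<bar> \<le> B"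
      using B(2)[where u="un n" and v="vn n" and x=x and z=z] True p le an(7)[OF x(1)] R(2)[OF x(2)] by auto
    have "norm (gradh (un n) (vn n) p) \<le> \<bar>fst (gradh (un n) (vn n) p)\<bar> + \<bar>snd (gradh (un n) (vn n) p)\<bar>"
      using norm_Pair_le[of "fst (gradh (un n) (vn n) p)" "snd (gradh (un n) (vn n) p)"] by simp
    then have "norm (gradh (un n) (vn n) p + tgrad \<phi> p) \<le> 2 * B + 2 * B'"
      using norm_triangle_ineq[of "gradh (un n) (vn n) p" "tgrad \<phi> p"] tb[of p] gb by linarith
    then have "(norm (gradh (un n) (vn n) p + tgrad \<phi> p))\<^sup>2 \<le> (2 * B + 2 * B')\<^sup>2" by (intro power_mono) auto
    then have "sig p * (norm (gradh (un n) (vn n) p + tgrad \<phi> p))\<^sup>2 \<le> Cst"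
      unfolding Cst_def using smax_pos by (intro mult_mono sigma_upper) auto
    then show ?thesis using True in_box sig_nonneg[of p] by (simp add: f_def abs_mult)
  next
    case False
    then show ?thesis using smax_pos by (auto simp: f_def Cst_def indicator_def)
  qed
  have wI: "integrable lebesgue (\<lambda>p. indicator Box p * Cst)"
  proof -
    have "compact Box" unfolding Box_def by (intro compact_Times compact_Icc)
    then have "Box \<in> lmeasurable" by (rule lmeasurable_compact)
    then show ?thesis by (intro integrable_mult_left) (auto simp: fmeasurable_def intro!: integrable_real_indicator)
  qed
  have lim: "(\<lambda>n. f n p) \<longlonglongrightarrow> g p" if np: "p \<notin> {p. snd p = -H}" "p \<notin> (\<lambda>x. (x, u x)) ` {-L..L}" for p
  proof -
    obtain x z where p: "p = (x, z)" by (cases p)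
    show ?thesis
    proof (cases "x \<in> D L \<and> -H-d < z")
      case False
      then have "p \<notin> Om (un n)" "p \<notin> Om u" for n using p by (auto simp: Om_mem)
      then show ?thesis by (simp add: f_def g_def)
    next
      case True
      then have x: "x \<in> D L" "x \<in> {-L..L}" by (auto simp: D_mem)
      have "z \<noteq> u x" using np(2) p x by auto
      then consider "z < u x" | "z > u x" by linarith
      then show ?thesis
      proof cases
        case 1
        have ev: "\<forall>\<^sub>F n in sequentially. z < un n x" using order_tendstoD(1)[OF ut[OF x(2)] 1] .
        have tr: "(\<lambda>n. (x, z, un n x)) \<longlonglongrightarrow> (x, z, u x)" by (intro tendsto_intros ut x)
        have uH: "u x \<ge> -H" "un n x \<ge> -H" for n using a(7) an(7) x by auto
        have "(\<lambda>n. gradh (un n) (vn n) p) \<longlonglongrightarrow> gradh u v p"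
        proof (cases "z \<le> -H")
          case zH: True
          have S: "(x, z, u x) \<in> S1" "\<And>n. (x, z, un n x) \<in> S1" using x uH True zH by (auto intro!: in_S1)
          have kt: "(\<lambda>n. k (x, z, un n x)) \<longlonglongrightarrow> k (x, z, u x)" if "continuous_on S1 k" for k :: "real \<times> real \<times> real \<Rightarrow> real"
            by (rule continuous_on_tendsto_compose[OF that tr S(1)]) (use S(2) in auto)
          have "(\<lambda>n. (d_x S1 h\<^sub>1 (x, z, un n x) + vn n x * d_w S1 h\<^sub>1 (x, z, un n x), d_z S1 h\<^sub>1 (x, z, un n x)))
            \<longlonglongrightarrow> (d_x S1 h\<^sub>1 (x, z, u x) + v x * d_w S1 h\<^sub>1 (x, z, u x), d_z S1 h\<^sub>1 (x, z, u x))"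
            by (intro tendsto_intros pt x kt h1[OF C2(1)])
          then show ?thesis using zH p by (simp add: gradh_def)
        next
          case zH: False
          have S: "(x, z, u x) \<in> S2" "\<And>n. (x, z, un n x) \<in> S2" using x uH True zH by (auto intro!: in_S2)
          have kt: "(\<lambda>n. k (x, z, un n x)) \<longlonglongrightarrow> k (x, z, u x)" if "continuous_on S2 k" for k :: "real \<times> real \<times> real \<Rightarrow> real"
            by (rule continuous_on_tendsto_compose[OF that tr S(1)]) (use S(2) in auto)
          have "(\<lambda>n. (d_x S2 h\<^sub>2 (x, z, un n x) + vn n x * d_w S2 h\<^sub>2 (x, z, un n x), d_z S2 h\<^sub>2 (x, z, un n x)))
            \<longlonglongrightarrow> (d_x S2 h\<^sub>2 (x, z, u x) + v x * d_w S2 h\<^sub>2 (x, z, u x), d_z S2 h\<^sub>2 (x, z, u x))"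
            by (intro tendsto_intros pt x kt h2[OF C2(2)])
          then show ?thesis using zH p by (simp add: gradh_def)
        qed
        then have "(\<lambda>n. sig p * (norm (gradh (un n) (vn n) p + tgrad \<phi> p))\<^sup>2) \<longlonglongrightarrow> sig p * (norm (gradh u v p + tgrad \<phi> p))\<^sup>2"
          by (intro tendsto_intros)
        moreover have "\<forall>\<^sub>F n in sequentially. sig p * (norm (gradh (un n) (vn n) p + tgrad \<phi> p))\<^sup>2 = f n p"
          using ev by eventually_elim (use True p in \<open>simp add: f_def Om_mem\<close>)
        ultimately have "(\<lambda>n. f n p) \<longlonglongrightarrow> sig p * (norm (gradh u v p + tgrad \<phi> p))\<^sup>2" by (rule Lim_transform_eventually)
        then show ?thesis using True 1 p by (simp add: g_def Om_mem)
      next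
        case 2
        have ev: "\<forall>\<^sub>F n in sequentially. un n x < z" using order_tendstoD(2)[OF ut[OF x(2)] 2] .
        have "\<forall>\<^sub>F n in sequentially. 0 = f n p"
          using ev by eventually_elim (use p in \<open>simp add: f_def Om_mem\<close>)
        then have "(\<lambda>n. f n p) \<longlonglongrightarrow> 0" by (rule Lim_transform_eventually[OF tendsto_const])
        then show ?thesis using 2 p by (simp add: g_def Om_mem)
      qed
    qed
  qed
  have "(\<lambda>n. LINT p|lebesgue. f n p) \<longlonglongrightarrow> (LINT p|lebesgue. g p)"
  proof (rule integral_dominated_convergence[OF _ _ wI])
    show "g \<in> borel_measurable lebesgue" unfolding g_def by (rule meas[OF dv])
    show "f n \<in> borel_measurable lebesgue" for n unfolding f_def by (rule meas[OF dvn])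
    show "AE p in lebesgue. (\<lambda>n. f n p) \<longlonglongrightarrow> g p"
      using AE_lebesgue_notin[OF negligible_snd[of "-H"]] AE_lebesgue_notin[OF graph_negligible[OF dv]]
      by eventually_elim (rule lim)
    show "AE p in lebesgue. norm (f n p) \<le> indicator Box p * Cst" for n by (intro AE_I2 dom)
  qed
  then show "(\<lambda>n. J (un n) (vn n) \<phi>) \<longlonglongrightarrow> J u v \<phi>" unfolding f_def g_def JI[OF dv] JI[OF dvn] .
qed

end

section \<open>Existence of a minimizer\<close>

text \<open>The limit is defined as the primitive of the uniform limit v of the slopes, so it is
  automatically C^1. What remains is a second derivative of v whose norm does not exceed the limit
  of the norms, the usual gain from weak lower semicontinuity.\<close>

lemma defl_limit:
  assumes L: "L > 0" and dv: "\<And>n. defl H L (un n) (vn n) (wn n)"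
    and v: "continuous_on {-L..L} v"
    and lim: "\<And>e. e > 0 \<Longrightarrow> \<exists>N. \<forall>n x. n \<ge> N \<and> x \<in> {-L..L} \<longrightarrow> \<bar>vn n x - v x\<bar> < e"
    and lam: "(\<lambda>n. nsq (lebesgue_on (D L)) (wn n)) \<longlonglongrightarrow> \<mu>"
  defines "u \<equiv> \<lambda>x. integral {-L..x} v"
  shows "\<And>e. e > 0 \<Longrightarrow> \<forall>\<^sub>F n in sequentially. \<forall>x\<in>{-L..L}. \<bar>un n x - u x\<bar> < e"
    and "\<exists>w. defl H L u v w \<and> nsq (lebesgue_on (D L)) w \<le> \<mu>"
proof -
  let ?M = "lebesgue_on (D L)"
  note an = deflD[OF dv]
  show unif: "\<forall>\<^sub>F n in sequentially. \<forall>x\<in>{-L..L}. \<bar>un n x - u x\<bar> < e" if e: "e > 0" for e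
  proof -
    have e': "e / (2 * L + 1) > 0" using e L by simp
    obtain N where N: "\<And>n x. n \<ge> N \<Longrightarrow> x \<in> {-L..L} \<Longrightarrow> \<bar>vn n x - v x\<bar> < e / (2 * L + 1)" using lim[OF e'] by metis
    have "\<bar>un n x - u x\<bar> < e" if n: "n \<ge> N" and x: "x \<in> {-L..L}" for n x
    proof -
      have sub: "{-L..x} \<subseteq> {-L..L}" using x by auto
      have un: "(vn n has_integral (un n x - un n (-L))) {-L..x}"
      proof (rule fundamental_theorem_of_calculus)
        show "- L \<le> x" using x by simp
        show "(un n has_vector_derivative vn n t) (at t within {-L..x})" if "t \<in> {-L..x}" for t
          using an(2)[of t n] that sub has_field_derivative_subset[OF _ sub]
          by (auto simp: has_real_derivative_iff_has_vector_derivative[symmetric] subset_iff)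
      qed
      have vi: "v integrable_on {-L..x}" using v sub by (intro integrable_continuous_real) (rule continuous_on_subset)
      have "un n x - u x = integral {-L..x} (\<lambda>t. vn n t - v t)"
        using un vi an(3)[of n] by (simp add: Henstock_Kurzweil_Integration.integral_diff has_integral_integrable integral_unique u_def)
      moreover have "norm (integral {-L..x} (\<lambda>t. vn n t - v t)) \<le> integral {-L..x} (\<lambda>t. e / (2 * L + 1))"
      proof (rule integral_norm_bound_integral)
        show "(\<lambda>t. vn n t - v t) integrable_on {-L..x}" using un vi by (intro integrable_diff) blast+
        show "norm (vn n t - v t) \<le> e / (2 * L + 1)" if "t \<in> {-L..x}" for t using N[OF n, of t] that sub by fastforce
      qed (rule integrable_const_ivl)
      ultimately have "\<bar>un n x - u x\<bar> \<le> (x + L) * (e / (2 * L + 1))" using x by simp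
      also have "\<dots> < (2 * L + 1) * (e / (2 * L + 1))" using x e' by (intro mult_strict_right_mono) auto
      also have "\<dots> = e" using L by simp
      finally show ?thesis .
    qed
    then show ?thesis unfolding eventually_sequentially by blast
  qed
  have ut: "(\<lambda>n. un n x) \<longlonglongrightarrow> u x" if x: "x \<in> {-L..L}" for x
  proof (rule LIMSEQ_I)
    fix r :: real assume "r > 0"
    then obtain N where "\<forall>n\<ge>N. \<forall>x\<in>{-L..L}. \<bar>un n x - u x\<bar> < r"
      using unif[of r] by (auto simp: eventually_sequentially)
    then show "\<exists>no. \<forall>n\<ge>no. norm (un n x - u x) < r" using x by (intro exI[of _ N]) auto
  qed
  have vt: "(\<lambda>n. vn n x) \<longlonglongrightarrow> v x" if x: "x \<in> {-L..L}" for x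
  proof (rule LIMSEQ_I)
    fix r :: real assume "r > 0"
    then obtain N where "\<forall>n x. n \<ge> N \<and> x \<in> {-L..L} \<longrightarrow> \<bar>vn n x - v x\<bar> < r" using lim by metis
    then show "\<exists>no. \<forall>n\<ge>no. norm (vn n x - v x) < r" using x by (intro exI[of _ N]) auto
  qed
  have pm: "-L \<in> {-L..L}" "L \<in> {-L..L}" using L by auto
  have z: "u (-L) = 0" "u L = 0" "v (-L) = 0" "v L = 0"
    using LIMSEQ_unique[OF ut[OF pm(1)]] LIMSEQ_unique[OF ut[OF pm(2)]] LIMSEQ_unique[OF vt[OF pm(1)]] LIMSEQ_unique[OF vt[OF pm(2)]]
    by (auto simp: an(3-6))
  have ge: "u x \<ge> -H" if "x \<in> D L" for x
  proof (rule LIMSEQ_le_const[OF ut])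
    show "x \<in> {-L..L}" using that D_basic(4)[of L] by blast
    show "\<exists>N. \<forall>n\<ge>N. -H \<le> un n x" using an(7)[OF that] by blast
  qed
  have ud: "(u has_real_derivative v t) (at t within {-L..L})" if "t \<in> {-L..L}" for t
    unfolding u_def using integral_has_real_derivative[OF v that] .
  \<comment> \<open>Second derivatives of deflections whose slope is uniformly close to v. These
    sets decrease, are stable under midpoints by convexity, and force v as the limit of the
    slopes.\<close>
  define P where "P j f \<longleftrightarrow> (\<exists>u' v'. defl H L u' v' f \<and> (\<forall>x\<in>{-L..L}. \<bar>v' x - v x\<bar> \<le> 1 / (real j + 1)))" for j f
  \<comment> \<open>Since \<mu> is only a limit, the norms of the sequence are eventually below
    \<mu> + \<delta>, and each \<delta> yields its own w.\<close>
  have ex: "\<exists>w. defl H L u v w \<and> nsq ?M w \<le> \<mu> + \<delta>" if \<delta>: "\<delta> > 0" for \<delta>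
  proof -
    have anti: "P j f" if "P (Suc j) f" for j f
    proof -
      have "1 / (real (Suc j) + 1) \<le> 1 / (real j + 1)" by (simp add: field_simps)
      then show ?thesis using that unfolding P_def by (meson order_trans)
    qed
    have sq: "sqint ?M f" if "P j f" for j f using that deflD(8) unfolding P_def by blast
    have mid: "P j (\<lambda>x. (1/2) *\<^sub>R (f x + g x))" if f: "P j f" and g: "P j g" for j f g
    proof -
      obtain u1 v1 where 1: "defl H L u1 v1 f" "\<forall>x\<in>{-L..L}. \<bar>v1 x - v x\<bar> \<le> 1 / (real j + 1)" using f unfolding P_def by blast
      obtain u2 v2 where 2: "defl H L u2 v2 g" "\<forall>x\<in>{-L..L}. \<bar>v2 x - v x\<bar> \<le> 1 / (real j + 1)" using g unfolding P_def by blast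
      have "\<bar>(v1 x + v2 x) / 2 - v x\<bar> \<le> 1 / (real j + 1)" if "x \<in> {-L..L}" for x
      proof -
        have "\<bar>(p + q) / 2 - r\<bar> \<le> s" if "\<bar>p - r\<bar> \<le> s" "\<bar>q - r\<bar> \<le> s" for p q r s :: real
          using that by (simp add: abs_le_iff field_simps)
        then show ?thesis using 1(2) 2(2) that by blast
      qed
      then show ?thesis unfolding P_def using defl_midpoint[OF 1(1) 2(1)] by blast
    qed
    have bd: "\<exists>f. P j f \<and> nsq ?M f \<le> \<mu> + \<delta>" for j
    proof -
      have j: "1 / (real j + 1) > 0" by simp
      obtain N1 where N1: "\<And>n x. n \<ge> N1 \<Longrightarrow> x \<in> {-L..L} \<Longrightarrow> \<bar>vn n x - v x\<bar> < 1 / (real j + 1)" using lim[OF j] by metis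
      obtain N2 where N2: "\<And>n. n \<ge> N2 \<Longrightarrow> nsq ?M (wn n) < \<mu> + \<delta>"
        using order_tendstoD(2)[OF lam, of "\<mu> + \<delta>"] \<delta> by (auto simp: eventually_sequentially)
      have "P j (wn (max N1 N2))" unfolding P_def using dv N1[of "max N1 N2"] less_imp_le max.cobounded1 by blast
      then show ?thesis using N2[of "max N1 N2"] by (intro exI[of _ "wn (max N1 N2)"]) auto
    qed
    show ?thesis
    proof (rule midpoint_minimizer[of P ?M, OF anti sq mid bd])
      fix f w assume f: "\<And>k. P k (f k)" and w: "sqint ?M w" "(\<lambda>k. nsq ?M (\<lambda>x. f k x - w x)) \<longlonglongrightarrow> 0" "nsq ?M w \<le> \<mu> + \<delta>"
      obtain u' v' where uv: "\<And>k. defl H L (u' k) (v' k) (f k)" "\<And>k x. x \<in> {-L..L} \<Longrightarrow> \<bar>v' k x - v x\<bar> \<le> 1 / (real k + 1)"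
        using f unfolding P_def by metis
      note a' = deflD[OF uv(1)]
      have "has_weak_pderiv (D L) 1 v w"
      proof (rule has_weak_pderiv_L2_limit[OF D_basic(1) _ a'(9) a'(12) a'(8) _ w(1) _ w(2)])
        show "sqint ?M v" by (rule continuous_interval_sqint[OF v])
        show "(\<lambda>n. nsq ?M (\<lambda>x. v' n x - v x)) \<longlonglongrightarrow> 0"
        proof (rule Lim_null_comparison)
          have "norm (nsq ?M (\<lambda>x. v' n x - v x)) \<le> 2 * L * (1 / (real n + 1))\<^sup>2" for n
          proof -
            have "nsq ?M (\<lambda>x. v' n x - v x) \<le> 2 * L * (1 / (real n + 1))\<^sup>2"
              using L uv(2) v a'(1) by (intro continuous_interval_nsq_le continuous_intros) auto
            then show ?thesis by simp
          qed
          then show "\<forall>\<^sub>F n in sequentially. norm (nsq ?M (\<lambda>x. v' n x - v x)) \<le> 2 * L * (1 / (real n + 1))\<^sup>2"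
            by (intro always_eventually) blast
          have "(\<lambda>n. 1 / (real n + 1)) \<longlonglongrightarrow> 0" using LIMSEQ_inverse_real_of_nat by (simp add: inverse_eq_divide add.commute)
          from tendsto_mult_right_zero[OF tendsto_null_power[OF this, of 2], of "2 * L"]
          show "(\<lambda>n. 2 * L * (1 / (real n + 1))\<^sup>2) \<longlonglongrightarrow> 0" by simp
        qed
      qed simp
      then have "defl H L u v w" unfolding defl_def using v ud z ge w(1) by auto
      with w(3) show ?thesis by blast
    qed
  qed
  obtain w where w: "defl H L u v w" using ex[of 1] by auto
  \<comment> \<open>The functions w obtained for different \<delta> are weak derivatives of the same
    v and have equal norms, so a single w satisfies every bound.\<close>
  have "nsq ?M w \<le> \<mu> + \<delta>" if \<delta>: "\<delta> > 0" for \<delta>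
  proof -
    obtain w' where w': "defl H L u v w'" "nsq ?M w' \<le> \<mu> + \<delta>" using ex[OF \<delta>] by auto
    note a = deflD[OF w] and a' = deflD[OF w'(1)]
    have "nsq ?M w = nsq ?M w'"
      by (rule sqint_cong_AE(2)[OF sqint_measurable[OF a(8)] a'(8) has_weak_pderiv_unique[OF D_basic(1) a(9) a'(9)]])
    with w'(2) show ?thesis by simp
  qed
  then have "nsq ?M w \<le> \<mu>" by (rule field_le_epsilon)
  with w show "\<exists>w. defl H L u v w \<and> nsq ?M w \<le> \<mu>" by blast
qed

text \<open>A bound on the bending energy makes the slopes uniformly bounded and equicontinuous
  through the Hoelder estimate. A further subsequence makes the bending energies themselves
  converge.\<close>

lemma defl_compactness:
  assumes L: "L > 0" and dv: "\<And>n::nat. defl H L (un n) (vn n) (wn n)" and B: "\<And>n. nsq (lebesgue_on (D L)) (wn n) \<le> B"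
  obtains k v \<mu> where "strict_mono (k::nat \<Rightarrow> nat)" "continuous_on {-L..L} v"
    "\<And>e. e > 0 \<Longrightarrow> \<exists>N. \<forall>n x. n \<ge> N \<and> x \<in> {-L..L} \<longrightarrow> \<bar>vn (k n) x - v x\<bar> < e"
    "(\<lambda>n. nsq (lebesgue_on (D L)) (wn (k n))) \<longlonglongrightarrow> \<mu>"
proof -
  let ?M = "lebesgue_on (D L)"
  have B0: "B \<ge> 0" using B[of 0] nsq_nonneg[of ?M "wn 0"] by linarith
  have hol: "(vn n y - vn n x)\<^sup>2 \<le> \<bar>y - x\<bar> * B" if "x \<in> {-L..L}" "y \<in> {-L..L}" for n x y
    using defl_bounds(1)[OF L dv that, of n] mult_left_mono[OF B[of n], of "\<bar>y - x\<bar>"] by linarith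
  have bound: "norm (vn n x) \<le> sqrt (2 * L * B)" if x: "x \<in> {-L..L}" for n x
  proof -
    have "(vn n x)\<^sup>2 \<le> 2 * L * B" using defl_bounds(2)[OF L dv x, of n] mult_left_mono[OF B[of n], of "2 * L"] L by linarith
    then show ?thesis by (simp add: real_le_rsqrt)
  qed
  have equi: "\<exists>d. 0 < d \<and> (\<forall>n y. y \<in> {-L..L} \<and> norm (x - y) < d \<longrightarrow> norm (vn n x - vn n y) < e)"
    if x: "x \<in> {-L..L}" and e: "0 < e" for x e
  proof (intro exI conjI allI impI)
    \<comment> \<open>The modulus comes from Hoelder continuity of exponent 1/2; the summand 1
      allows B = 0.\<close>
    show "0 < e\<^sup>2 / (B + 1)" using e B0 by simp
    fix n y assume y: "y \<in> {-L..L} \<and> norm (x - y) < e\<^sup>2 / (B + 1)"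
    have "(vn n x - vn n y)\<^sup>2 \<le> \<bar>x - y\<bar> * B" using hol[of y x n] x y by simp
    also have "\<dots> \<le> \<bar>x - y\<bar> * (B + 1)" by (intro mult_left_mono) auto
    also have "\<dots> < e\<^sup>2" using y B0 by (simp add: pos_less_divide_eq)
    finally have "\<bar>vn n x - vn n y\<bar>\<^sup>2 < e\<^sup>2" by simp
    then show "norm (vn n x - vn n y) < e" using e by (simp add: power2_less_imp_less)
  qed
  obtain v k where v: "continuous_on {-L..L} v" and k: "strict_mono (k :: nat \<Rightarrow> nat)"
    and lim: "\<And>e. 0 < e \<Longrightarrow> \<exists>N. \<forall>n x. n \<ge> N \<and> x \<in> {-L..L} \<longrightarrow> norm (vn (k n) x - v x) < e"
  proof (rule Arzela_Ascoli[OF compact_Icc[of "-L" L] bound equi])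
    fix g and k :: "nat \<Rightarrow> nat"
    assume l: "continuous_on {-L..L} g" "strict_mono k"
      "\<And>e. 0 < e \<Longrightarrow> \<exists>N. \<forall>n x. n \<ge> N \<and> x \<in> {-L..L} \<longrightarrow> norm (vn (k n) x - g x) < e"
    show thesis by (rule that[OF l])
  qed
  have "bounded (range (\<lambda>n. nsq ?M (wn (k n))))"
  proof -
    have "norm (nsq ?M (wn (k n))) \<le> B" for n using B[of "k n"] nsq_nonneg[of ?M "wn (k n)"] by simp
    then show ?thesis unfolding bounded_iff by blast
  qed
  then obtain \<mu> r where r: "strict_mono (r :: nat \<Rightarrow> nat)" "((\<lambda>n. nsq ?M (wn (k n))) \<circ> r) \<longlonglongrightarrow> \<mu>"
    using bounded_imp_convergent_subsequence by blast
  show ?thesis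
  proof (rule that[of "k \<circ> r" v \<mu>])
    show "strict_mono (k \<circ> r)" using k r(1) by (rule strict_mono_o)
    show "continuous_on {-L..L} v" by (rule v)
    show "(\<lambda>n. nsq ?M (wn ((k \<circ> r) n))) \<longlonglongrightarrow> \<mu>" using r(2) by (simp add: o_def)
    show "\<exists>N. \<forall>n x. n \<ge> N \<and> x \<in> {-L..L} \<longrightarrow> \<bar>vn ((k \<circ> r) n) x - v x\<bar> < e" if e0: "e > 0" for e
    proof -
      obtain N where N: "\<forall>n x. n \<ge> N \<and> x \<in> {-L..L} \<longrightarrow> norm (vn (k n) x - v x) < e" using lim[OF e0] by blast
      have "r n \<ge> N" if "n \<ge> N" for n using seq_suble[OF r(1), of n] that by linarith
      with N show ?thesis by (intro exI[of _ N]) auto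
    qed
  qed
qed

text \<open>X and Y stand for the squared norms of second and first derivative. If a > 0, the
  quartic term dominates the electrostatic term A/2 Y up to a constant, by completing the square. If
  a = 0, only the part of A beyond \<tau> is harmful, and Y \<le> 4L^2 X charges it to the bending
  energy, leaving half the positive constant.\<close>

lemma coercive_estimate:
  fixes \<beta> \<tau> a A L X Y E c :: real
  assumes "\<beta> > 0" "\<tau> \<ge> 0" "a \<ge> 0" "X \<ge> 0" "Y \<ge> 0" "Y \<le> 4 * L\<^sup>2 * X" and A: "A \<ge> 0"
    and max: "max a (\<beta> - 4 * L\<^sup>2 * max (A - \<tau>) 0) > 0"
    and E: "E \<ge> \<beta> / 2 * X + (\<tau> / 2 + a / 4 * Y) * Y - A / 2 * Y - c"
  shows "X * (if a > 0 then \<beta> / 2 else (\<beta> - 4 * L\<^sup>2 * max (A - \<tau>) 0) / 2) \<le> E + c + (if a > 0 then A\<^sup>2 / (4 * a) else 0)"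
proof (cases "a > 0")
  case True
  \<comment> \<open>A / a is the minimizer of a/4 Y^2 - A/2 Y.\<close>
  have "0 \<le> (a / 4) * (Y - A / a)\<^sup>2" using True by simp
  also have "\<dots> = a / 4 * Y * Y - A / 2 * Y + A\<^sup>2 / (4 * a)" using True by (simp add: power2_eq_square field_simps)
  finally have "A / 2 * Y - A\<^sup>2 / (4 * a) \<le> a / 4 * Y * Y" by simp
  moreover have "0 \<le> \<tau> / 2 * Y" using assms by simp
  ultimately show ?thesis using E True by (simp add: algebra_simps)
next
  case False
  then have a: "a = 0" using assms(3) by simp
  let ?m = "max (A - \<tau>) 0"
  have "(A - \<tau>) * Y \<le> ?m * Y" using assms(5) by (intro mult_right_mono) auto
  also have "\<dots> \<le> ?m * (4 * L\<^sup>2 * X)" using assms(6) by (intro mult_left_mono) auto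
  finally have "(A - \<tau>) * Y \<le> ?m * (4 * L\<^sup>2 * X)" .
  moreover have "X * ((\<beta> - 4 * L\<^sup>2 * ?m) / 2) = \<beta> / 2 * X - ?m * (4 * L\<^sup>2 * X) / 2" by (simp add: field_simps)
  moreover have "E \<ge> \<beta> / 2 * X - (A - \<tau>) * Y / 2 - c" using E a by (simp add: field_simps)
  ultimately have "X * ((\<beta> - 4 * L\<^sup>2 * ?m) / 2) \<le> E + c" by linarith
  then show ?thesis using a by simp
qed

section \<open>Coercivity, lower semicontinuity and the minimizer\<close>

context mems
begin

lemma energy_coercive:
  assumes A3: "A3 H L d m\<^sub>1 m\<^sub>2 m\<^sub>3 h\<^sub>1 h\<^sub>2" and m: "m\<^sub>1 > 0" "m\<^sub>2 > 0" "m\<^sub>3 > 0"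
    and \<beta>: "\<beta> > 0" "\<tau> \<ge> 0" "a \<ge> 0" and K: "max a (frak_K H L d \<beta> \<tau> \<sigma>\<^sub>1 \<sigma>\<^sub>2 m\<^sub>2 m\<^sub>3) > 0"
  obtains \<kappa> c where "\<kappa> > 0" "\<And>u v w. defl H L u v w \<Longrightarrow>
    \<kappa> * nsq (lebesgue_on (D L)) w \<le> total_energy H L d \<beta> \<tau> a \<sigma>\<^sub>1 \<sigma>\<^sub>2 h\<^sub>1 h\<^sub>2 u + c"
proof -
  \<comment> \<open>The coefficient that \<open>frak_K\<close> compares with \<tau>.\<close>
  define A where "A = (d + 1) * smax * (12 * m\<^sub>2 * L\<^sup>2 + 2 * m\<^sub>3)"
  define c where "c = (d + 1) * smax * (2 * L * m\<^sub>1)"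
  let ?M = "lebesgue_on (D L)"
  have ds: "(d + 1) * smax \<ge> 0" using d smax_pos by simp
  have A: "A \<ge> 0" unfolding A_def using ds m by simp
  have mx: "max a (\<beta> - 4 * L\<^sup>2 * max (A - \<tau>) 0) > 0" using K by (simp add: frak_K_def A_def)
  define \<kappa> where "\<kappa> = (if a > 0 then \<beta> / 2 else (\<beta> - 4 * L\<^sup>2 * max (A - \<tau>) 0) / 2)"
  have \<kappa>: "\<kappa> > 0" using mx \<beta> by (auto simp: \<kappa>_def less_max_iff_disj)
  show ?thesis
  proof (rule that[of \<kappa> "c + (if a > 0 then A\<^sup>2 / (4 * a) else 0)", OF \<kappa>])
    fix u v w assume dv: "defl H L u v w"
    let ?X = "nsq ?M w" and ?Y = "nsq ?M v"
    note b = defl_bounds[OF L dv]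
    have "- (1/2) * J u v (\<lambda>x. 0) \<le> E_e H L d \<sigma>\<^sub>1 \<sigma>\<^sub>2 h\<^sub>1 h\<^sub>2 u"
      by (rule E_e_variational(1)[OF dv zero_test_function(1)])
    moreover have "J u v (\<lambda>x. 0) \<le> 2 * (d + 1) * smax * (2 * L * m\<^sub>1 + m\<^sub>2 * nsq ?M u + m\<^sub>3 * ?Y)"
      by (rule J_zero_bound[OF dv A3 m])
    moreover have "2 * (d + 1) * smax * (2 * L * m\<^sub>1 + m\<^sub>2 * nsq ?M u + m\<^sub>3 * ?Y) \<le> 2 * c + A * ?Y"
    proof -
      \<comment> \<open>Poincare's inequality for u gives 4 L^2 here, enlarged to 6 L^2 to match
        half of the constant 12 in \<open>frak_K\<close>.\<close>
      have "m\<^sub>2 * nsq ?M u \<le> m\<^sub>2 * (4 * L\<^sup>2 * ?Y)" using b(5) m by (intro mult_left_mono) auto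
      also have "\<dots> \<le> 6 * m\<^sub>2 * L\<^sup>2 * ?Y" using m nsq_nonneg[of ?M v] by (simp add: mult_ac mult_right_mono)
      finally have "2 * (m\<^sub>2 * nsq ?M u + m\<^sub>3 * ?Y) \<le> (12 * m\<^sub>2 * L\<^sup>2 + 2 * m\<^sub>3) * ?Y" by (simp add: algebra_simps)
      from mult_left_mono[OF this ds] show ?thesis unfolding A_def c_def by (simp add: algebra_simps)
    qed
    ultimately have "E_e H L d \<sigma>\<^sub>1 \<sigma>\<^sub>2 h\<^sub>1 h\<^sub>2 u \<ge> - c - A / 2 * ?Y" by linarith
    then have "total_energy H L d \<beta> \<tau> a \<sigma>\<^sub>1 \<sigma>\<^sub>2 h\<^sub>1 h\<^sub>2 u \<ge> \<beta> / 2 * ?X + (\<tau> / 2 + a / 4 * ?Y) * ?Y - A / 2 * ?Y - c"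
      unfolding total_energy_def E_m_eq[OF dv] by linarith
    from coercive_estimate[OF \<beta> nsq_nonneg nsq_nonneg b(3) A mx this]
    show "\<kappa> * ?X \<le> total_energy H L d \<beta> \<tau> a \<sigma>\<^sub>1 \<sigma>\<^sub>2 h\<^sub>1 h\<^sub>2 u + (c + (if a > 0 then A\<^sup>2 / (4 * a) else 0))"
      by (simp add: \<kappa>_def mult.commute add.assoc)
  qed
qed

text \<open>The mechanical energy passes to the limit with equality in the first-order terms and an
  inequality in the bending term. For the electrostatic energy a single \<phi> that is almost
  optimal for the limit u gives a lower bound along the sequence, and this bound converges.\<close>

lemma energy_lsc:
  assumes dvn: "\<And>n. defl H L (un n) (vn n) (wn n)" and B: "\<And>n. nsq (lebesgue_on (D L)) (wn n) \<le> B"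
    and \<beta>: "\<beta> > 0" and m: "(\<lambda>n. total_energy H L d \<beta> \<tau> a \<sigma>\<^sub>1 \<sigma>\<^sub>2 h\<^sub>1 h\<^sub>2 (un n)) \<longlonglongrightarrow> m"
  obtains u v w where "defl H L u v w" "total_energy H L d \<beta> \<tau> a \<sigma>\<^sub>1 \<sigma>\<^sub>2 h\<^sub>1 h\<^sub>2 u \<le> m"
proof -
  let ?M = "lebesgue_on (D L)" and ?E = "total_energy H L d \<beta> \<tau> a \<sigma>\<^sub>1 \<sigma>\<^sub>2 h\<^sub>1 h\<^sub>2"
  obtain k v \<mu> where k: "strict_mono (k::nat \<Rightarrow> nat)" and v: "continuous_on {-L..L} v"
    and lim: "\<And>e. e > 0 \<Longrightarrow> \<exists>N. \<forall>n x. n \<ge> N \<and> x \<in> {-L..L} \<longrightarrow> \<bar>vn (k n) x - v x\<bar> < e"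
    and lam: "(\<lambda>n. nsq ?M (wn (k n))) \<longlonglongrightarrow> \<mu>"
  proof (rule defl_compactness[OF L, where H=H and un=un and vn=vn and wn=wn and B=B, OF dvn B])
    fix k :: "nat \<Rightarrow> nat" and v \<mu>
    assume l: "strict_mono k" "continuous_on {-L..L} v"
      "\<And>e. e > 0 \<Longrightarrow> \<exists>N. \<forall>n x. n \<ge> N \<and> x \<in> {-L..L} \<longrightarrow> \<bar>vn (k n) x - v x\<bar> < e"
      "(\<lambda>n. nsq ?M (wn (k n))) \<longlonglongrightarrow> \<mu>"
    show thesis by (rule that[OF l])
  qed
  define u where "u x = integral {-L..x} v" for x
  note dk = dvn[of "k n" for n]
  have "\<exists>w. defl H L (\<lambda>x. integral {-L..x} v) v w \<and> nsq ?M w \<le> \<mu>"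
    by (rule defl_limit(2)[OF L dk v _ lam]) (rule lim)
  then obtain w where dv: "defl H L u v w" and w: "nsq ?M w \<le> \<mu>" unfolding u_def[abs_def] by blast
  have unif: "\<forall>\<^sub>F n in sequentially. \<forall>x\<in>{-L..L}. \<bar>un (k n) x - u x\<bar> < e" if "e > 0" for e
    unfolding u_def by (rule defl_limit(1)[OF L dk v _ lam that]) (rule lim)
  have pt: "(\<lambda>n. vn (k n) x) \<longlonglongrightarrow> v x" if x: "x \<in> {-L..L}" for x
  proof (rule LIMSEQ_I)
    fix r :: real assume "r > 0"
    then obtain N where "\<forall>n x. n \<ge> N \<and> x \<in> {-L..L} \<longrightarrow> \<bar>vn (k n) x - v x\<bar> < r" using lim by metis
    then show "\<exists>no. \<forall>n\<ge>no. norm (vn (k n) x - v x) < r" using x by (intro exI[of _ N]) auto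
  qed
  note ak = deflD[OF dk] and a' = deflD[OF dv]
  have vk0: "(\<lambda>n. nsq ?M (\<lambda>x. vn (k n) x - v x)) \<longlonglongrightarrow> 0"
  proof (rule LIMSEQ_I)
    fix r :: real assume r: "r > 0"
    \<comment> \<open>Chosen so that the bound 2 L e^2 equals r/2.\<close>
    define e where "e = sqrt (r / (4 * L))"
    have e: "e > 0" "e\<^sup>2 = r / (4 * L)" using r L by (auto simp: e_def)
    obtain N where N: "\<And>n x. n \<ge> N \<Longrightarrow> x \<in> {-L..L} \<Longrightarrow> \<bar>vn (k n) x - v x\<bar> < e" using lim[OF e(1)] by metis
    have "norm (nsq ?M (\<lambda>x. vn (k n) x - v x) - 0) < r" if "n \<ge> N" for n
    proof -
      have "nsq ?M (\<lambda>x. vn (k n) x - v x) \<le> 2 * L * e\<^sup>2"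
        using L v ak(1) N[OF that] by (intro continuous_interval_nsq_le continuous_intros) (auto intro: less_imp_le)
      also have "\<dots> < r" using r L e(2) by simp
      finally show ?thesis by simp
    qed
    then show "\<exists>no. \<forall>n\<ge>no. norm (nsq ?M (\<lambda>x. vn (k n) x - v x) - 0) < r" by blast
  qed
  have vk: "(\<lambda>n. nsq ?M (vn (k n))) \<longlonglongrightarrow> nsq ?M v" by (rule sqint_tendsto_nsq[OF ak(12) a'(12) vk0])
  define R where "R = sqrt (2 * L * (4 * L\<^sup>2 * B)) + sqrt (2 * L * B)"
  have B0: "B \<ge> 0" using B[of 0] nsq_nonneg[of ?M "wn 0"] by linarith
  have R: "\<bar>un (k n) x\<bar> \<le> R" "\<bar>vn (k n) x\<bar> \<le> R" if x: "x \<in> {-L..L}" for n x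
  proof -
    note b = defl_bounds[OF L dk]
    have "4 * L\<^sup>2 * nsq ?M (wn (k n)) \<le> 4 * L\<^sup>2 * B" using B by (intro mult_left_mono) auto
    then have Y: "nsq ?M (vn (k n)) \<le> 4 * L\<^sup>2 * B" using b(3)[of n] by linarith
    have "(un (k n) x)\<^sup>2 \<le> 2 * L * (4 * L\<^sup>2 * B)" using b(4)[OF x, of n] mult_left_mono[OF Y, of "2 * L"] L by linarith
    then have 1: "\<bar>un (k n) x\<bar> \<le> sqrt (2 * L * (4 * L\<^sup>2 * B))" by (simp add: real_le_rsqrt)
    have "(vn (k n) x)\<^sup>2 \<le> 2 * L * B" using b(2)[OF x, of n] mult_left_mono[OF B[of "k n"], of "2 * L"] L by linarith
    then have 2: "\<bar>vn (k n) x\<bar> \<le> sqrt (2 * L * B)" by (simp add: real_le_rsqrt)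
    have "0 \<le> sqrt (2 * L * (4 * L\<^sup>2 * B))" "0 \<le> sqrt (2 * L * B)" using L B0 by simp_all
    with 1 2 show "\<bar>un (k n) x\<bar> \<le> R" "\<bar>vn (k n) x\<bar> \<le> R" unfolding R_def by linarith+
  qed
  have "?E u \<le> m + e" if e: "e > 0" for e
  proof -
    \<comment> \<open>Almost optimal for u, while for the deflections of the sequence it serves only
      as one competitor. Thus \<phi> does not depend on n, and the error e is removed at the
      end.\<close>
    obtain \<phi> where \<phi>: "\<phi> \<in> test_functions (Om u)" "E_e H L d \<sigma>\<^sub>1 \<sigma>\<^sub>2 h\<^sub>1 h\<^sub>2 u \<le> - (1/2) * J u v \<phi> + e"
      using E_e_variational(2)[OF dv e] by blast
    have Jt: "\<forall>\<^sub>F n in sequentially. \<phi> \<in> test_functions (Om (un (k n)))"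
      "(\<lambda>n. J (un (k n)) (vn (k n)) \<phi>) \<longlonglongrightarrow> J u v \<phi>"
      by (rule J_tendsto[where R=R, OF dv dk _ _ _ _ \<phi>(1)]; (rule unif pt R, assumption))+
    let ?low = "\<lambda>n. \<beta> / 2 * nsq ?M (wn (k n)) + (\<tau> / 2 + a / 4 * nsq ?M (vn (k n))) * nsq ?M (vn (k n)) - (1/2) * J (un (k n)) (vn (k n)) \<phi>"
    have "?low \<longlonglongrightarrow> \<beta> / 2 * \<mu> + (\<tau> / 2 + a / 4 * nsq ?M v) * nsq ?M v - (1/2) * J u v \<phi>"
      by (intro tendsto_intros lam vk Jt(2))
    moreover have "(\<lambda>n. ?E (un (k n))) \<longlonglongrightarrow> m" using LIMSEQ_subseq_LIMSEQ[OF m k] by (simp add: o_def)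
    moreover have "\<forall>\<^sub>F n in sequentially. ?low n \<le> ?E (un (k n))"
      using Jt(1)
    proof eventually_elim
      case (elim n)
      show ?case unfolding total_energy_def E_m_eq[OF dk] using E_e_variational(1)[OF dk elim] by linarith
    qed
    ultimately have "\<beta> / 2 * \<mu> + (\<tau> / 2 + a / 4 * nsq ?M v) * nsq ?M v - (1/2) * J u v \<phi> \<le> m"
      by (intro tendsto_le[OF sequentially_bot])
    moreover have "\<beta> / 2 * nsq ?M w \<le> \<beta> / 2 * \<mu>" using w \<beta> by (intro mult_left_mono) auto
    ultimately show ?thesis unfolding total_energy_def E_m_eq[OF dv] using \<phi>(2) by linarith
  qed
  then have "?E u \<le> m" by (rule field_le_epsilon)
  with dv show ?thesis by (rule that)
qed

lemma zero_defl: "defl H L (\<lambda>x. 0) (\<lambda>x. 0) (\<lambda>x. 0)"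
  unfolding defl_def using H zero_weak_pderiv by auto

lemma energy_minimizer:
  assumes A3: "A3 H L d m\<^sub>1 m\<^sub>2 m\<^sub>3 h\<^sub>1 h\<^sub>2" and m: "m\<^sub>1 > 0" "m\<^sub>2 > 0" "m\<^sub>3 > 0"
    and \<beta>: "\<beta> > 0" "\<tau> \<ge> 0" "a \<ge> 0" and K: "max a (frak_K H L d \<beta> \<tau> \<sigma>\<^sub>1 \<sigma>\<^sub>2 m\<^sub>2 m\<^sub>3) > 0"
  shows "\<exists>u\<in>S0bar H L. \<forall>u'\<in>S0bar H L. total_energy H L d \<beta> \<tau> a \<sigma>\<^sub>1 \<sigma>\<^sub>2 h\<^sub>1 h\<^sub>2 u \<le> total_energy H L d \<beta> \<tau> a \<sigma>\<^sub>1 \<sigma>\<^sub>2 h\<^sub>1 h\<^sub>2 u'"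
proof -
  let ?M = "lebesgue_on (D L)" and ?E = "total_energy H L d \<beta> \<tau> a \<sigma>\<^sub>1 \<sigma>\<^sub>2 h\<^sub>1 h\<^sub>2"
  obtain \<kappa> c where \<kappa>: "\<kappa> > 0" and co: "\<And>u v w. defl H L u v w \<Longrightarrow> \<kappa> * nsq ?M w \<le> ?E u + c"
    by (rule energy_coercive[OF A3 m \<beta> K]) blast
  define I where "I = Inf (?E ` S0bar H L)"
  have ne: "?E ` S0bar H L \<noteq> {}" using zero_defl S0bar_iff[OF L] by blast
  have lower: "- c \<le> ?E u" if uS: "u \<in> S0bar H L" for u
  proof -
    obtain v w where "defl H L u v w" using uS S0bar_iff[OF L] by blast
    then have "\<kappa> * nsq ?M w \<le> ?E u + c" by (rule co)
    moreover have "0 \<le> \<kappa> * nsq ?M w" using \<kappa> by simp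
    ultimately show ?thesis by linarith
  qed
  have bb: "bdd_below (?E ` S0bar H L)" using lower by (intro bdd_belowI[of _ "-c"]) auto
  have I_le: "I \<le> ?E u" if "u \<in> S0bar H L" for u unfolding I_def using bb that by (intro cInf_lower) auto
  have "\<exists>u v w. defl H L u v w \<and> ?E u < I + 1 / (real n + 1)" for n
  proof -
    have "\<exists>y\<in>?E ` S0bar H L. y < I + 1 / (real n + 1)" using ne by (intro cInf_lessD) (auto simp: I_def[symmetric])
    then show ?thesis using S0bar_iff[OF L] by blast
  qed
  then obtain un vn wn where dvn: "\<And>n. defl H L (un n) (vn n) (wn n)" and En: "\<And>n. ?E (un n) < I + 1 / (real n + 1)" by metis
  have unS: "un n \<in> S0bar H L" for n using dvn S0bar_iff[OF L] by blast
  \<comment> \<open>All members of the minimizing sequence have energy at most I + 1, which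
    coercivity turns into a common bound on the second derivatives.\<close>
  have B: "nsq ?M (wn n) \<le> (I + 1 + c) / \<kappa>" for n
  proof -
    have "1 / (real n + 1) \<le> 1" by simp
    then have "\<kappa> * nsq ?M (wn n) \<le> I + 1 + c" using co[OF dvn[of n]] En[of n] by linarith
    then show ?thesis using \<kappa> by (simp add: pos_le_divide_eq mult.commute)
  qed
  have lim: "(\<lambda>n. ?E (un n)) \<longlonglongrightarrow> I"
  proof (rule tendsto_sandwich[where f = "\<lambda>n. I" and h = "\<lambda>n. I + 1 / (real n + 1)"])
    have "(\<lambda>n. 1 / (real n + 1)) \<longlonglongrightarrow> 0" using LIMSEQ_inverse_real_of_nat by (simp add: inverse_eq_divide add.commute)
    from tendsto_add[OF tendsto_const[of I] this] show "(\<lambda>n. I + 1 / (real n + 1)) \<longlonglongrightarrow> I" by simp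
    show "(\<lambda>n. I) \<longlonglongrightarrow> I" by simp
    show "\<forall>\<^sub>F n in sequentially. I \<le> ?E (un n)" by (intro always_eventually allI I_le unS)
    show "\<forall>\<^sub>F n in sequentially. ?E (un n) \<le> I + 1 / (real n + 1)" by (intro always_eventually allI less_imp_le En)
  qed
  obtain u v w where u: "defl H L u v w" "?E u \<le> I"
    by (rule energy_lsc[OF dvn B \<beta>(1) lim])
  have "u \<in> S0bar H L" using u(1) S0bar_iff[OF L] by blast
  moreover have "?E u \<le> ?E u'" if "u' \<in> S0bar H L" for u' using u(2) I_le[OF that] by linarith
  ultimately show ?thesis by blast
qed

end

theorem theorem5p1:
  fixes H L d V \<beta> \<tau> a \<sigma>\<^sub>2 m\<^sub>1 m\<^sub>2 m\<^sub>3 :: real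
    and \<sigma>\<^sub>1 :: "real \<times> real \<Rightarrow> real"
    and h\<^sub>1 h\<^sub>2 :: "real \<times> real \<times> real \<Rightarrow> real"
  assumes "H > 0" and "L > 0" and "d > 0" and "V > 0" and "\<beta> > 0" and "\<tau> \<ge> 0" and "a \<ge> 0"
    and "admissible_sigma H L d \<sigma>\<^sub>1 \<sigma>\<^sub>2"
    and "A1 H L d \<sigma>\<^sub>1 \<sigma>\<^sub>2 h\<^sub>1 h\<^sub>2"
    and "A2 H L d V h\<^sub>1 h\<^sub>2"
    and "m\<^sub>1 > 0" and "m\<^sub>2 > 0" and "m\<^sub>3 > 0" and "A3 H L d m\<^sub>1 m\<^sub>2 m\<^sub>3 h\<^sub>1 h\<^sub>2"
    and "max a (frak_K H L d \<beta> \<tau> \<sigma>\<^sub>1 \<sigma>\<^sub>2 m\<^sub>2 m\<^sub>3) > 0"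
  shows "\<exists>u\<^sub>m\<in>S0bar H L. \<forall>u\<in>S0bar H L.
           total_energy H L d \<beta> \<tau> a \<sigma>\<^sub>1 \<sigma>\<^sub>2 h\<^sub>1 h\<^sub>2 u\<^sub>m
             \<le> total_energy H L d \<beta> \<tau> a \<sigma>\<^sub>1 \<sigma>\<^sub>2 h\<^sub>1 h\<^sub>2 u"
proof -
  interpret mems H L d \<sigma>\<^sub>2 \<sigma>\<^sub>1 h\<^sub>1 h\<^sub>2 by unfold_locales (use assms in auto)
  show ?thesis by (rule energy_minimizer[OF assms(14) assms(11-13) assms(5-7) assms(15)])
qed

end
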